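(* Assume $\boldsymbol\alpha\in\mathcal D_k$ for some integer $k\ge q$. Then, as $n\to\infty$, $$\Big(\frac{\chi_n(t)}{n^{\tau_k(\boldsymbol\alpha)}},\ t\ge 0\Big)\to \frac{(-1)^k}{(k+1)!}\quad\text{almost surely}$$ and $$\Big(\frac{\beta_{k,n}(t)}{n^{\tau_k(\boldsymbol\alpha)}},\ t\ge 0\Big)\to \frac{1}{(k+1)!}\quad\text{almost surely}$$ in the Skorohod $J_1$-topology on $D[0,\infty)$, where the right-hand sides are viewed as constant functions in $D[0,\infty)$.
   Context: Parameters. Let $\boldsymbol\alpha=(\alpha_1,\alpha_2,\dots)$ with $\alpha_i\in[0,\infty]$, not all zero, and for each $n$ let $p_i=n^{-\alpha_i}$ (with $n^{-\infty}=0$). Let $q=\min\{i\ge1:\alpha_i>0\}$. For $j\ge1$ put $\psi_j(\boldsymbol\alpha)=\sum_{i=1}^j\binom ji\alpha_i$ and $\tau_j(\boldsymbol\alpha)=j+1-\sum_{i=1}^j\binom{j+1}{i+1}\alpha_i$. For $k\ge1$ let $\mathcal D_k=\{\boldsymbol\alpha:\psi_k(\boldsymbol\alpha)<1<\psi_{k+1}(\boldsymbol\alpha)\}$. On/off processes. For each $i\ge1$ let $G_i$ be the distribution function of a positive random variable with finite mean $\mu_i>0$ (not depending on $n$), and $(G_i)_e(x)=\mu_i^{-1}\int_0^x(1-G_i(y))\,dy$. Standing assumption: there is $a>0$ with $G_i(a)\le 1/2$ for all $i\ge q$. Let $D^{(i)}$ have distribution function $(G_i)_e$, let $Z^{(i)}_2,Z^{(i)}_3,\dots$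 be i.i.d. with distribution $G_i$, and $I^{(i)}_0,I^{(i)}_1,\dots$ i.i.d. Bernoulli with parameter $p_i$, all independent. Put $S^{(i)}_0=0$, $S^{(i)}_1=D^{(i)}$, $S^{(i)}_j=D^{(i)}+\sum_{l=2}^jZ^{(i)}_l$ for $j\ge2$, and $\Delta_i(t)=\sum_{j\ge0}\mathbf 1\{S^{(i)}_j\le t<S^{(i)}_{j+1}\}I^{(i)}_j$, $t\ge0$. Dynamic complex. For each $n$ take independent processes $\Delta_{i,A}$, $1\le i\le n-1$, $A\subseteq[n]=\{1,\dots,n\}$, $|A|=i+1$, with $\Delta_{i,A}$ distributed as $\Delta_i$. The complex $X([n],\mathbf p;t)$ has vertex set $[n]$, and a set $A\subseteq[n]$ with $|A|\ge2$ is a face at time $t$ iff $\Delta_{|B|-1,B}(t)=1$ for all $B\subseteq A$ with $|B|\ge2$. The complexes for different $n$ are defined on a common probability space. $\beta_{j,n}(t)$ is the $j$th reduced Betti number (rational coefficients) of $X([n],\mathbf p;t)$, and $\chi_n(t)=\sum_{j=0}^{n-1}(-1)^jf_{j,n}(t)$ is its Euler characteristic, where $f_{j,n}(t)$ is the number of $j$-dimensional faces of $X([n],\mathbf p;t)$. $D[0,\infty)$ is the space of right-continuous real functions on $[0,\infty)$ with left limits. *)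

theory Defs
  imports "HOL-Probability.Probability" "HOL-Library.Poly_Mapping"
begin

text \<open>The exponents are \<open>\<alpha> 1, \<alpha> 2, \<dots>\<close>; the value \<open>\<alpha> 0\<close> is never used.\<close>

definition face_prob :: "ereal \<Rightarrow> nat \<Rightarrow> real" where
  "face_prob a n = (if a = \<infinity> then 0 else real n powr (- real_of_ereal a))"

definition q_index :: "(nat \<Rightarrow> ereal) \<Rightarrow> nat" where
  "q_index \<alpha> = (LEAST i. 1 \<le> i \<and> 0 < \<alpha> i)"

definition psi :: "nat \<Rightarrow> (nat \<Rightarrow> ereal) \<Rightarrow> ereal" where
  "psi j \<alpha> = (\<Sum>i=1..j. ereal (real (j choose i)) * \<alpha> i)"

definition tau :: "nat \<Rightarrow> (nat \<Rightarrow> ereal) \<Rightarrow> ereal" where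
  "tau j \<alpha> = ereal (real j + 1) - (\<Sum>i=1..j. ereal (real ((j + 1) choose (i + 1))) * \<alpha> i)"

definition param_region :: "nat \<Rightarrow> (nat \<Rightarrow> ereal) set" where
  "param_region k = {\<alpha>. psi k \<alpha> < 1 \<and> 1 < psi (k + 1) \<alpha>}"

text \<open>A distribution function \<open>G\<close> is represented by its law \<open>\<nu>\<close>, so that \<open>G = cdf \<nu>\<close>.\<close>

definition law_mean :: "real measure \<Rightarrow> real" where
  "law_mean \<nu> = (LINT x|\<nu>. x)"

definition positive_finite_mean_law :: "real measure \<Rightarrow> bool" where
  "positive_finite_mean_law \<nu> \<longleftrightarrow>
     real_distribution \<nu> \<and> (AE x in \<nu>. 0 < x) \<and> integrable \<nu> (\<lambda>x. x) \<and> 0 < law_mean \<nu>"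

text \<open>For \<open>x < 0\<close> the interval \<open>{0..x}\<close> is empty, so the function vanishes there.\<close>

definition equilibrium_cdf :: "real measure \<Rightarrow> real \<Rightarrow> real" where
  "equilibrium_cdf \<nu> x = (LINT y:{0..x}|lborel. 1 - cdf \<nu> y) / law_mean \<nu>"

definition switch_time :: "real \<Rightarrow> (nat \<Rightarrow> real) \<Rightarrow> nat \<Rightarrow> real" where
  "switch_time d z j = (if j = 0 then 0 else d + (\<Sum>l=2..j. z l))"

definition onoff :: "real \<Rightarrow> (nat \<Rightarrow> real) \<Rightarrow> (nat \<Rightarrow> bool) \<Rightarrow> real \<Rightarrow> real" where
  "onoff d z b t =
     suminf (\<lambda>j. of_bool (switch_time d z j \<le> t \<and> t < switch_time d z (Suc j)) * of_bool (b j))"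

abbreviation path_measurable_space :: "(real \<Rightarrow> real) measure" where
  "path_measurable_space \<equiv> PiM {0..} (\<lambda>_. borel)"

text \<open>
  The law, on the product \<sigma>-algebra, of the process \<open>\<Delta>\<close> built from independent
  \<open>D\<close> (with distribution function \<open>equilibrium_cdf \<nu>\<close>), \<open>Z 2, Z 3, \<dots>\<close> (i.i.d. with law \<open>\<nu>\<close>) and
  \<open>I 0, I 1, \<dots>\<close> (i.i.d. Bernoulli with parameter \<open>p\<close>).
\<close>

definition onoff_law :: "real measure \<Rightarrow> real \<Rightarrow> (real \<Rightarrow> real) measure" where
  "onoff_law \<nu> p =
     distr (interval_measure (equilibrium_cdf \<nu>) \<Otimes>\<^sub>M
              (PiM {2..} (\<lambda>_. \<nu>) \<Otimes>\<^sub>M PiM UNIV (\<lambda>_. measure_pmf (bernoulli_pmf p))))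
       path_measurable_space (\<lambda>(d, z, b). \<lambda>t\<in>{0..}. onoff d z b t)"

text \<open>Elements of \<open>D[0,\<infinity>)\<close> are represented by functions that are \<open>undefined\<close> off \<open>[0,\<infinity>)\<close>.\<close>

definition cadlag :: "(real \<Rightarrow> real) set" where
  "cadlag = {x \<in> extensional {0..}.
     (\<forall>t\<ge>0. continuous (at_right t) x) \<and> (\<forall>t>0. \<exists>l. (x \<longlongrightarrow> l) (at_left t))}"

text \<open>
  The metric is the one of Ethier and Kurtz (Markov Processes, Section 3.5): the infimum over time
  changes \<open>\<theta>\<close> of \<open>\<gamma>(\<theta>) \<or> \<integral>\<^sub>0\<^sup>\<infinity> e\<^bsup>-u\<^esup> sup\<^sub>t (1 \<and> \<bar>x(t\<and>u) - y(\<theta>(t)\<and>u)\<bar>) du\<close>, where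
  \<open>\<gamma>(\<theta>) = sup\<^bsub>s>t\<ge>0\<^esub> \<bar>log ((\<theta>(s) - \<theta>(t)) / (s - t))\<bar>\<close> is required to be finite.
\<close>

definition log_slopes :: "(real \<Rightarrow> real) \<Rightarrow> real set" where
  "log_slopes \<theta> = {\<bar>ln ((\<theta> s - \<theta> t) / (s - t))\<bar> | s t. 0 \<le> t \<and> t < s}"

definition time_changes :: "(real \<Rightarrow> real) set" where
  "time_changes = {\<theta>. strict_mono_on {0..} \<theta> \<and> \<theta> ` {0..} = {0..} \<and> bdd_above (log_slopes \<theta>)}"

definition skorohod_dist :: "(real \<Rightarrow> real) \<Rightarrow> (real \<Rightarrow> real) \<Rightarrow> real" where
  "skorohod_dist x y = (INF \<theta>\<in>time_changes.
     max (Sup (log_slopes \<theta>))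
         (LINT u:{0..}|lborel. exp (- u) * (SUP t\<in>{0..}. min 1 \<bar>x (min t u) - y (min (\<theta> t) u)\<bar>)))"

definition skorohod_J1 :: "(real \<Rightarrow> real) topology" where
  "skorohod_J1 = topology (\<lambda>U. U \<subseteq> cadlag \<and>
     (\<forall>x\<in>U. \<exists>e>0. \<forall>y\<in>cadlag. skorohod_dist x y < e \<longrightarrow> y \<in> U))"

lemma openin_skorohod_J1:
  "openin skorohod_J1 U \<longleftrightarrow>
     U \<subseteq> cadlag \<and> (\<forall>x\<in>U. \<exists>e>0. \<forall>y\<in>cadlag. skorohod_dist x y < e \<longrightarrow> y \<in> U)"
proof -
  let ?P = "\<lambda>U. U \<subseteq> cadlag \<and>
     (\<forall>x\<in>U. \<exists>e>0. \<forall>y\<in>cadlag. skorohod_dist x y < e \<longrightarrow> y \<in> U)"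
  have "istopology ?P"
    unfolding istopology_def
  proof (intro conjI allI impI)
    fix S T assume S: "?P S" and T: "?P T"
    show "S \<inter> T \<subseteq> cadlag" using S by blast
    show "\<forall>x\<in>S \<inter> T. \<exists>e>0. \<forall>y\<in>cadlag. skorohod_dist x y < e \<longrightarrow> y \<in> S \<inter> T"
    proof
      fix x assume x: "x \<in> S \<inter> T"
      obtain d where d: "d > 0" "\<forall>y\<in>cadlag. skorohod_dist x y < d \<longrightarrow> y \<in> S"
        using S x by blast
      obtain e where e: "e > 0" "\<forall>y\<in>cadlag. skorohod_dist x y < e \<longrightarrow> y \<in> T"
        using T x by blast
      show "\<exists>e>0. \<forall>y\<in>cadlag. skorohod_dist x y < e \<longrightarrow> y \<in> S \<inter> T"
        using d e by (intro exI[of _ "min d e"]) auto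
    qed
  next
    fix \<K> assume K: "\<forall>U\<in>\<K>. ?P U"
    show "\<Union>\<K> \<subseteq> cadlag" using K by blast
    show "\<forall>x\<in>\<Union>\<K>. \<exists>e>0. \<forall>y\<in>cadlag. skorohod_dist x y < e \<longrightarrow> y \<in> \<Union>\<K>"
      using K by (meson UnionE UnionI)
  qed
  then show ?thesis
    unfolding skorohod_J1_def by (simp add: topology_inverse')
qed

lemma topspace_skorohod_J1: "topspace skorohod_J1 = cadlag"
proof -
  have "openin skorohod_J1 cadlag"
    unfolding openin_skorohod_J1 by (auto intro: exI[of _ 1])
  then show ?thesis
    by (metis openin_skorohod_J1 openin_subset openin_topspace subset_antisym)
qed

text \<open>A complex is the set of its nonempty faces.\<close>

definition faces :: "nat set set \<Rightarrow> nat \<Rightarrow> nat set set" where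
  "faces K j = {A \<in> K. card A = j + 1}"

definition euler_char :: "nat \<Rightarrow> nat set set \<Rightarrow> real" where
  "euler_char n K = (\<Sum>j<n. (-1) ^ j * real (card (faces K j)))"

text \<open>
  Rational chains are finite formal combinations of vertex sets, each oriented by the order of
  \<open>nat\<close>. The boundary of a vertex is the empty set, so the chain complex is the augmented one
  and yields reduced homology.
\<close>

type_synonym rat_chain = "nat set \<Rightarrow>\<^sub>0 rat"

definition scale_chain :: "rat \<Rightarrow> rat_chain \<Rightarrow> rat_chain" where
  "scale_chain r = Poly_Mapping.map ((*) r)"

lemma lookup_scale_chain [simp]:
  "Poly_Mapping.lookup (scale_chain r c) A = r * Poly_Mapping.lookup c A"
  by (simp add: scale_chain_def Poly_Mapping.map.rep_eq when_def)

global_interpretation chain_space: vector_space scale_chain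
  defines chain_dim = chain_space.dim
  by unfold_locales (auto simp: lookup_add algebra_simps intro!: poly_mapping_eqI)

definition chain_boundary :: "rat_chain \<Rightarrow> rat_chain" where
  "chain_boundary c = (\<Sum>A\<in>Poly_Mapping.keys c. \<Sum>v\<in>A.
     Poly_Mapping.single (A - {v}) ((-1) ^ card {w \<in> A. w < v} * Poly_Mapping.lookup c A))"

definition chains :: "nat set set \<Rightarrow> nat \<Rightarrow> rat_chain set" where
  "chains K j = {c. Poly_Mapping.keys c \<subseteq> faces K j}"

definition cycles :: "nat set set \<Rightarrow> nat \<Rightarrow> rat_chain set" where
  "cycles K j = {c \<in> chains K j. chain_boundary c = 0}"

definition boundaries :: "nat set set \<Rightarrow> nat \<Rightarrow> rat_chain set" where
  "boundaries K j = chain_boundary ` chains K (j + 1)"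

lemma chain_boundary_superset:
  assumes "finite S" "Poly_Mapping.keys c \<subseteq> S"
  shows "chain_boundary c = (\<Sum>A\<in>S. \<Sum>v\<in>A.
     Poly_Mapping.single (A - {v}) ((-1) ^ card {w \<in> A. w < v} * Poly_Mapping.lookup c A))"
  unfolding chain_boundary_def
  by (rule sum.mono_neutral_left) (use assms in \<open>auto simp: in_keys_iff\<close>)

lemma chain_boundary_add: "chain_boundary (c + d) = chain_boundary c + chain_boundary d"
proof -
  let ?S = "Poly_Mapping.keys c \<union> Poly_Mapping.keys d"
  have "Poly_Mapping.keys (c + d) \<subseteq> ?S" by (rule keys_add)
  then show ?thesis
    by (subst (1 2 3) chain_boundary_superset[of ?S])
      (auto simp: lookup_add distrib_left single_add sum.distrib)
qed

lemma chain_boundary_0 [simp]: "chain_boundary 0 = 0"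
  by (simp add: chain_boundary_def)

lemma chain_boundary_sum: "chain_boundary (sum f S) = (\<Sum>x\<in>S. chain_boundary (f x))"
  by (induction S rule: infinite_finite_induct) (auto simp: chain_boundary_add)

lemma chain_boundary_single:
  "chain_boundary (Poly_Mapping.single A r) =
     (\<Sum>v\<in>A. Poly_Mapping.single (A - {v}) ((-1) ^ card {w \<in> A. w < v} * r))"
  by (subst chain_boundary_superset[of "{A}"]) auto

lemma chain_boundary_boundary_single:
  "chain_boundary (chain_boundary (Poly_Mapping.single A r)) = 0"
proof (cases "finite A")
  case False
  then show ?thesis by (simp add: chain_boundary_single)
next
  case fin: True
  define F where "F v w = Poly_Mapping.single (A - {v} - {w})
     ((-1) ^ card {u \<in> A - {v}. u < w} * ((-1) ^ card {u \<in> A. u < v} * r))" for v w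
  have swap: "F v w = - F w v" if "v < w" "v \<in> A" "w \<in> A" for v w
  proof -
    have *: "{u \<in> A - {w}. u < v} = {u \<in> A. u < v}" using that by auto
    have "{u \<in> A. u < w} = insert v {u \<in> A - {v}. u < w}" using that by auto
    then have "card {u \<in> A. u < w} = Suc (card {u \<in> A - {v}. u < w})"
      using fin by (simp add: card_insert_if)
    moreover have "A - {w} - {v} = A - {v} - {w}" by auto
    ultimately show ?thesis
      unfolding F_def * by (simp add: single_uminus[symmetric] mult_ac)
  qed
  let ?P = "{(v, w). v \<in> A \<and> w \<in> A \<and> v \<noteq> w}"
  let ?L = "{(v, w). v \<in> A \<and> w \<in> A \<and> v < w}"
  let ?G = "{(v, w). v \<in> A \<and> w \<in> A \<and> w < v}"
  have finL: "finite ?L" "finite ?G"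
    by (rule finite_subset[of _ "A \<times> A"]; use fin in auto)+
  have "chain_boundary (chain_boundary (Poly_Mapping.single A r)) =
      (\<Sum>v\<in>A. \<Sum>w\<in>A - {v}. F v w)"
    by (simp add: chain_boundary_single chain_boundary_sum F_def)
  also have "\<dots> = (\<Sum>(v, w)\<in>?P. F v w)"
  proof (subst sum.Sigma)
    have "Sigma A (\<lambda>v. A - {v}) = ?P" by auto
    then show "(\<Sum>(v, w)\<in>Sigma A (\<lambda>v. A - {v}). F v w) = (\<Sum>(v, w)\<in>?P. F v w)" by simp
  qed (use fin in auto)
  also have "?P = ?L \<union> ?G" by auto
  also have "(\<Sum>(v, w)\<in>?L \<union> ?G. F v w) = (\<Sum>(v, w)\<in>?L. F v w) + (\<Sum>(v, w)\<in>?G. F v w)"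
    by (rule sum.union_disjoint) (use finL in auto)
  also have "(\<Sum>(v, w)\<in>?G. F v w) = (\<Sum>(v, w)\<in>?L. F w v)"
    by (rule sum.reindex_bij_witness[of _ prod.swap prod.swap]) auto
  also have "\<dots> = - (\<Sum>(v, w)\<in>?L. F v w)"
    unfolding sum_negf[symmetric] by (rule sum.cong) (auto simp: swap)
  finally show ?thesis by simp
qed

lemma chain_boundary_boundary: "chain_boundary (chain_boundary c) = 0"
proof -
  have "chain_boundary (chain_boundary c) =
      (\<Sum>A\<in>Poly_Mapping.keys c.
         chain_boundary (chain_boundary (Poly_Mapping.single A (Poly_Mapping.lookup c A))))"
    by (subst (2) chain_boundary_def)
      (simp only: chain_boundary_single chain_boundary_sum)
  then show ?thesis by (simp add: chain_boundary_boundary_single)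
qed

lemma boundaries_subset_cycles:
  assumes "\<And>A B. A \<in> K \<Longrightarrow> B \<subseteq> A \<Longrightarrow> B \<noteq> {} \<Longrightarrow> B \<in> K"
  shows "boundaries K j \<subseteq> cycles K j"
proof
  fix b assume "b \<in> boundaries K j"
  then obtain c where c: "Poly_Mapping.keys c \<subseteq> faces K (j + 1)" and b: "b = chain_boundary c"
    by (auto simp: boundaries_def chains_def)
  have face: "A - {v} \<in> faces K j" if "A \<in> faces K (j + 1)" "v \<in> A" for A v
  proof -
    have "card A = j + 2" "A \<in> K" using that by (auto simp: faces_def)
    then have "card (A - {v}) = j + 1" using that(2) by simp
    then have "A - {v} \<noteq> {}" by force
    then show ?thesis
      using assms[OF \<open>A \<in> K\<close>, of "A - {v}"] \<open>card (A - {v}) = j + 1\<close> by (auto simp: faces_def)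
  qed
  have "Poly_Mapping.keys b \<subseteq> faces K j"
    unfolding b chain_boundary_def
    by (rule subset_trans[OF Poly_Mapping.keys_sum] UN_least)+ (use c face in auto)
  then show "b \<in> cycles K j"
    by (simp add: cycles_def chains_def b chain_boundary_boundary)
qed

text \<open>
  The dimension of the quotient \<open>cycles K j / boundaries K j\<close>. For a simplicial complex
  \<open>boundaries K j \<subseteq> cycles K j\<close>, so the subtraction does not truncate
  (\<open>boundaries_subset_cycles\<close>).
\<close>

definition reduced_betti :: "nat set set \<Rightarrow> nat \<Rightarrow> nat" where
  "reduced_betti K j = chain_dim (cycles K j) - chain_dim (boundaries K j)"

text \<open>
  The process attached to a vertex set \<open>A\<close> is indexed by \<open>A\<close> alone, its dimension being
  \<open>card A - 1\<close>.
\<close>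

definition cells :: "nat \<Rightarrow> nat set set" where
  "cells n = {A. A \<subseteq> {1..n} \<and> 2 \<le> card A}"

definition complex_at :: "nat \<Rightarrow> (nat set \<Rightarrow> real) \<Rightarrow> nat set set" where
  "complex_at n X = {A. A \<subseteq> {1..n} \<and> A \<noteq> {} \<and> (\<forall>B\<subseteq>A. 2 \<le> card B \<longrightarrow> X B = 1)}"

text \<open>
  \<open>\<Delta> n A t \<omega>\<close> is the state at time \<open>t\<close> of the process attached to \<open>A\<close> in the complex on
  \<open>{1..n}\<close>. The processes are random elements of \<open>D[0,\<infinity>)\<close>: their law on the product
  \<sigma>-algebra is prescribed and their paths are almost surely cadlag. Nothing is assumed about the
  joint law for different \<open>n\<close>.
\<close>

definition dynamic_processes ::
    "'w measure \<Rightarrow> (nat \<Rightarrow> ereal) \<Rightarrow> (nat \<Rightarrow> real measure) \<Rightarrow>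
     (nat \<Rightarrow> nat set \<Rightarrow> real \<Rightarrow> 'w \<Rightarrow> real) \<Rightarrow> bool" where
  "dynamic_processes M \<alpha> \<nu> \<Delta> \<longleftrightarrow> (\<forall>n.
     prob_space.indep_vars M (\<lambda>_. path_measurable_space) (\<lambda>A \<omega>. \<lambda>t\<in>{0..}. \<Delta> n A t \<omega>) (cells n) \<and>
     (\<forall>A\<in>cells n.
        distr M path_measurable_space (\<lambda>\<omega>. \<lambda>t\<in>{0..}. \<Delta> n A t \<omega>) =
          onoff_law (\<nu> (card A - 1)) (face_prob (\<alpha> (card A - 1)) n) \<and>
        (AE \<omega> in M. (\<lambda>t\<in>{0..}. \<Delta> n A t \<omega>) \<in> cadlag)))"

end

theory Submission
  imports Defs
begin

text \<open>
  A window \<open>[s, s + \<delta>)\<close> of time is compared with two static complexes: a cell is kept if its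
  process is on throughout the window, respectively at some time in it. The cells stay independent,
  and their probabilities lie between \<open>p\<^sub>i (1 - \<eta>)\<close> and \<open>p\<^sub>i (1 + \<eta>)\<close> once \<open>\<delta>\<close> is so
  small that the expected number of switches in the window is at most \<open>\<eta>\<close>; the face numbers of the dynamic complex lie between the
  static ones during the whole window. On a bounded time interval finitely many windows suffice, so
  no maximal inequality is needed: since \<open>\<tau>\<^sub>1 = 2 - \<alpha>\<^sub>1 > 1\<close>, the second moment makes the
  deviations of the static face numbers summable in \<open>n\<close>. Only \<open>f\<^sub>k\<close> is of order
  \<open>n\<^bsup>\<tau>\<^sub>k\<^esup>\<close>, which gives the Euler characteristic directly and the Betti number through the
  Morse inequalities \<open>f\<^sub>k - f\<^sub>k\<^sub>-\<^sub>1 - f\<^sub>k\<^sub>+\<^sub>1 \<le> \<beta>\<^sub>k \<le> f\<^sub>k\<close>. Convergence to a constant that is uniform on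
  bounded intervals implies Skorohod convergence, with the identity as time change.
\<close>

section \<open>Morse inequalities\<close>

text \<open>The switch times do not involve the coins, so the window length \<delta> is chosen from
  the gap laws alone, before n. Each interval between switches carries its own coin, independent of
  the timing; hence the window error is a factor 1 + \<eta> or 1 - \<eta> on the cell probability,
  however small that probability is. A face of fixed dimension has boundedly many cells, so the
  factors multiply to a constant near 1. The joint law over n is arbitrary, and almost sure
  statements come from summable probabilities. Pairs of j-faces sharing m + 1 vertices contribute
  order n^(2 tau_j - tau_m) to the variance; divided by n^(2 tau_k) this is at most n^(-tau_1). The
  number of dimensions grows with n, while the constants in the moment bounds depend on the
  dimension. Since tau_j falls at least linearly beyond k, some J has tau_J \<le> -2. The expected
  number of J-faces is then summable, so for large n none occurs in the bounded time interval, and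
  all higher dimensions vanish with them. Estimates are made only up to J.\<close>

definition down_closed :: "nat set set \<Rightarrow> bool" where
  "down_closed K \<longleftrightarrow> (\<forall>A\<in>K. \<forall>B\<subseteq>A. B \<noteq> {} \<longrightarrow> B \<in> K)"

lemma scale_chain_single: "scale_chain r (Poly_Mapping.single A x) = Poly_Mapping.single A (r * x)"
  by (rule poly_mapping_eqI) (simp add: lookup_single when_def)

lemma chain_boundary_scale: "chain_boundary (scale_chain r c) = scale_chain r (chain_boundary c)"
proof -
  have *: "Poly_Mapping.keys (scale_chain r c) \<subseteq> Poly_Mapping.keys c"
    by (auto simp: in_keys_iff)
  show ?thesis
    by (subst (1 2) chain_boundary_superset[of "Poly_Mapping.keys c"])
      (use * in \<open>auto simp: chain_space.scale_sum_right scale_chain_single mult_ac\<close>)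
qed

lemma chain_boundary_diff: "chain_boundary (c - d) = chain_boundary c - chain_boundary d"
  by (metis add_diff_cancel chain_boundary_add diff_add_cancel)

lemma chain_as_sum:
  "c = (\<Sum>A\<in>Poly_Mapping.keys c. scale_chain (Poly_Mapping.lookup c A) (Poly_Mapping.single A 1))"
  by (rule poly_mapping_eqI)
    (auto simp: lookup_sum lookup_single when_def in_keys_iff sum.delta if_distrib cong: if_cong)

definition unit_chains :: "nat set set \<Rightarrow> rat_chain set" where
  "unit_chains S = (\<lambda>A. Poly_Mapping.single A 1) ` S"

lemma inj_unit_chain: "inj_on (\<lambda>A. Poly_Mapping.single A (1::rat)) S"
  by (rule inj_onI) (metis keys_single singleton_inject zero_neq_one)

lemma card_unit_chains: "card (unit_chains S) = card S"
  unfolding unit_chains_def by (rule card_image[OF inj_unit_chain])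

lemma chains_subset_span: "chains K j \<subseteq> chain_space.span (unit_chains (faces K j))"
proof
  fix c assume "c \<in> chains K j"
  then have "Poly_Mapping.keys c \<subseteq> faces K j" by (simp add: chains_def)
  then show "c \<in> chain_space.span (unit_chains (faces K j))"
    by (subst chain_as_sum, intro chain_space.span_sum chain_space.span_scale chain_space.span_base)
      (auto simp: unit_chains_def)
qed

lemma independent_unit_chains:
  assumes "finite S" shows "\<not> chain_space.dependent (unit_chains S)"
proof
  assume "chain_space.dependent (unit_chains S)"
  then obtain u v where v: "v \<in> unit_chains S" "u v \<noteq> 0"
    and 0: "(\<Sum>v\<in>unit_chains S. scale_chain (u v) v) = 0"
    using chain_space.dependent_finite[of "unit_chains S"] assms by (auto simp: unit_chains_def)
  from v obtain A where A: "A \<in> S" "v = Poly_Mapping.single A 1" by (auto simp: unit_chains_def)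
  have "0 = (\<Sum>B\<in>S. scale_chain (u (Poly_Mapping.single B 1)) (Poly_Mapping.single B 1))"
    using 0 unfolding unit_chains_def by (simp add: sum.reindex[OF inj_unit_chain])
  then have "0 = Poly_Mapping.lookup (\<Sum>B\<in>S. scale_chain (u (Poly_Mapping.single B 1)) (Poly_Mapping.single B 1)) A"
    by simp
  also have "\<dots> = u v"
    using assms A by (simp add: lookup_sum lookup_single when_def if_distrib sum.delta cong: if_cong)
  finally show False using v by simp
qed

lemma subspace_chains: "chain_space.subspace (chains K j)"
  unfolding chain_space.subspace_def chains_def
  using keys_add by (auto simp: in_keys_iff subset_iff lookup_add) fastforce

lemma span_chains: "chain_space.span (unit_chains (faces K j)) = chains K j"
proof
  show "chain_space.span (unit_chains (faces K j)) \<subseteq> chains K j"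
    by (rule chain_space.span_minimal[OF _ subspace_chains]) (auto simp: unit_chains_def chains_def)
qed (rule chains_subset_span)

lemma dim_chains:
  assumes "finite (faces K j)" shows "chain_dim (chains K j) = card (faces K j)"
  using chain_space.dim_span_eq_card_independent[OF independent_unit_chains[OF assms]]
  by (simp add: span_chains card_unit_chains)

lemma dim_le_faces:
  assumes "finite (faces K j)" "V \<subseteq> chains K j" shows "chain_dim V \<le> card (faces K j)"
proof -
  have "chain_dim V \<le> card (unit_chains (faces K j))"
    by (rule chain_space.dim_le_card)
       (use assms chains_subset_span in \<open>auto simp: unit_chains_def\<close>)
  then show ?thesis by (simp add: card_unit_chains)
qed

lemma faces_boundary:
  assumes "down_closed K" "A \<in> faces K (Suc j)" "v \<in> A"
  shows "A - {v} \<in> faces K j"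
proof -
  have "card A = j + 2" "A \<in> K" using assms by (auto simp: faces_def)
  then have "card (A - {v}) = j + 1" using assms(3) by simp
  then have "A - {v} \<noteq> {}" by force
  then show ?thesis
    using assms(1) \<open>A \<in> K\<close> \<open>card (A - {v}) = j + 1\<close> by (auto simp: faces_def down_closed_def)
qed

lemma boundary_in_chains:
  assumes "down_closed K" "c \<in> chains K (Suc j)"
  shows "chain_boundary c \<in> chains K j"
proof -
  have "Poly_Mapping.keys (chain_boundary c) \<subseteq> faces K j"
    unfolding chain_boundary_def
    by (rule subset_trans[OF Poly_Mapping.keys_sum] UN_least)+
      (use assms faces_boundary in \<open>auto simp: chains_def\<close>)
  then show ?thesis by (simp add: chains_def)
qed

text \<open>By linearity the image of the boundary map is spanned by the boundaries of single
  faces.\<close>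

lemma dim_boundaries_le:
  assumes "finite (faces K (j + 1))"
  shows "chain_dim (boundaries K j) \<le> card (faces K (j + 1))"
proof -
  let ?W = "chain_boundary ` unit_chains (faces K (j + 1))"
  have "boundaries K j \<subseteq> chain_space.span ?W"
  proof
    fix b assume "b \<in> boundaries K j"
    then obtain c where c: "Poly_Mapping.keys c \<subseteq> faces K (j + 1)" "b = chain_boundary c"
      by (auto simp: boundaries_def chains_def)
    have "b = (\<Sum>A\<in>Poly_Mapping.keys c. scale_chain (Poly_Mapping.lookup c A) (chain_boundary (Poly_Mapping.single A 1)))"
      unfolding c(2) by (subst chain_as_sum) (simp add: chain_boundary_sum chain_boundary_scale)
    then show "b \<in> chain_space.span ?W"
      using c(1) by (auto simp: unit_chains_def
          intro!: chain_space.span_sum chain_space.span_scale intro: chain_space.span_base)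
  qed
  then have "chain_dim (boundaries K j) \<le> card ?W"
    by (rule chain_space.dim_le_card) (use assms in \<open>auto simp: unit_chains_def\<close>)
  also have "\<dots> \<le> card (unit_chains (faces K (j + 1)))"
    by (rule card_image_le) (use assms in \<open>auto simp: unit_chains_def\<close>)
  finally show ?thesis by (simp add: card_unit_chains)
qed

text \<open>Rank-nullity as an inequality: a basis of the cycles together with lifts of a basis of
  the image spans all chains, and the image lies in the chains one dimension lower, which bounds its
  dimension by the number of faces there.\<close>

lemma dim_cycles_ge:
  assumes fin: "finite (faces K (Suc j))" "finite (faces K j)" and K: "down_closed K"
  shows "card (faces K (Suc j)) \<le> chain_dim (cycles K (Suc j)) + card (faces K j)"
proof -
  let ?Im = "chain_boundary ` chains K (Suc j)"
  have finW: "finite (unit_chains (faces K j))" "finite (unit_chains (faces K (Suc j)))"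
    using fin by (auto simp: unit_chains_def)
  obtain B where B: "B \<subseteq> ?Im" "\<not> chain_space.dependent B" "?Im \<subseteq> chain_space.span B" "card B = chain_dim ?Im"
    by (rule chain_space.basis_exists)
  have sub: "?Im \<subseteq> chain_space.span (unit_chains (faces K j))"
    using boundary_in_chains[OF K] chains_subset_span by blast
  have finB: "finite B" "card B \<le> card (faces K j)"
    using chain_space.independent_span_bound[OF finW(1) B(2)] B(1) sub
    by (auto simp: card_unit_chains)
  obtain C where C: "C \<subseteq> cycles K (Suc j)" "\<not> chain_space.dependent C"
      "cycles K (Suc j) \<subseteq> chain_space.span C" "card C = chain_dim (cycles K (Suc j))"
    by (rule chain_space.basis_exists)
  have finC: "finite C"
    using chain_space.independent_span_bound[OF finW(2) C(2)] C(1) chains_subset_span[of K "Suc j"]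
    by (auto simp: cycles_def)
  obtain g where g: "\<And>b. b \<in> B \<Longrightarrow> g b \<in> chains K (Suc j) \<and> chain_boundary (g b) = b"
    using B(1) by (metis (no_types, lifting) f_inv_into_f inv_into_into subset_eq)
  have "chains K (Suc j) \<subseteq> chain_space.span (C \<union> g ` B)"
  proof
    fix x assume x: "x \<in> chains K (Suc j)"
    then have "chain_boundary x \<in> chain_space.span B" using B(3) by blast
    then obtain u where u: "chain_boundary x = (\<Sum>b\<in>B. scale_chain (u b) b)"
      using chain_space.span_finite[OF finB(1)] by auto
    \<comment> \<open>The lift of \<open>chain_boundary x\<close> through \<open>g\<close>; it has
      the same boundary as \<open>x\<close>, so \<open>x - y\<close> is a cycle.\<close>
    define y where "y = (\<Sum>b\<in>B. scale_chain (u b) (g b))"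
    have y: "y \<in> chains K (Suc j)" unfolding y_def
      using g by (intro chain_space.subspace_sum chain_space.subspace_scale subspace_chains) auto
    have "chain_boundary y = chain_boundary x"
      unfolding u y_def chain_boundary_sum chain_boundary_scale using g by (intro sum.cong) auto
    then have "x - y \<in> cycles K (Suc j)"
      using x y by (auto simp: cycles_def chain_boundary_diff intro!: chain_space.subspace_diff subspace_chains)
    then have "x - y \<in> chain_space.span (C \<union> g ` B)"
      using C(3) chain_space.span_mono[of C "C \<union> g ` B"] by auto
    moreover have "y \<in> chain_space.span (C \<union> g ` B)" unfolding y_def
      by (intro chain_space.span_sum chain_space.span_scale chain_space.span_base) auto
    ultimately have "(x - y) + y \<in> chain_space.span (C \<union> g ` B)" by (rule chain_space.span_add)
    then show "x \<in> chain_space.span (C \<union> g ` B)" by simp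
  qed
  then have "chain_dim (chains K (Suc j)) \<le> card (C \<union> g ` B)"
    by (rule chain_space.dim_le_card) (use finB finC in auto)
  also have "\<dots> \<le> card C + card (g ` B)" by (rule card_Un_le)
  also have "card (g ` B) \<le> card B" by (rule card_image_le) fact
  finally show ?thesis using finB C dim_chains[OF fin(1)] by simp
qed

text \<open>The second inequality combines a lower bound for the cycles with an upper bound for the
  boundaries. It survives the truncated subtraction in \<open>reduced_betti\<close>, because z \<le>
  (z - b) + b holds for natural numbers without z \<ge> b.\<close>

lemma reduced_betti_bounds:
  assumes fin: "\<And>j. finite (faces K j)" and K: "down_closed K"
  shows "reduced_betti K (Suc j) \<le> card (faces K (Suc j))"
    and "card (faces K (Suc j)) \<le> reduced_betti K (Suc j) + card (faces K j) + card (faces K (Suc (Suc j)))"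
proof -
  have "chain_dim (cycles K (Suc j)) \<le> card (faces K (Suc j))"
    by (rule dim_le_faces[OF fin]) (auto simp: cycles_def)
  then show "reduced_betti K (Suc j) \<le> card (faces K (Suc j))" by (simp add: reduced_betti_def)
  show "card (faces K (Suc j)) \<le> reduced_betti K (Suc j) + card (faces K j) + card (faces K (Suc (Suc j)))"
    using dim_cycles_ge[OF fin fin K, of j] dim_boundaries_le[of K "Suc j"] fin by (simp add: reduced_betti_def)
qed

section \<open>Skorohod convergence to a constant\<close>

lemma has_bochner_integral_exp_Ici:
  "has_bochner_integral lborel (\<lambda>u. exp (- u) * indicator {a..} u :: real) (exp (- a))"
proof (rule has_bochner_integral_nn_integral)
  have "((\<lambda>x::real. - exp (- x)) \<longlongrightarrow> - 0) at_top"
    by (intro tendsto_intros filterlim_compose[OF exp_at_bot] filterlim_uminus_at_bot_at_top)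
  then have "(\<integral>\<^sup>+u. ennreal (exp (- u)) * indicator {a..} u \<partial>lborel) = ennreal (0 - (- exp (- a)))"
    by (intro nn_integral_FTC_atLeast) (auto intro!: derivative_eq_intros)
  then show "(\<integral>\<^sup>+u. ennreal (exp (- u) * indicator {a..} u) \<partial>lborel) = ennreal (exp (- a))"
    by (simp add: ennreal_mult' ennreal_indicator)
qed auto

text \<open>Under the identity time change the inner supremum is at most \<epsilon> for u < T, and
  beyond T it exceeds \<epsilon> by at most 1 because of the truncation at 1. The weight exp(-u) has
  mass 1 on the half-line and exp(-T) beyond T.\<close>

lemma skorohod_dist_const_le:
  fixes T \<epsilon> c :: real
  assumes "0 \<le> \<epsilon>" and close: "\<And>t. 0 \<le> t \<Longrightarrow> t < T \<Longrightarrow> \<bar>c - y t\<bar> \<le> \<epsilon>"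
  shows "skorohod_dist (\<lambda>t\<in>{0..}. c) y \<le> \<epsilon> + exp (- T)"
proof -
  let ?x = "\<lambda>t\<in>{0..}. c"
  let ?h = "\<lambda>\<theta> u. exp (- u) * (SUP t\<in>{0..}. min 1 \<bar>?x (min t u) - y (min (\<theta> t) u)\<bar>)"
  let ?v = "\<lambda>\<theta>. max (Sup (log_slopes \<theta>)) (LINT u:{0..}|lborel. ?h \<theta> u)"
  have slopes: "log_slopes id = {0}"
  proof
    have "\<bar>ln ((id 1 - id 0) / (1 - 0))\<bar> \<in> log_slopes id"
      unfolding log_slopes_def by (rule CollectI, rule exI[of _ 1], rule exI[of _ 0]) auto
    then show "{0} \<subseteq> log_slopes id" by simp
  qed (auto simp: log_slopes_def)
  have id: "id \<in> time_changes"
    by (auto simp: time_changes_def slopes strict_mono_on_def)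
  \<comment> \<open>The infimum is bounded by its value at the identity only if the values are
    bounded below; here 0 is a lower bound, since any element of \<open>log_slopes \<theta>\<close>
    is an absolute value.\<close>
  have pos: "0 \<le> ?v \<theta>" if "\<theta> \<in> time_changes" for \<theta>
  proof -
    have bdd: "bdd_above (log_slopes \<theta>)" using that by (simp add: time_changes_def)
    have mem: "\<bar>ln ((\<theta> 1 - \<theta> 0) / (1 - 0))\<bar> \<in> log_slopes \<theta>"
      unfolding log_slopes_def by (rule CollectI, rule exI[of _ 1], rule exI[of _ 0]) auto
    have "0 \<le> \<bar>ln ((\<theta> 1 - \<theta> 0) / (1 - 0))\<bar>" by simp
    also have "\<dots> \<le> Sup (log_slopes \<theta>)" by (rule cSup_upper[OF mem bdd])
    finally show ?thesis by simp
  qed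
  have le_id: "skorohod_dist ?x y \<le> ?v id"
    unfolding skorohod_dist_def by (rule cINF_lower[OF _ id]) (use pos in \<open>auto intro!: bdd_belowI2\<close>)
  have "(LINT u:{0..}|lborel. ?h id u) \<le> \<epsilon> + exp (- T)"
  proof (cases "set_integrable lborel {0..} (?h id)")
    \<comment> \<open>Measurability of the supremum in u is not assumed; an integrand that is not
      integrable has integral 0 by convention, so the bound is trivial.\<close>
    case False
    then show ?thesis
      using assms(1) by (simp add: set_lebesgue_integral_def set_integrable_def not_integrable_integral_eq)
  next
    case True
    have int: "has_bochner_integral lborel
        (\<lambda>u. \<epsilon> * (exp (- u) * indicator {0..} u) + exp (- u) * indicator {T..} u) (\<epsilon> * exp (- 0) + exp (- T))"
      by (intro has_bochner_integral_add has_bochner_integral_mult_right has_bochner_integral_exp_Ici)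
    have "(LINT u:{0..}|lborel. ?h id u) \<le>
        (LINT u|lborel. \<epsilon> * (exp (- u) * indicator {0..} u) + exp (- u) * indicator {T..} u)"
      unfolding set_lebesgue_integral_def
    proof (rule integral_mono)
      show "integrable lborel (\<lambda>u. indicat_real {0..} u *\<^sub>R ?h id u)"
        using True by (simp add: set_integrable_def)
      show "integrable lborel (\<lambda>u. \<epsilon> * (exp (- u) * indicator {0..} u) + exp (- u) * indicator {T..} u)"
        using int by (rule integrable.intros)
      fix u :: real
      show "indicat_real {0..} u *\<^sub>R ?h id u \<le>
        \<epsilon> * (exp (- u) * indicator {0..} u) + exp (- u) * indicator {T..} u"
      proof (cases "0 \<le> u")
        case u: True
        let ?S = "SUP t\<in>{0..}. min 1 \<bar>?x (min t u) - y (min (id t) u)\<bar>"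
        have "?S \<le> \<epsilon> + indicator {T..} u"
        proof (rule cSUP_least)
          fix t :: real assume "t \<in> {0..}"
          then show "min 1 \<bar>?x (min t u) - y (min (id t) u)\<bar> \<le> \<epsilon> + indicator {T..} u"
            using close[of "min t u"] u assms(1) by (auto simp: indicator_def min_le_iff_disj)
        qed auto
        then have "exp (- u) * ?S \<le> exp (- u) * (\<epsilon> + indicator {T..} u)"
          by (rule mult_left_mono) auto
        then show ?thesis using u by (simp add: algebra_simps)
      qed auto
    qed
    then show ?thesis using has_bochner_integral_integral_eq[OF int] by simp
  qed
  moreover have "Sup (log_slopes id) = 0" by (simp only: slopes cSup_singleton)
  ultimately have "?v id \<le> \<epsilon> + exp (- T)" using assms(1) by simp
  with le_id show ?thesis by (rule order_trans)
qed

section \<open>Path regularity of functions of finitely many binary paths\<close>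

lemma cadlag_locally_constant:
  assumes "y \<in> extensional {0..}"
    and R: "\<And>t. 0 \<le> t \<Longrightarrow> eventually (\<lambda>u. y u = y t) (at_right t)"
    and L: "\<And>t. 0 < t \<Longrightarrow> \<exists>l. eventually (\<lambda>u. y u = l) (at_left t)"
  shows "y \<in> cadlag"
  unfolding cadlag_def mem_Collect_eq continuous_within
proof (intro conjI allI impI assms(1))
  show "(y \<longlongrightarrow> y t) (at_right t)" if "0 \<le> t" for t
    by (rule tendsto_eventually[OF R[OF that]])
  show "\<exists>l. (y \<longlongrightarrow> l) (at_left t)" if "0 < t" for t
    using L[OF that] tendsto_eventually by blast
qed

lemma const_cadlag: "(\<lambda>t\<in>{0..}. c) \<in> cadlag"
proof (rule cadlag_locally_constant)
  show "\<exists>l. eventually (\<lambda>u. (\<lambda>t\<in>{0..}. c) u = l) (at_left t)" if "0 < t" for t :: real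
    using that by (intro exI[of _ c]) (auto simp: eventually_at_left intro!: exI[of _ 0])
qed (auto intro!: eventually_at_right_less simp: eventually_at_filter)

lemma limitin_skorohod_const:
  assumes cad: "eventually (\<lambda>n. y n \<in> cadlag) sequentially"
    and close: "\<And>(T::nat) \<epsilon>. 0 < \<epsilon> \<Longrightarrow> eventually (\<lambda>n. \<forall>t. 0 \<le> t \<and> t < real T \<longrightarrow> \<bar>y n t - c\<bar> \<le> \<epsilon>) sequentially"
  shows "limitin skorohod_J1 y (\<lambda>t\<in>{0..}. c) sequentially"
  unfolding limitin_def topspace_skorohod_J1
proof (intro conjI allI impI const_cadlag)
  fix U assume "openin skorohod_J1 U \<and> (\<lambda>t\<in>{0..}. c) \<in> U"
  then obtain e where e: "e > 0" "\<And>z. z \<in> cadlag \<Longrightarrow> skorohod_dist (\<lambda>t\<in>{0..}. c) z < e \<Longrightarrow> z \<in> U"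
    unfolding openin_skorohod_J1 by blast
  have "((\<lambda>T. exp (- real T)) \<longlongrightarrow> 0) sequentially"
    by (intro filterlim_compose[OF exp_at_bot] filterlim_compose[OF filterlim_uminus_at_bot_at_top] filterlim_real_sequentially)
  then have "eventually (\<lambda>T. exp (- real T) < e / 2) sequentially"
    using e(1) by (intro order_tendstoD) auto
  then obtain T :: nat where T: "exp (- real T) < e / 2"
    by (auto simp: eventually_sequentially)
  show "eventually (\<lambda>n. y n \<in> U) sequentially"
    using cad close[OF half_gt_zero[OF e(1)], of T]
  proof eventually_elim
    case (elim n)
    have "skorohod_dist (\<lambda>t\<in>{0..}. c) (y n) \<le> e / 2 + exp (- real T)"
      using elim e(1) by (intro skorohod_dist_const_le) (auto simp: abs_minus_commute)
    then show ?case using T e elim by auto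
  qed
qed

text \<open>At most one of 0 and 1 lies within distance less than 1/2 of l, so near the limit the
  function has to take that value.\<close>

lemma binary_limit_eventually_const:
  fixes x :: "real \<Rightarrow> real"
  assumes "(x \<longlongrightarrow> l) F" "eventually (\<lambda>u. x u \<in> {0, 1}) F"
  shows "\<exists>v. eventually (\<lambda>u. x u = v) F"
proof -
  have "eventually (\<lambda>u. dist (x u) l < 1 / 2) F" using assms(1) by (rule tendstoD) simp
  then have "eventually (\<lambda>u. x u = (if l < 1 / 2 then 0 else 1)) F"
    using assms(2) by eventually_elim (auto simp: dist_real_def split: if_splits)
  then show ?thesis by blast
qed

text \<open>Binary cadlag paths are constant just to the right and just to the left of each time,
  and finitely many of them are so simultaneously. Any function \<open>F\<close> of their values is
  then locally constant on each side, without any regularity of \<open>F\<close>; this covers Betti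
  numbers as well as the Euler characteristic.\<close>

lemma cadlag_finite_state:
  assumes fin: "finite C"
    and X: "\<And>B. B \<in> C \<Longrightarrow> (\<lambda>t\<in>{0..}. X B t) \<in> cadlag"
    and bin: "\<And>B t. B \<in> C \<Longrightarrow> 0 \<le> t \<Longrightarrow> X B t \<in> {0, 1}"
    and dep: "\<And>Y Z. (\<And>B. B \<in> C \<Longrightarrow> Y B = Z B) \<Longrightarrow> F Y = F Z"
  shows "(\<lambda>t\<in>{0..}. F (\<lambda>B. X B t)) \<in> cadlag"
proof (rule cadlag_locally_constant)
  fix t :: real assume t: "0 \<le> t"
  have nonneg: "eventually (\<lambda>u. 0 \<le> u) (at_right t)"
    using t by (auto simp: eventually_at_filter)
  have "eventually (\<lambda>u. X B u = X B t) (at_right t)" if B: "B \<in> C" for B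
  proof -
    have lim: "((\<lambda>t\<in>{0..}. X B t) \<longlongrightarrow> X B t) (at_right t)"
      using X[OF B] t by (auto simp: cadlag_def continuous_within)
    have "eventually (\<lambda>u. dist ((\<lambda>t\<in>{0..}. X B t) u) (X B t) < 1 / 2) (at_right t)"
      using lim by (rule tendstoD) simp
    then show ?thesis
      using nonneg
    proof eventually_elim
      case (elim u)
      then show ?case using bin[OF B, of u] bin[OF B t] by (auto simp: dist_real_def)
    qed
  qed
  then have "eventually (\<lambda>u. \<forall>B\<in>C. X B u = X B t) (at_right t)"
    using fin by (simp add: eventually_ball_finite)
  then show "eventually (\<lambda>u. (\<lambda>t\<in>{0..}. F (\<lambda>B. X B t)) u = (\<lambda>t\<in>{0..}. F (\<lambda>B. X B t)) t) (at_right t)"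
    using nonneg by eventually_elim (use t in \<open>auto intro!: dep\<close>)
next
  fix t :: real assume t: "0 < t"
  have nonneg: "eventually (\<lambda>u. 0 \<le> u) (at_left t)"
    using t by (auto simp: eventually_at_left intro!: exI[of _ 0])
  have "\<exists>v. eventually (\<lambda>u. X B u = v) (at_left t)" if B: "B \<in> C" for B
  proof -
    obtain l where l: "((\<lambda>t\<in>{0..}. X B t) \<longlongrightarrow> l) (at_left t)"
      using X[OF B] t by (auto simp: cadlag_def)
    have "eventually (\<lambda>u. (\<lambda>t\<in>{0..}. X B t) u \<in> {0, 1}) (at_left t)"
      using nonneg by eventually_elim (use bin[OF B] in auto)
    then obtain v where "eventually (\<lambda>u. (\<lambda>t\<in>{0..}. X B t) u = v) (at_left t)"
      using binary_limit_eventually_const[OF l] by blast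
    then have "eventually (\<lambda>u. X B u = v) (at_left t)"
      using nonneg by eventually_elim auto
    then show ?thesis ..
  qed
  then obtain v where "\<And>B. B \<in> C \<Longrightarrow> eventually (\<lambda>u. X B u = v B) (at_left t)" by metis
  then have "eventually (\<lambda>u. \<forall>B\<in>C. X B u = v B) (at_left t)"
    using fin by (simp add: eventually_ball_finite)
  then have "eventually (\<lambda>u. (\<lambda>t\<in>{0..}. F (\<lambda>B. X B t)) u = F v) (at_left t)"
    using nonneg by eventually_elim (auto intro!: dep)
  then show "\<exists>l. eventually (\<lambda>u. (\<lambda>t\<in>{0..}. F (\<lambda>B. X B t)) u = l) (at_left t)" ..
qed auto

lemma complex_at_cong:
  assumes "\<And>B. B \<in> cells n \<Longrightarrow> Y B = Z B"
  shows "complex_at n Y = complex_at n Z"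
proof -
  have "(\<forall>B\<subseteq>A. 2 \<le> card B \<longrightarrow> Y B = 1) \<longleftrightarrow> (\<forall>B\<subseteq>A. 2 \<le> card B \<longrightarrow> Z B = 1)" if "A \<subseteq> {1..n}" for A
    using assms that by (auto simp: cells_def)
  then show ?thesis by (auto simp: complex_at_def)
qed

lemma finite_cells: "finite (cells n)"
  by (rule finite_subset[of _ "Pow {1..n}"]) (auto simp: cells_def)

section \<open>The equilibrium distribution\<close>

context
  fixes \<nu> :: "real measure"
  assumes law: "positive_finite_mean_law \<nu>"
begin

interpretation real_distribution \<nu> using law by (simp add: positive_finite_mean_law_def)

lemma survival_bounds: "0 \<le> 1 - cdf \<nu> y" "1 - cdf \<nu> y \<le> 1"
  using cdf_bounded_prob[of y] cdf_nonneg[of y] by auto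

lemma survival_measurable [measurable]: "(\<lambda>y. 1 - cdf \<nu> y) \<in> borel_measurable borel"
  by (intro borel_measurable_diff borel_measurable_const borel_measurable_mono)
     (auto simp: mono_def intro: cdf_nondecreasing)

text \<open>Tonelli on the region 0 \<le> y < x: integrating in x first gives the survival function,
  in y first gives x itself. This makes \<open>equilibrium_cdf\<close> tend to 1.\<close>

lemma nn_integral_survival:
  "(\<integral>\<^sup>+y. ennreal ((1 - cdf \<nu> y) * indicator {0..} y) \<partial>lborel) = ennreal (law_mean \<nu>)"
proof -
  interpret P: pair_sigma_finite lborel \<nu> ..
  have m: "(\<lambda>(y, x). indicator {(y, x). 0 \<le> y \<and> y < x} (y, x) :: ennreal) \<in> borel_measurable (lborel \<Otimes>\<^sub>M \<nu>)"
    by measurable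
  have "(\<integral>\<^sup>+y. ennreal ((1 - cdf \<nu> y) * indicator {0..} y) \<partial>lborel)
      = (\<integral>\<^sup>+y. (\<integral>\<^sup>+x. indicator {(y, x). 0 \<le> y \<and> y < x} (y, x) \<partial>\<nu>) \<partial>lborel)"
  proof (rule nn_integral_cong)
    fix y :: real
    have "1 - cdf \<nu> y = measure \<nu> {y<..}"
      using prob_compl[of "{..y}"] by (simp add: cdf_def Compl_eq_Diff_UNIV[symmetric])
    then have "ennreal (1 - cdf \<nu> y) = emeasure \<nu> {y<..}"
      by (simp add: emeasure_eq_measure)
    moreover have "(\<integral>\<^sup>+x. indicator {(y, x). 0 \<le> y \<and> y < x} (y, x) \<partial>\<nu>)
        = (\<integral>\<^sup>+x. indicator {y<..} x * indicator {0..} y \<partial>\<nu>)"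
      by (rule nn_integral_cong) (auto simp: indicator_def)
    moreover have "\<dots> = emeasure \<nu> {y<..} * indicator {0..} y"
      by (subst nn_integral_multc) auto
    ultimately show "ennreal ((1 - cdf \<nu> y) * indicator {0..} y) = (\<integral>\<^sup>+x. indicator {(y, x). 0 \<le> y \<and> y < x} (y, x) \<partial>\<nu>)"
      by (cases "0 \<le> y") simp_all
  qed
  also have "\<dots> = (\<integral>\<^sup>+x. (\<integral>\<^sup>+y. indicator {(y, x). 0 \<le> y \<and> y < x} (y, x) \<partial>lborel) \<partial>\<nu>)"
    using P.Fubini'[OF m] by simp
  also have "\<dots> = (\<integral>\<^sup>+x. ennreal x \<partial>\<nu>)"
  proof (rule nn_integral_cong_AE)
    have "AE x in \<nu>. 0 < x" using law by (simp add: positive_finite_mean_law_def)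
    then show "AE x in \<nu>. (\<integral>\<^sup>+y. indicator {(y, x). 0 \<le> y \<and> y < x} (y, x) \<partial>lborel) = ennreal x"
    proof eventually_elim
      case (elim x)
      have "(\<integral>\<^sup>+y. indicator {(y, x). 0 \<le> y \<and> y < x} (y, x) \<partial>lborel) = (\<integral>\<^sup>+y. indicator {0..<x} y \<partial>lborel)"
        by (rule nn_integral_cong) (auto simp: indicator_def)
      then show ?case using elim by simp
    qed
  qed
  also have "\<dots> = ennreal (law_mean \<nu>)"
    unfolding law_mean_def using law
    by (intro nn_integral_eq_integral) (auto simp: positive_finite_mean_law_def)
  finally show ?thesis .
qed

lemma law_mean_pos: "0 < law_mean \<nu>"
  using law by (simp add: positive_finite_mean_law_def)

lemma has_bochner_integral_survival:
  "has_bochner_integral lborel (\<lambda>y. indicat_real {0..} y *\<^sub>R (1 - cdf \<nu> y)) (law_mean \<nu>)"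
  using nn_integral_survival law_mean_pos survival_bounds
  by (intro has_bochner_integral_nn_integral) (auto simp: mult_ac)

lemma set_integrable_survival: "A \<in> sets borel \<Longrightarrow> A \<subseteq> {0..} \<Longrightarrow> set_integrable lborel A (\<lambda>y. 1 - cdf \<nu> y)"
  by (rule set_integrable_subset[of _ "{0..}"])
     (use has_bochner_integral_survival in \<open>auto simp: set_integrable_def dest: integrable.intros\<close>)

lemma equilibrium_cdf_nonpos: "x \<le> 0 \<Longrightarrow> equilibrium_cdf \<nu> x = 0"
proof -
  assume x: "x \<le> 0"
  have "(LINT y:{0..x}|lborel. 1 - cdf \<nu> y) = 0"
    unfolding set_lebesgue_integral_def
    by (rule integral_eq_zero_AE, rule AE_mp[OF AE_lborel_singleton[of 0]])
       (use x in \<open>auto simp: indicator_def\<close>)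
  then show ?thesis by (simp add: equilibrium_cdf_def)
qed

lemma equilibrium_cdf_increment_on_nonneg:
  assumes "0 \<le> x" "x \<le> y"
  shows "0 \<le> equilibrium_cdf \<nu> y - equilibrium_cdf \<nu> x"
    and "equilibrium_cdf \<nu> y - equilibrium_cdf \<nu> x \<le> (y - x) / law_mean \<nu>"
proof -
  have split: "{0..y} = {0..x} \<union> {x<..y}" using assms by auto
  have "(LINT u:{0..y}|lborel. 1 - cdf \<nu> u) = (LINT u:{0..x}|lborel. 1 - cdf \<nu> u) + (LINT u:{x<..y}|lborel. 1 - cdf \<nu> u)"
    unfolding split by (rule set_integral_Un) (use assms in \<open>auto intro!: set_integrable_survival\<close>)
  then have eq: "equilibrium_cdf \<nu> y - equilibrium_cdf \<nu> x = (LINT u:{x<..y}|lborel. 1 - cdf \<nu> u) / law_mean \<nu>"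
    by (simp add: equilibrium_cdf_def add_divide_distrib)
  have "0 \<le> (LINT u:{x<..y}|lborel. 1 - cdf \<nu> u)"
    unfolding set_lebesgue_integral_def
    using cdf_bounded_prob by (intro integral_nonneg_AE AE_I2) (auto simp: indicator_def)
  then show "0 \<le> equilibrium_cdf \<nu> y - equilibrium_cdf \<nu> x" using law_mean_pos by (simp add: eq)
  have "(LINT u:{x<..y}|lborel. 1 - cdf \<nu> u) \<le> (LINT u:{x<..y}|lborel. 1)"
  proof (rule set_integral_mono)
    show "set_integrable lborel {x<..y} (\<lambda>y. 1 - cdf \<nu> y)"
      using assms by (intro set_integrable_survival) auto
  qed (use assms survival_bounds in \<open>auto simp: set_integrable_def\<close>)
  also have "\<dots> = y - x" using assms by (simp add: set_lebesgue_integral_def)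
  finally show "equilibrium_cdf \<nu> y - equilibrium_cdf \<nu> x \<le> (y - x) / law_mean \<nu>"
    using law_mean_pos by (simp add: eq divide_right_mono)
qed

lemma equilibrium_cdf_increment:
  assumes "x \<le> y"
  shows "0 \<le> equilibrium_cdf \<nu> y - equilibrium_cdf \<nu> x"
    and "equilibrium_cdf \<nu> y - equilibrium_cdf \<nu> x \<le> (y - x) / law_mean \<nu>"
proof -
  \<comment> \<open>Both sides vanish on the negative half-line, so the estimate on [0, \<infinity>)
    extends to all reals by clipping at 0.\<close>
  have eq: "equilibrium_cdf \<nu> z = equilibrium_cdf \<nu> (max 0 z)" for z
    using equilibrium_cdf_nonpos by (auto simp: max_def)
  note * = equilibrium_cdf_increment_on_nonneg[of "max 0 x" "max 0 y", folded eq]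
  show "0 \<le> equilibrium_cdf \<nu> y - equilibrium_cdf \<nu> x" using * assms by (auto simp: max_def)
  have "(max 0 y - max 0 x) / law_mean \<nu> \<le> (y - x) / law_mean \<nu>"
    using assms law_mean_pos by (intro divide_right_mono) auto
  with * assms show "equilibrium_cdf \<nu> y - equilibrium_cdf \<nu> x \<le> (y - x) / law_mean \<nu>"
    by (auto simp: max_def split: if_splits)
qed

lemma equilibrium_cdf_mono: "x \<le> y \<Longrightarrow> equilibrium_cdf \<nu> x \<le> equilibrium_cdf \<nu> y"
  using equilibrium_cdf_increment(1)[of x y] by simp

lemma equilibrium_cdf_continuous: "continuous (at_right a) (equilibrium_cdf \<nu>)"
proof -
  have "(1 / law_mean \<nu>)-lipschitz_on UNIV (equilibrium_cdf \<nu>)"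
  proof (rule lipschitz_onI)
    fix x y :: real
    show "dist (equilibrium_cdf \<nu> x) (equilibrium_cdf \<nu> y) \<le> 1 / law_mean \<nu> * dist x y"
      using equilibrium_cdf_increment[of x y] equilibrium_cdf_increment[of y x]
      by (cases "x \<le> y") (auto simp: dist_real_def)
  qed (use law_mean_pos in simp)
  then have "continuous_on UNIV (equilibrium_cdf \<nu>)" by (rule lipschitz_on_continuous_on)
  then show ?thesis by (simp add: continuous_on_eq_continuous_at continuous_at_imp_continuous_at_within)
qed

lemma equilibrium_cdf_at_bot: "(equilibrium_cdf \<nu> \<longlongrightarrow> 0) at_bot"
  by (rule tendsto_eventually)
     (auto simp: eventually_at_bot_linorder equilibrium_cdf_nonpos intro!: exI[of _ 0])

lemma equilibrium_cdf_at_top: "(equilibrium_cdf \<nu> \<longlongrightarrow> 1) at_top"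
proof -
  have "((\<lambda>b. LINT y:{0..b}|lborel. 1 - cdf \<nu> y) \<longlongrightarrow> (LINT y:{0..}|lborel. 1 - cdf \<nu> y)) at_top"
    by (rule tendsto_set_lebesgue_integral_at_top) (auto intro: set_integrable_survival)
  also have "(LINT y:{0..}|lborel. 1 - cdf \<nu> y) = law_mean \<nu>"
    unfolding set_lebesgue_integral_def by (rule has_bochner_integral_integral_eq[OF has_bochner_integral_survival])
  finally have "((\<lambda>b. (LINT y:{0..b}|lborel. 1 - cdf \<nu> y) / law_mean \<nu>) \<longlongrightarrow> law_mean \<nu> / law_mean \<nu>) at_top"
    using law_mean_pos by (intro tendsto_divide tendsto_const) auto
  then show ?thesis using law_mean_pos by (simp add: equilibrium_cdf_def[abs_def])
qed

lemma real_distribution_equilibrium: "real_distribution (interval_measure (equilibrium_cdf \<nu>))"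
  by (rule real_distribution_interval_measure[OF equilibrium_cdf_mono equilibrium_cdf_continuous
        equilibrium_cdf_at_bot equilibrium_cdf_at_top])

text \<open>The survival function is at most 1, so the equilibrium law has density at most 1 / mean.
  It thus charges every short interval little, even when \<nu> has atoms; all control of switches in
  short windows rests on this.\<close>

lemma emeasure_equilibrium_Ioc:
  "emeasure (interval_measure (equilibrium_cdf \<nu>)) {x<..y} \<le> ennreal ((y - x) / law_mean \<nu>)"
  using equilibrium_cdf_increment(2)[of x y]
  by (simp add: emeasure_interval_measure_Ioc_eq[OF equilibrium_cdf_mono equilibrium_cdf_continuous] ennreal_leI)

lemma AE_equilibrium_pos: "AE x in interval_measure (equilibrium_cdf \<nu>). 0 < x"
proof -
  interpret E: real_distribution "interval_measure (equilibrium_cdf \<nu>)"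
    by (rule real_distribution_equilibrium)
  have "measure (interval_measure (equilibrium_cdf \<nu>)) {..0} = equilibrium_cdf \<nu> 0"
    using cdf_interval_measure[OF equilibrium_cdf_mono equilibrium_cdf_continuous equilibrium_cdf_at_bot]
    by (simp add: cdf_def fun_eq_iff)
  then have "emeasure (interval_measure (equilibrium_cdf \<nu>)) {..0} = 0"
    by (simp add: E.emeasure_eq_measure equilibrium_cdf_nonpos)
  then show ?thesis by (intro AE_I[of _ _ "{..0}"]) auto
qed

text \<open>Strictly below 1 because the law is almost surely positive: otherwise 1 - exp(-x) would
  have mean 0 and vanish almost everywhere. The number r serves as the geometric rate in the
  Chernoff bounds for early switches.\<close>

lemma laplace_lt_1: obtains r where "0 \<le> r" "r < 1" "(\<integral>\<^sup>+x. ennreal (exp (- x)) \<partial>\<nu>) = ennreal r"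
proof -
  have pos: "AE x in \<nu>. 0 < x" using law by (simp add: positive_finite_mean_law_def)
  have int: "integrable \<nu> (\<lambda>x. exp (- x))"
    by (rule integrable_const_bound[where B = 1]) (use pos in auto)
  have "expectation (\<lambda>x. 1 - exp (- x)) \<noteq> 0"
  proof
    assume "expectation (\<lambda>x. 1 - exp (- x)) = 0"
    moreover have "AE x in \<nu>. 0 \<le> 1 - exp (- x)" using pos by eventually_elim simp
    ultimately have "AE x in \<nu>. 1 - exp (- x) = 0"
      using int by (subst (asm) integral_nonneg_eq_0_iff_AE) auto
    with pos have "AE x in \<nu>. False" by eventually_elim simp
    then show False by simp
  qed
  moreover have "0 \<le> expectation (\<lambda>x. 1 - exp (- x))"
    by (rule integral_nonneg_AE) (use pos in eventually_elim, simp)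
  ultimately have "expectation (\<lambda>x. exp (- x)) < 1"
    using int prob_space by simp
  moreover have "(\<integral>\<^sup>+x. ennreal (exp (- x)) \<partial>\<nu>) = ennreal (expectation (\<lambda>x. exp (- x)))"
    by (rule nn_integral_eq_integral[OF int]) simp
  ultimately show ?thesis by (intro that[of "expectation (\<lambda>x. exp (- x))"]) auto
qed

end

section \<open>The renewal process and the on/off law\<close>

lemma switch_time_Suc: "switch_time d z (Suc j) = switch_time d z j + (if j = 0 then d else z (Suc j))"
  by (simp add: switch_time_def)

lemma strict_mono_switch_time:
  assumes "0 < d" "\<And>l. 2 \<le> l \<Longrightarrow> 0 < z l"
  shows "strict_mono (switch_time d z)"
  unfolding strict_mono_Suc_iff using assms by (auto simp: switch_time_Suc)

text \<open>Strictly increasing switch times leave exactly one nonzero indicator in the defining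
  series.\<close>

lemma onoff_eq:
  assumes mono: "strict_mono (switch_time d z)"
    and j: "switch_time d z j \<le> t" "t < switch_time d z (Suc j)"
  shows "onoff d z b t = of_bool (b j)"
proof -
  have "of_bool (switch_time d z i \<le> t \<and> t < switch_time d z (Suc i)) * of_bool (b i) =
      (if i = j then of_bool (b j) else 0 :: real)" for i
  proof (cases i j rule: linorder_cases)
    case less
    then have "switch_time d z (Suc i) \<le> switch_time d z j"
      using strict_mono_less_eq[OF mono] by simp
    then show ?thesis using j less by auto
  next
    case greater
    then have "switch_time d z (Suc j) \<le> switch_time d z i"
      using strict_mono_less_eq[OF mono] by simp
    then show ?thesis using j greater by auto
  qed (use j in auto)
  then show ?thesis
    unfolding onoff_def using sums_single[of j "\<lambda>_. of_bool (b j) :: real"] by (simp add: sums_iff)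
qed

lemma switch_interval_exists:
  assumes "0 \<le> t" "t < switch_time d z m"
  obtains j where "switch_time d z j \<le> t" "t < switch_time d z (Suc j)"
proof -
  let ?k = "LEAST k. t < switch_time d z k"
  have k: "t < switch_time d z ?k" using assms(2) by (rule LeastI)
  have "switch_time d z 0 = 0" by (simp add: switch_time_def)
  then have "?k \<noteq> 0" using k assms(1) by (metis not_less)
  then obtain j where j: "?k = Suc j" using not0_implies_Suc by blast
  then have "\<not> t < switch_time d z j" using not_less_Least[of j "\<lambda>k. t < switch_time d z k"] by simp
  then show ?thesis using that[of j] j k by simp
qed

text \<open>
  The product \<open>\<sigma>\<close>-algebra only sees countably many times. For a cadlag path the rational times
  decide: if it takes the value 1 in the window, it exceeds 1/2 at a rational time of the window.
\<close>

definition hit_set :: "real \<Rightarrow> real \<Rightarrow> (real \<Rightarrow> real) set" where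
  "hit_set s \<delta> = {x \<in> space path_measurable_space. \<exists>t\<in>\<rat> \<inter> {s..<s + \<delta>}. 1 / 2 < x t}"

definition stay_set :: "real \<Rightarrow> real \<Rightarrow> (real \<Rightarrow> real) set" where
  "stay_set s \<delta> = {x \<in> space path_measurable_space. \<forall>t\<in>\<rat> \<inter> {s..<s + \<delta>}. x t = 1}"

lemma rational_path_sets:
  assumes "\<And>t. t \<in> I \<Longrightarrow> 0 \<le> t" "A \<in> sets borel"
  shows "{x \<in> space path_measurable_space. \<exists>t\<in>\<rat> \<inter> I. x t \<in> A} \<in> sets path_measurable_space"
    and "{x \<in> space path_measurable_space. \<forall>t\<in>\<rat> \<inter> I. x t \<in> A} \<in> sets path_measurable_space"
proof -
  have ex: "{x \<in> space path_measurable_space. \<exists>t\<in>\<rat> \<inter> I. x t \<in> A} \<in> sets path_measurable_space"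
    if [measurable]: "A \<in> sets borel" for A
  proof -
    have "{x \<in> space path_measurable_space. x t \<in> A} \<in> sets path_measurable_space" if "t \<in> \<rat> \<inter> I" for t
    proof -
      have [measurable]: "(\<lambda>x. x t) \<in> borel_measurable path_measurable_space"
        using assms(1) that by (intro measurable_component_singleton) auto
      show ?thesis by measurable
    qed
    then have "(\<Union>t\<in>\<rat> \<inter> I. {x \<in> space path_measurable_space. x t \<in> A}) \<in> sets path_measurable_space"
      by (intro sets.countable_UN' countable_Int1 countable_rat image_subsetI)
    also have "(\<Union>t\<in>\<rat> \<inter> I. {x \<in> space path_measurable_space. x t \<in> A}) =
        {x \<in> space path_measurable_space. \<exists>t\<in>\<rat> \<inter> I. x t \<in> A}" by blast
    finally show ?thesis .
  qed
  show "{x \<in> space path_measurable_space. \<exists>t\<in>\<rat> \<inter> I. x t \<in> A} \<in> sets path_measurable_space"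
    by (rule ex[OF assms(2)])
  have "space path_measurable_space - {x \<in> space path_measurable_space. \<exists>t\<in>\<rat> \<inter> I. x t \<in> - A} \<in> sets path_measurable_space"
    using ex[of "- A"] assms(2) by (intro sets.compl_sets) (simp add: borel_comp)
  also have "space path_measurable_space - {x \<in> space path_measurable_space. \<exists>t\<in>\<rat> \<inter> I. x t \<in> - A} =
      {x \<in> space path_measurable_space. \<forall>t\<in>\<rat> \<inter> I. x t \<in> A}" by blast
  finally show "{x \<in> space path_measurable_space. \<forall>t\<in>\<rat> \<inter> I. x t \<in> A} \<in> sets path_measurable_space" .
qed

lemma hit_set_measurable: "0 \<le> s \<Longrightarrow> hit_set s \<delta> \<in> sets path_measurable_space"
  using rational_path_sets(1)[of "{s..<s + \<delta>}" "{1 / 2<..}"] by (auto simp: hit_set_def)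

lemma stay_set_measurable: "0 \<le> s \<Longrightarrow> stay_set s \<delta> \<in> sets path_measurable_space"
  using rational_path_sets(2)[of "{s..<s + \<delta>}" "{1}"] by (auto simp: stay_set_def)

section \<open>Switch times of the delayed renewal process\<close>

locale positive_law =
  fixes \<nu> :: "real measure"
  assumes law: "positive_finite_mean_law \<nu>"
begin

abbreviation "age \<equiv> interval_measure (equilibrium_cdf \<nu>)"
abbreviation "gaps \<equiv> PiM {2::nat..} (\<lambda>_. \<nu>)"
abbreviation "renewal \<equiv> age \<Otimes>\<^sub>M gaps"
abbreviation "S j x \<equiv> switch_time (fst x) (snd x) j"

sublocale \<nu>: real_distribution \<nu> using law by (simp add: positive_finite_mean_law_def)
sublocale age: real_distribution age by (rule real_distribution_equilibrium[OF law])
sublocale gaps: product_prob_space "\<lambda>_. \<nu>" "{2::nat..}" ..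
sublocale renewal: pair_prob_space age gaps ..

lemma switch_time_measurable [measurable]: "S j \<in> borel_measurable renewal"
proof -
  have *: "(\<lambda>x. snd x l) \<in> borel_measurable renewal" if "2 \<le> l" for l
    using measurable_compose[OF measurable_snd measurable_component_singleton[of l "{2..}" "\<lambda>_. \<nu>"]] that
    by (simp add: measurable_cong_sets[OF refl \<nu>.events_eq_borel])
  show ?thesis
  proof (cases "j = 0")
    case True then show ?thesis by (simp add: switch_time_def)
  next
    case False
    have "(\<lambda>x. fst x + (\<Sum>l=2..j. snd x l)) \<in> borel_measurable renewal"
      using * by (intro borel_measurable_add borel_measurable_sum) auto
    then show ?thesis using False by (simp add: switch_time_def)
  qed
qed

lemma AE_renewal_pos: "AE x in renewal. 0 < fst x \<and> (\<forall>l\<ge>2. 0 < snd x l)"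
proof -
  have "AE x in renewal. 0 < fst x"
  proof (rule renewal.AE_pair_measure)
    have "AE x in age. 0 < x" by (rule AE_equilibrium_pos[OF law])
    then show "AE x in age. AE y in gaps. 0 < fst (x, y)" by eventually_elim simp
  qed measurable
  moreover have "AE x in renewal. 0 < snd x l" if l: "2 \<le> l" for l
  proof (rule renewal.AE_pair_measure)
    have [measurable]: "(\<lambda>x. snd x l) \<in> borel_measurable renewal"
      using measurable_compose[OF measurable_snd measurable_component_singleton[of l "{2..}" "\<lambda>_. \<nu>"]] l
      by (simp add: measurable_cong_sets[OF refl \<nu>.events_eq_borel])
    show "{x \<in> space renewal. 0 < snd x l} \<in> sets renewal" by measurable
    have "AE x in \<nu>. 0 < x" using law by (simp add: positive_finite_mean_law_def)
    then have "AE z in gaps. 0 < z l"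
      using l by (intro AE_PiM_component \<nu>.prob_space_axioms) auto
    then show "AE x in age. AE y in gaps. 0 < snd (x, y) l" by simp
  qed
  then have "AE x in renewal. \<forall>l. 2 \<le> l \<longrightarrow> 0 < snd x l"
    by (subst AE_all_countable) (auto intro: AE_impI)
  ultimately show ?thesis by eventually_elim auto
qed

text \<open>Given the gaps, the event confines the delay to a half-open interval of length \<delta>,
  whose position depends on the gaps but whose probability bound does not. For j = 0 it fails, as
  the time 0 carries no delay.\<close>

lemma emeasure_switch_window:
  assumes "0 < j"
  shows "emeasure renewal {x \<in> space renewal. s < S j x \<and> S j x \<le> s + \<delta>} \<le> ennreal (\<delta> / law_mean \<nu>)"
proof -
  let ?A = "{x \<in> space renewal. s < S j x \<and> S j x \<le> s + \<delta>}"
  have "emeasure renewal ?A = (\<integral>\<^sup>+z. emeasure age ((\<lambda>d. (d, z)) -` ?A) \<partial>gaps)"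
    by (rule renewal.emeasure_pair_measure_alt2) measurable
  also have "\<dots> \<le> (\<integral>\<^sup>+z. ennreal (\<delta> / law_mean \<nu>) \<partial>gaps)"
  proof (rule nn_integral_mono)
    fix z assume z: "z \<in> space gaps"
    have "(\<lambda>d. (d, z)) -` ?A = {s - (\<Sum>l=2..j. z l)<..s + \<delta> - (\<Sum>l=2..j. z l)}"
      using assms z by (auto simp: switch_time_def space_pair_measure)
    then show "emeasure age ((\<lambda>d. (d, z)) -` ?A) \<le> ennreal (\<delta> / law_mean \<nu>)"
      using emeasure_equilibrium_Ioc[OF law, of "s - (\<Sum>l=2..j. z l)" "s + \<delta> - (\<Sum>l=2..j. z l)"] by simp
  qed
  also have "\<dots> = ennreal (\<delta> / law_mean \<nu>)" by (simp add: gaps.emeasure_space_1)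
  finally show ?thesis .
qed

text \<open>The exponent is j - 1 because the gaps entering the j-th switch time are numbered 2 to
  j.\<close>

lemma nn_integral_gaps_exp:
  assumes r: "(\<integral>\<^sup>+x. ennreal (exp (- x)) \<partial>\<nu>) = ennreal r" "0 \<le> r"
  shows "(\<integral>\<^sup>+z. (\<Prod>l\<in>{2..j}. ennreal (exp (- z l))) \<partial>gaps) = ennreal (r ^ (j - 1))"
proof -
  let ?J = "{2..j}"
  interpret J: product_sigma_finite "\<lambda>_. \<nu>" ..
  have "ennreal (r ^ (j - 1)) = (\<Prod>l\<in>?J. (\<integral>\<^sup>+x. ennreal (exp (- x)) \<partial>\<nu>))"
    using r by (simp add: ennreal_power)
  also have "\<dots> = (\<integral>\<^sup>+z. (\<Prod>l\<in>?J. ennreal (exp (- z l))) \<partial>PiM ?J (\<lambda>_. \<nu>))"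
    by (rule J.product_nn_integral_prod[symmetric]) auto
  \<comment> \<open>The product formula concerns finite products; the infinite family of gaps
    reaches it through its finite marginal.\<close>
  also have "PiM ?J (\<lambda>_. \<nu>) = distr gaps (PiM ?J (\<lambda>_. \<nu>)) (\<lambda>x. restrict x ?J)"
    by (rule gaps.distr_PiM_restrict_finite[symmetric]) auto
  also have "(\<integral>\<^sup>+z. (\<Prod>l\<in>?J. ennreal (exp (- z l))) \<partial>distr gaps (PiM ?J (\<lambda>_. \<nu>)) (\<lambda>x. restrict x ?J))
      = (\<integral>\<^sup>+z. (\<Prod>l\<in>?J. ennreal (exp (- (restrict z ?J) l))) \<partial>gaps)"
    by (rule nn_integral_distr) (auto intro!: measurable_restrict_subset)
  also have "\<dots> = (\<integral>\<^sup>+z. (\<Prod>l\<in>?J. ennreal (exp (- z l))) \<partial>gaps)"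
    by (rule nn_integral_cong) (auto intro!: prod.cong)
  finally show ?thesis by simp
qed

text \<open>Chernoff bound with exponent 1; the delay \<open>d > 0\<close> is dropped.\<close>

lemma emeasure_early_switch:
  assumes r: "(\<integral>\<^sup>+x. ennreal (exp (- x)) \<partial>\<nu>) = ennreal r" "0 \<le> r" and "0 < j"
  shows "emeasure renewal {x \<in> space renewal. S j x \<le> T} \<le> ennreal (exp T * r ^ (j - 1))"
proof -
  let ?A = "{x \<in> space renewal. S j x \<le> T}"
  have m: "(\<lambda>z. z l) \<in> borel_measurable gaps" if "l \<in> {2..j}" for l
    using measurable_component_singleton[of l "{2..}" "\<lambda>_. \<nu>"] that
    by (simp add: measurable_cong_sets[OF refl \<nu>.events_eq_borel])
  have [measurable]: "(\<lambda>z. \<Sum>l=2..j. z l) \<in> borel_measurable gaps"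
    by (rule borel_measurable_sum) (rule m)
  have [measurable]: "(\<lambda>z. \<Prod>l\<in>{2..j}. ennreal (exp (- z l))) \<in> borel_measurable gaps"
    using m by (intro borel_measurable_prod_ennreal measurable_compose[OF _ measurable_ennreal] borel_measurable_exp borel_measurable_uminus) auto
  have "emeasure renewal ?A = (\<integral>\<^sup>+d. emeasure gaps (Pair d -` ?A) \<partial>age)"
    by (rule gaps.emeasure_pair_measure_alt) measurable
  also have "\<dots> \<le> (\<integral>\<^sup>+d. ennreal (exp T * r ^ (j - 1)) \<partial>age)"
  proof (rule nn_integral_mono_AE)
    have "AE x in age. 0 < x" by (rule AE_equilibrium_pos[OF law])
    then show "AE d in age. emeasure gaps (Pair d -` ?A) \<le> ennreal (exp T * r ^ (j - 1))"
    proof eventually_elim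
      case (elim d)
      have "emeasure gaps (Pair d -` ?A) \<le> emeasure gaps {z \<in> space gaps. (\<Sum>l=2..j. z l) \<le> T}"
        using elim assms(3) by (intro emeasure_mono) (auto simp: switch_time_def space_pair_measure)
      also have "\<dots> = (\<integral>\<^sup>+z. indicator {z \<in> space gaps. (\<Sum>l=2..j. z l) \<le> T} z \<partial>gaps)"
        by (rule nn_integral_indicator[symmetric]) measurable
      also have "\<dots> \<le> (\<integral>\<^sup>+z. ennreal (exp T) * (\<Prod>l\<in>{2..j}. ennreal (exp (- z l))) \<partial>gaps)"
      proof (rule nn_integral_mono)
        fix z
        have "1 \<le> exp T * (\<Prod>l\<in>{2..j}. exp (- z l))" if "(\<Sum>l=2..j. z l) \<le> T"
          using that by (simp add: exp_sum[symmetric] exp_add[symmetric] sum_negf)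
        then have "1 \<le> ennreal (exp T) * (\<Prod>l\<in>{2..j}. ennreal (exp (- z l)))" if "(\<Sum>l=2..j. z l) \<le> T"
          using that by (simp add: prod_ennreal ennreal_mult[symmetric] prod_nonneg flip: ennreal_1)
        then show "indicator {z \<in> space gaps. (\<Sum>l=2..j. z l) \<le> T} z \<le> ennreal (exp T) * (\<Prod>l\<in>{2..j}. ennreal (exp (- z l)))"
          by (auto simp: indicator_def)
      qed
      also have "\<dots> = ennreal (exp T * r ^ (j - 1))"
        using r(2) by (simp add: nn_integral_cmult nn_integral_gaps_exp[OF r] ennreal_mult)
      finally show ?case .
    qed
  qed
  also have "\<dots> = ennreal (exp T * r ^ (j - 1))" using age.emeasure_space_1 by simp
  finally show ?thesis .
qed

text \<open>No explosion: the probabilities that the switch times stay below T are geometrically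
  small, so Borel-Cantelli applies for each integer T. Hence every time lies in some interval
  between switches.\<close>

lemma AE_renewal_unbounded: "AE x in renewal. \<forall>t. \<exists>j. t < S j x"
proof -
  obtain r where r: "0 \<le> r" "r < 1" "(\<integral>\<^sup>+x. ennreal (exp (- x)) \<partial>\<nu>) = ennreal r"
    by (rule laplace_lt_1[OF law])
  have "AE x in renewal. \<exists>j. real T < S j x" for T :: nat
  proof -
    let ?A = "\<lambda>j. {x \<in> space renewal. S (Suc j) x \<le> real T}"
    have "AE x in renewal. eventually (\<lambda>j. x \<in> space renewal - ?A j) sequentially"
    proof (rule borel_cantelli_AE1)
      show "summable (\<lambda>j. measure renewal (?A j))"
      proof (rule summable_comparison_test')
        show "summable (\<lambda>j. exp (real T) * r ^ j)"
          using r by (intro summable_mult summable_geometric) auto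
        show "norm (measure renewal (?A j)) \<le> exp (real T) * r ^ j" if "j \<ge> 0" for j
          using emeasure_early_switch[OF r(3,1), of "Suc j" "real T"] r(1)
          by (simp add: renewal.P.emeasure_eq_measure)
      qed
      show "?A j \<in> sets renewal" for j by measurable
    qed (simp add: renewal.P.emeasure_eq_measure)
    then show ?thesis
      by (rule AE_mp) (auto simp: eventually_sequentially not_le intro!: AE_I2)
  qed
  then have "AE x in renewal. \<forall>T::nat. \<exists>j. real T < S j x" by (simp add: AE_all_countable)
  then show ?thesis
    by eventually_elim (meson less_le_trans less_trans reals_Archimedean2)
qed

text \<open>The sum is the expected number of switches in (s, s + \<delta>]. The first N terms are
  of order \<delta> each by the bounded density of the delay; the later ones are small whatever
  \<delta> is, since so many switches before T + 1 are unlikely. Both bounds are uniform in s \<le>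
  T.\<close>

lemma switch_window_sum:
  assumes "0 < \<eta>"
  obtains \<delta>\<^sub>0 where "0 < \<delta>\<^sub>0" "\<And>\<delta> s. 0 < \<delta> \<Longrightarrow> \<delta> \<le> \<delta>\<^sub>0 \<Longrightarrow> s \<le> T \<Longrightarrow>
    suminf (\<lambda>j. emeasure renewal {x \<in> space renewal. s < S (Suc j) x \<and> S (Suc j) x \<le> s + \<delta>}) \<le> ennreal \<eta>"
proof -
  obtain r where r: "0 \<le> r" "r < 1" "(\<integral>\<^sup>+x. ennreal (exp (- x)) \<partial>\<nu>) = ennreal r"
    by (rule laplace_lt_1[OF law])
  have \<mu>: "0 < law_mean \<nu>" by (rule law_mean_pos[OF law])
  have "(\<lambda>N. exp (T + 1) * r ^ N / (1 - r)) \<longlonglongrightarrow> exp (T + 1) * 0 / (1 - r)"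
    using r by (intro tendsto_intros LIMSEQ_power_zero) auto
  then have "eventually (\<lambda>N. exp (T + 1) * r ^ N / (1 - r) < \<eta> / 2) sequentially"
    using assms by (intro order_tendstoD) auto
  then obtain N where N: "exp (T + 1) * r ^ N / (1 - r) < \<eta> / 2"
    by (auto simp: eventually_sequentially)
  \<comment> \<open>The bound 1 keeps windows before T + 1; the other entry brings the first N terms
    below \<eta>/2, with N + 1 in place of N to avoid division by 0.\<close>
  define \<delta>\<^sub>0 where "\<delta>\<^sub>0 = min 1 (\<eta> * law_mean \<nu> / (2 * (real N + 1)))"
  show ?thesis
  proof (rule that)
    show "0 < \<delta>\<^sub>0" using assms \<mu> by (simp add: \<delta>\<^sub>0_def)
    fix \<delta> s assume \<delta>: "0 < \<delta>" "\<delta> \<le> \<delta>\<^sub>0" and s: "s \<le> T"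
    let ?A = "\<lambda>j. {x \<in> space renewal. s < S (Suc j) x \<and> S (Suc j) x \<le> s + \<delta>}"
    define m where "m j = (if j < N then \<delta> / law_mean \<nu> else exp (T + 1) * r ^ j)" for j
    have m_tail: "(\<lambda>j. m (j + N)) sums (exp (T + 1) * r ^ N * (1 / (1 - r)))"
      using sums_mult[OF geometric_sums[of r], of "exp (T + 1) * r ^ N"] r
      by (simp add: m_def power_add mult_ac)
    have summ: "summable m"
      using sums_summable[OF m_tail] summable_iff_shift[of m N] by blast
    have "suminf m = suminf (\<lambda>j. m (j + N)) + (\<Sum>j<N. m j)"
      by (rule suminf_split_initial_segment[OF summ])
    also have "\<dots> = exp (T + 1) * r ^ N / (1 - r) + real N * (\<delta> / law_mean \<nu>)"
      unfolding sums_unique[OF m_tail, symmetric] by (simp add: m_def)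
    also have "real N * (\<delta> / law_mean \<nu>) \<le> (real N + 1) * ((\<eta> * law_mean \<nu> / (2 * (real N + 1))) / law_mean \<nu>)"
      using \<delta> \<mu> by (intro mult_mono divide_right_mono) (auto simp: \<delta>\<^sub>0_def)
    also have "\<dots> = \<eta> / 2"
    proof -
      have "c * ((\<eta> * law_mean \<nu> / (2 * c)) / law_mean \<nu>) = \<eta> / 2" if "0 < c" for c
        using that \<mu> by (simp add: field_simps)
      from this[of "real N + 1"] show ?thesis by linarith
    qed
    finally have total: "suminf m \<le> \<eta>" using N by linarith
    have nonneg: "0 \<le> m j" for j using r \<delta> \<mu> by (simp add: m_def)
    have "emeasure renewal (?A j) \<le> ennreal (m j)" for j
    proof (cases "j < N")
      case True then show ?thesis using emeasure_switch_window[of "Suc j" s \<delta>] by (simp add: m_def)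
    next
      case False
      have "emeasure renewal (?A j) \<le> emeasure renewal {x \<in> space renewal. S (Suc j) x \<le> T + 1}"
      proof (rule emeasure_mono)
        show "{x \<in> space renewal. S (Suc j) x \<le> T + 1} \<in> sets renewal" by measurable
      qed (use s \<delta> in \<open>auto simp: \<delta>\<^sub>0_def\<close>)
      also have "\<dots> \<le> ennreal (exp (T + 1) * r ^ j)"
        using emeasure_early_switch[OF r(3,1), of "Suc j" "T + 1"] by simp
      finally show ?thesis using False by (simp add: m_def)
    qed
    then have "suminf (\<lambda>j. emeasure renewal (?A j)) \<le> suminf (\<lambda>j. ennreal (m j))"
      by (intro suminf_le) auto
    also have "\<dots> = ennreal (suminf m)" by (rule suminf_ennreal2[OF nonneg summ])
    also have "\<dots> \<le> ennreal \<eta>" using total by (rule ennreal_leI)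
    finally show "suminf (\<lambda>j. emeasure renewal (?A j)) \<le> ennreal \<eta>" .
  qed
qed


section \<open>Coins, and the law of an on/off path\<close>

definition coins :: "real \<Rightarrow> (nat \<Rightarrow> bool) measure" where
  "coins p = PiM UNIV (\<lambda>_. measure_pmf (bernoulli_pmf p))"

abbreviation "driver p \<equiv> age \<Otimes>\<^sub>M (gaps \<Otimes>\<^sub>M coins p)"

lemma prob_space_coins: "prob_space (coins p)"
  unfolding coins_def by (rule prob_space_PiM) (rule measure_pmf.prob_space_axioms)

lemma coin_measurable: "(\<lambda>b. b j) \<in> coins p \<rightarrow>\<^sub>M count_space UNIV"
  using measurable_component_singleton[of j UNIV "\<lambda>_. measure_pmf (bernoulli_pmf p)"]
  by (simp add: coins_def measurable_cong_sets[OF refl, of "measure_pmf (bernoulli_pmf p)" "count_space UNIV"])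

lemma coin_set_measurable: "{b \<in> space (coins p). b j} \<in> sets (coins p)"
proof -
  have "{b \<in> space (coins p). b j} = (\<lambda>b. b j) -` {True} \<inter> space (coins p)" by auto
  then show ?thesis using measurable_sets[OF coin_measurable, of "{True}"] by simp
qed

lemma emeasure_coin:
  assumes "0 \<le> p" "p \<le> 1"
  shows "emeasure (coins p) {b \<in> space (coins p). b j} = ennreal p"
proof -
  have "emeasure (bernoulli_pmf p) {True} = emeasure (distr (coins p) (measure_pmf (bernoulli_pmf p)) (\<lambda>\<omega>. \<omega> j)) {True}"
    unfolding coins_def by (subst distr_PiM_component) (auto intro: measure_pmf.prob_space_axioms)
  also have "\<dots> = emeasure (coins p) ((\<lambda>\<omega>. \<omega> j) -` {True} \<inter> space (coins p))"
    unfolding coins_def by (intro emeasure_distr measurable_component_singleton) auto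
  also have "(\<lambda>\<omega>. \<omega> j) -` {True} \<inter> space (coins p) = {b \<in> space (coins p). b j}" by auto
  finally show ?thesis using assms by (simp add: emeasure_pmf_single)
qed

lemma prob_space_driver: "prob_space (driver p)"
proof -
  interpret c: prob_space "coins p" by (rule prob_space_coins)
  interpret gc: pair_prob_space gaps "coins p" ..
  interpret pair_prob_space age "gaps \<Otimes>\<^sub>M coins p" ..
  show ?thesis by (rule P.prob_space_axioms)
qed

abbreviation "timing y \<equiv> (fst y, fst (snd y))"

lemma timing_measurable [measurable]: "timing \<in> driver p \<rightarrow>\<^sub>M renewal"
  by measurable

lemma driver_event_measurable:
  assumes [measurable]: "A \<in> sets renewal" "C \<in> sets (coins p)"
  shows "{y \<in> space (driver p). timing y \<in> A \<and> snd (snd y) \<in> C} \<in> sets (driver p)"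
  by measurable

text \<open>The product is nested with the coins beside the gaps rather than beside the pair of
  delay and gaps. Slicing at a fixed delay turns the event into a rectangle and recovers the
  independence of timing and coins.\<close>

lemma emeasure_driver:
  assumes A: "A \<in> sets renewal" and C: "C \<in> sets (coins p)"
  shows "emeasure (driver p) {y \<in> space (driver p). timing y \<in> A \<and> snd (snd y) \<in> C} =
    emeasure renewal A * emeasure (coins p) C"
proof -
  interpret c: prob_space "coins p" by (rule prob_space_coins)
  interpret gc: pair_prob_space gaps "coins p" ..
  let ?X = "{y \<in> space (driver p). timing y \<in> A \<and> snd (snd y) \<in> C}"
  have [measurable]: "A \<in> sets renewal" "C \<in> sets (coins p)" by fact+
  have AS: "A \<subseteq> space renewal" "C \<subseteq> space (coins p)"
    by (rule sets.sets_into_space[OF A], rule sets.sets_into_space[OF C])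
  have "emeasure (driver p) ?X = (\<integral>\<^sup>+d. emeasure (gaps \<Otimes>\<^sub>M coins p) (Pair d -` ?X) \<partial>age)"
    by (rule gc.P.emeasure_pair_measure_alt) measurable
  also have "\<dots> = (\<integral>\<^sup>+d. emeasure gaps (Pair d -` A) * emeasure (coins p) C \<partial>age)"
  proof (rule nn_integral_cong)
    fix d
    have "Pair d -` ?X = (Pair d -` A) \<times> C"
      using AS by (auto simp: space_pair_measure)
    moreover have "Pair d -` A \<in> sets gaps" by (rule sets_Pair1[OF A])
    ultimately show "emeasure (gaps \<Otimes>\<^sub>M coins p) (Pair d -` ?X) = emeasure gaps (Pair d -` A) * emeasure (coins p) C"
      using C by (simp add: c.emeasure_pair_measure_Times)
  qed
  also have "\<dots> = (\<integral>\<^sup>+d. emeasure gaps (Pair d -` A) \<partial>age) * emeasure (coins p) C"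
    by (rule nn_integral_multc) (rule gaps.measurable_emeasure_Pair[OF A])
  also have "(\<integral>\<^sup>+d. emeasure gaps (Pair d -` A) \<partial>age) = emeasure renewal A"
    by (rule gaps.emeasure_pair_measure_alt[OF A, symmetric])
  finally show ?thesis .
qed

lemma AE_driver:
  assumes "AE x in renewal. P x"
  shows "AE y in driver p. P (timing y)"
proof -
  interpret c: prob_space "coins p" by (rule prob_space_coins)
  obtain N where N: "N \<in> null_sets renewal" "{x \<in> space renewal. \<not> P x} \<subseteq> N"
    using assms by (auto simp: eventually_ae_filter)
  let ?N = "{y \<in> space (driver p). timing y \<in> N \<and> snd (snd y) \<in> space (coins p)}"
  have [measurable]: "N \<in> sets renewal" using N by auto
  have "emeasure (driver p) ?N = 0"
    using N by (subst emeasure_driver) auto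
  moreover have "?N \<in> sets (driver p)" by measurable
  moreover have "{y \<in> space (driver p). \<not> P (timing y)} \<subseteq> ?N"
    using N(2) by (auto simp: space_pair_measure)
  ultimately show ?thesis by (auto intro: AE_I)
qed

lemma AE_driver_good:
  "AE y in driver p. strict_mono (\<lambda>j. S j (timing y)) \<and> (\<forall>t. \<exists>j. t < S j (timing y))"
proof (rule AE_driver)
  show "AE x in renewal. strict_mono (\<lambda>j. S j x) \<and> (\<forall>t. \<exists>j. t < S j x)"
    using AE_renewal_pos AE_renewal_unbounded
    by eventually_elim (auto intro!: strict_mono_switch_time)
qed

abbreviation path_of :: "real \<times> (nat \<Rightarrow> real) \<times> (nat \<Rightarrow> bool) \<Rightarrow> real \<Rightarrow> real" where
  "path_of \<equiv> \<lambda>(d, z, b). \<lambda>t\<in>{0..}. onoff d z b t"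

lemma onoff_law_driver: "onoff_law \<nu> p = distr (driver p) path_measurable_space path_of"
  by (simp add: onoff_law_def coins_def)

lemma path_of_measurable [measurable]: "path_of \<in> driver p \<rightarrow>\<^sub>M path_measurable_space"
proof -
  have "(\<lambda>y. \<lambda>t\<in>{0..}. onoff (fst y) (fst (snd y)) (snd (snd y)) t) \<in> driver p \<rightarrow>\<^sub>M path_measurable_space"
  proof (rule measurable_restrict)
    fix t :: real
    have [measurable]: "(\<lambda>y. switch_time (fst y) (fst (snd y)) j) \<in> borel_measurable (driver p)" for j
      using measurable_compose[OF timing_measurable switch_time_measurable[of j]] by simp
    have [measurable]: "Measurable.pred (driver p) (\<lambda>y. snd (snd y) j)" for j
      by (rule measurable_compose[OF measurable_compose[OF measurable_snd measurable_snd] coin_measurable])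
    show "(\<lambda>y. onoff (fst y) (fst (snd y)) (snd (snd y)) t) \<in> borel_measurable (driver p)"
      unfolding onoff_def by measurable
  qed
  then show ?thesis by (simp add: case_prod_beta)
qed

lemma path_of_good:
  assumes "strict_mono (\<lambda>j. S j (timing y))" "\<forall>t. \<exists>j. t < S j (timing y)" "0 \<le> t"
  obtains j where "S j (timing y) \<le> t" "t < S (Suc j) (timing y)" "path_of y t = of_bool (snd (snd y) j)"
proof -
  obtain m where m: "t < S m (timing y)" using assms(2) by auto
  obtain j where j: "S j (timing y) \<le> t" "t < S (Suc j) (timing y)"
    using switch_interval_exists[OF assms(3) m] by auto
  have "path_of y t = of_bool (snd (snd y) j)"
    using assms(1,3) j onoff_eq[of "fst y" "fst (snd y)" j t "snd (snd y)"] by (simp add: case_prod_beta)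
  with j show ?thesis by (rule that)
qed

text \<open>Stated at rational times so that it is an event of the product \<sigma>-algebra and can
  be transported to any process with this law; right-continuity supplies the other times
  (\<open>cadlag_binary\<close>).\<close>

lemma AE_onoff_law_binary: "AE x in onoff_law \<nu> p. \<forall>t\<in>\<rat> \<inter> {0..}. x t \<in> {0, 1}"
proof -
  have "AE y in driver p. \<forall>t\<in>\<rat> \<inter> {0..}. path_of y t \<in> {0, 1}"
    using AE_driver_good
  proof eventually_elim
    case (elim y)
    show ?case
    proof
      fix t :: real assume "t \<in> \<rat> \<inter> {0..}"
      then have "0 \<le> t" by simp
      then obtain j where "path_of y t = of_bool (snd (snd y) j)"
        using path_of_good[of y t] elim by blast
      then show "path_of y t \<in> {0, 1}" by (simp only:) simp
    qed
  qed
  moreover have "{x \<in> space path_measurable_space. \<forall>t\<in>\<rat> \<inter> {0..}. x t \<in> {0, 1}} \<in> sets path_measurable_space"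
    by (rule rational_path_sets(2)) auto
  ultimately show ?thesis
    unfolding onoff_law_driver by (subst AE_distr_iff[OF path_of_measurable])
qed

end

text \<open>Disjointness is asked at the single point x, because the renewal intervals are disjoint
  only where the switch times increase strictly, that is, almost everywhere.\<close>

lemma suminf_indicator_unique:
  assumes "\<And>i j. x \<in> B i \<Longrightarrow> x \<in> B j \<Longrightarrow> i = j"
  shows "suminf (\<lambda>j::nat. indicator (B j) x :: ennreal) = indicator (\<Union>j. B j) x"
proof (cases "\<exists>j. x \<in> B j")
  case True
  then obtain j where j: "x \<in> B j" ..
  have "indicator (B i) x = (if i = j then 1 else 0 :: ennreal)" for i
    using assms[of i j] j by (cases "i = j") (auto simp: indicator_def)
  then have "suminf (\<lambda>i. indicator (B i) x :: ennreal) = suminf (\<lambda>i. if i = j then 1 else 0)"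
    by simp
  also have "\<dots> = 1" by (rule sums_unique[OF sums_single, symmetric])
  also have "1 = (indicator (\<Union>j. B j) x :: ennreal)" using j by (auto simp: indicator_def)
  finally show ?thesis .
next
  case False
  then have "indicator (B i) x = (0 :: ennreal)" for i by (simp add: indicator_def)
  then show ?thesis using False by (simp add: indicator_def)
qed

section \<open>Probability of being on at some time, or throughout, a window\<close>

context positive_law
begin

lemma renewal_interval_unique:
  assumes mono: "strict_mono (\<lambda>j. S j x)"
    and "S i x \<le> t" "t < S (Suc i) x" "S j x \<le> t" "t < S (Suc j) x"
  shows "i = j"
proof -
  have "S i x < S (Suc j) x" "S j x < S (Suc i) x"
    by (rule le_less_trans[OF assms(2,5)], rule le_less_trans[OF assms(4,3)])
  then show ?thesis using strict_mono_less[OF mono] by simp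
qed

text \<open>Almost surely exactly one interval between switches contains t, so the indicators sum to
  1; integrate term by term.\<close>

lemma interval_prob_sum:
  assumes "0 \<le> t"
  shows "suminf (\<lambda>j. emeasure renewal {x \<in> space renewal. S j x \<le> t \<and> t < S (Suc j) x}) = 1"
proof -
  let ?A = "\<lambda>j. {x \<in> space renewal. S j x \<le> t \<and> t < S (Suc j) x}"
  have [measurable]: "?A j \<in> sets renewal" for j by measurable
  have "suminf (\<lambda>j. emeasure renewal (?A j)) = suminf (\<lambda>j. \<integral>\<^sup>+x. indicator (?A j) x \<partial>renewal)"
    by (simp only: nn_integral_indicator \<open>\<And>j. ?A j \<in> sets renewal\<close>)
  also have "\<dots> = (\<integral>\<^sup>+x. suminf (\<lambda>j. indicator (?A j) x) \<partial>renewal)"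
    by (rule nn_integral_suminf[symmetric]) measurable
  also have "\<dots> = (\<integral>\<^sup>+x. 1 \<partial>renewal)"
  proof (rule nn_integral_cong_AE)
    show "AE x in renewal. suminf (\<lambda>j. indicator (?A j) x :: ennreal) = 1"
      using AE_renewal_pos AE_renewal_unbounded AE_space
    proof eventually_elim
      case (elim x)
      then have mono: "strict_mono (\<lambda>j. S j x)"
        by (intro strict_mono_switch_time) auto
      obtain m where "t < S m x" using elim(2) by blast
      then obtain j where j: "S j x \<le> t" "t < S (Suc j) x"
        by (rule switch_interval_exists[OF assms])
      have "x \<in> ?A j" by (rule CollectI) (use elim(3) j in blast)
      then have "x \<in> (\<Union>j. ?A j)" by (rule UN_I[OF UNIV_I])
      moreover have "suminf (\<lambda>j. indicator (?A j) x :: ennreal) = indicator (\<Union>j. ?A j) x"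
      proof (rule suminf_indicator_unique)
        fix i j assume "x \<in> ?A i" "x \<in> ?A j"
        then show "i = j" unfolding mem_Collect_eq by (elim conjE) (rule renewal_interval_unique[OF mono])
      qed
      ultimately show ?case by (simp only: indicator_simps)
    qed
  qed
  also have "\<dots> = 1" by (simp add: renewal.P.emeasure_space_1)
  finally show ?thesis .
qed

definition switched_on :: "real \<Rightarrow> ((real \<times> (nat \<Rightarrow> real)) set) \<Rightarrow> nat \<Rightarrow> (real \<times> (nat \<Rightarrow> real) \<times> (nat \<Rightarrow> bool)) set" where
  "switched_on p A j = {y \<in> space (driver p). timing y \<in> A \<and> snd (snd y) \<in> {b \<in> space (coins p). b j}}"

lemma emeasure_switched_on:
  assumes "A \<in> sets renewal" "0 \<le> p" "p \<le> 1"
  shows "emeasure (driver p) (switched_on p A j) = emeasure renewal A * ennreal p"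
  unfolding switched_on_def using assms by (simp only: emeasure_driver coin_set_measurable emeasure_coin)

lemma switched_on_measurable:
  "A \<in> sets renewal \<Longrightarrow> switched_on p A j \<in> sets (driver p)"
  unfolding switched_on_def by (intro driver_event_measurable coin_set_measurable)

text \<open>A path that is on in the window has an on coin on some interval meeting the window. Such
  an interval either contains s + \<delta>, with total probability 1, or ends inside the window,
  with total probability at most \<eta>. Independence of coins and timing turns the union bound into
  p times 1 + \<eta>.\<close>

lemma hit_prob:
  assumes p: "0 \<le> p" "p \<le> 1" and s: "0 \<le> s" "0 < \<delta>" and \<eta>: "0 \<le> \<eta>"
    and W: "suminf (\<lambda>j. emeasure renewal {x \<in> space renewal. s < S (Suc j) x \<and> S (Suc j) x \<le> s + \<delta>}) \<le> ennreal \<eta>"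
  shows "emeasure (onoff_law \<nu> p) (hit_set s \<delta>) \<le> ennreal (p * (1 + \<eta>))"
proof -
  let ?W = "\<lambda>j. {x \<in> space renewal. s < S (Suc j) x \<and> S (Suc j) x \<le> s + \<delta>}"
  let ?I = "\<lambda>j. {x \<in> space renewal. S j x \<le> s + \<delta> \<and> s + \<delta> < S (Suc j) x}"
  let ?A = "\<lambda>j. {x \<in> space renewal. S j x \<le> s + \<delta> \<and> s < S (Suc j) x}"
  have sets1: "?W j \<in> sets renewal" for j by measurable
  have sets2: "?I j \<in> sets renewal" for j by measurable
  have sets3: "?A j \<in> sets renewal" for j by measurable
  note sets = sets1 sets2 sets3
  define A where "A = ?A"
  define a where "a j = emeasure renewal (A j)" for j
  define w where "w j = emeasure renewal (?W j)" for j
  define v where "v j = emeasure renewal (?I j)" for j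
  have A_sets: "A j \<in> sets renewal" for j unfolding A_def by (rule sets(3))
  have law_eq: "emeasure (onoff_law \<nu> p) (hit_set s \<delta>) = emeasure (driver p) (path_of -` hit_set s \<delta> \<inter> space (driver p))"
    unfolding onoff_law_driver by (rule emeasure_distr[OF path_of_measurable hit_set_measurable[OF s(1)]])
  have law_le: "emeasure (driver p) (path_of -` hit_set s \<delta> \<inter> space (driver p)) \<le> emeasure (driver p) (\<Union>j. switched_on p (A j) j)"
  proof (rule emeasure_mono_AE)
    show "AE y in driver p. y \<in> path_of -` hit_set s \<delta> \<inter> space (driver p) \<longrightarrow> y \<in> (\<Union>j. switched_on p (A j) j)"
      using AE_driver_good
    proof eventually_elim
      case (elim y)
      show ?case
      proof
        assume y: "y \<in> path_of -` hit_set s \<delta> \<inter> space (driver p)"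
        then have "path_of y \<in> hit_set s \<delta>" by (rule IntD1[THEN vimageD])
        then obtain t where t: "s \<le> t" "t < s + \<delta>" "1 / 2 < path_of y t"
          unfolding hit_set_def mem_Collect_eq by (meson IntD2 atLeastLessThan_iff)
        then obtain j where j: "S j (timing y) \<le> t" "t < S (Suc j) (timing y)" "path_of y t = of_bool (snd (snd y) j)"
          using path_of_good[of y t, OF _ _ order_trans[OF s(1) t(1)]] elim by blast
        have "snd (snd y) j"
        proof (rule ccontr)
          assume "\<not> snd (snd y) j"
          then show False using t(3) unfolding j(3) by simp
        qed
        have y_space: "y \<in> space (driver p)" using y by (rule IntD2)
        have "timing y \<in> A j"
          unfolding A_def mem_Collect_eq using j(1,2) t(1,2) measurable_space[OF timing_measurable y_space] by simp
        moreover have "snd (snd y) \<in> space (coins p)"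
          using y_space by (auto simp: space_pair_measure)
        ultimately have "y \<in> switched_on p (A j) j"
          unfolding switched_on_def using y_space \<open>snd (snd y) j\<close> by blast
        then show "y \<in> (\<Union>j. switched_on p (A j) j)" by blast
      qed
    qed
    show "(\<Union>j. switched_on p (A j) j) \<in> sets (driver p)"
      by (rule sets.countable_UN) (use switched_on_measurable[OF A_sets] in blast)
  qed
  have "emeasure (driver p) (\<Union>j. switched_on p (A j) j) \<le> suminf (\<lambda>j. emeasure (driver p) (switched_on p (A j) j))"
    by (rule emeasure_subadditive_countably) (use switched_on_measurable[OF A_sets] in blast)
  also have "(\<lambda>j. emeasure (driver p) (switched_on p (A j) j)) = (\<lambda>j. a j * ennreal p)"
    unfolding a_def by (rule ext) (rule emeasure_switched_on[OF A_sets p])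
  also have "suminf (\<lambda>j. a j * ennreal p) = suminf a * ennreal p"
    by (rule ennreal_suminf_multc)
  finally have union_le: "emeasure (driver p) (\<Union>j. switched_on p (A j) j) \<le> suminf a * ennreal p" .
  \<comment> \<open>An interval meeting the window either reaches beyond s + \<delta> or ends with a
    switch in (s, s + \<delta>].\<close>
  have avw: "a j \<le> v j + w j" for j
  proof -
    have "a j \<le> emeasure renewal (?I j \<union> ?W j)" unfolding a_def A_def
      by (rule emeasure_mono[OF _ sets.Un[OF sets(2,1)]]) auto
    also have "\<dots> \<le> v j + w j" unfolding v_def w_def
      by (rule emeasure_subadditive[OF sets(2,1)])
    finally show ?thesis .
  qed
  have "suminf a \<le> suminf (\<lambda>j. v j + w j)" by (intro suminf_le avw summableI)
  also have "\<dots> = suminf v + suminf w" by (rule suminf_add[symmetric]) (rule summableI)+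
  also have "suminf v = 1" unfolding v_def by (rule interval_prob_sum) (use s in simp)
  finally have "suminf a \<le> 1 + ennreal \<eta>" using W unfolding w_def[symmetric] by (meson add_left_mono order_trans)
  then have "suminf a * ennreal p \<le> ennreal (1 + \<eta>) * ennreal p"
    using \<eta> by (intro mult_right_mono) (simp_all add: ennreal_plus)
  also have "\<dots> = ennreal (p * (1 + \<eta>))" using p \<eta> by (simp add: ennreal_mult' mult.commute)
  finally show ?thesis
    unfolding law_eq by (rule order_trans[OF law_le order_trans[OF union_le]])
qed

text \<open>The interval containing s covers the whole window unless it ends inside it, which costs
  at most \<eta>. An on coin on a covering interval keeps the path at 1. At most one interval
  contains s, so these events are disjoint and their probabilities may be summed for a lower
  bound.\<close>

lemma stay_prob:
  assumes p: "0 \<le> p" "p \<le> 1" and s: "0 \<le> s" "0 < \<delta>" and \<eta>: "0 \<le> \<eta>"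
    and W: "suminf (\<lambda>j. emeasure renewal {x \<in> space renewal. s < S (Suc j) x \<and> S (Suc j) x \<le> s + \<delta>}) \<le> ennreal \<eta>"
  shows "ennreal (p * (1 - \<eta>)) \<le> emeasure (onoff_law \<nu> p) (stay_set s \<delta>)"
proof -
  let ?W = "\<lambda>j. {x \<in> space renewal. s < S (Suc j) x \<and> S (Suc j) x \<le> s + \<delta>}"
  let ?I = "\<lambda>j. {x \<in> space renewal. S j x \<le> s \<and> s < S (Suc j) x}"
  let ?A = "\<lambda>j. {x \<in> space renewal. S j x \<le> s \<and> s + \<delta> < S (Suc j) x}"
  have sets1: "?W j \<in> sets renewal" for j by measurable
  have sets2: "?I j \<in> sets renewal" for j by measurable
  have sets3: "?A j \<in> sets renewal" for j by measurable
  note sets = sets1 sets2 sets3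
  define A where "A = ?A"
  define a where "a j = emeasure renewal (A j)" for j
  define w where "w j = emeasure renewal (?W j)" for j
  define v where "v j = emeasure renewal (?I j)" for j
  have A_sets: "A j \<in> sets renewal" for j unfolding A_def by (rule sets(3))
  note sw = switched_on_measurable[OF A_sets]
  have pre: "path_of -` stay_set s \<delta> \<inter> space (driver p) \<in> sets (driver p)"
    by (rule measurable_sets[OF path_of_measurable stay_set_measurable[OF s(1)]])
  have vaw: "v j \<le> a j + w j" for j
  proof -
    have "v j \<le> emeasure renewal (A j \<union> ?W j)" unfolding v_def A_def
      by (rule emeasure_mono[OF _ sets.Un[OF sets(3,1)]]) auto
    also have "\<dots> \<le> a j + w j" unfolding a_def w_def
      by (rule emeasure_subadditive[OF A_sets sets(1)])
    finally show ?thesis .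
  qed
  have "1 = suminf v" unfolding v_def by (rule interval_prob_sum[OF s(1), symmetric])
  also have "suminf v \<le> suminf (\<lambda>j. a j + w j)" by (intro suminf_le vaw summableI)
  also have "\<dots> = suminf a + suminf w" by (rule suminf_add[symmetric]) (rule summableI)+
  finally have "1 \<le> suminf a + ennreal \<eta>" using W unfolding w_def[symmetric] by (meson add_left_mono order_trans)
  then have "1 - ennreal \<eta> \<le> suminf a"
    by (simp add: ennreal_minus_le_iff add.commute)
  \<comment> \<open>If \<eta> exceeds 1, both the truncated difference and
    \<open>ennreal (1 - \<eta>)\<close> are 0.\<close>
  then have "ennreal (1 - \<eta>) \<le> suminf a"
    using \<eta> by (simp add: ennreal_minus flip: ennreal_1)
  then have "ennreal p * ennreal (1 - \<eta>) \<le> ennreal p * suminf a" by (rule mult_left_mono) simp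
  then have le_a: "ennreal (p * (1 - \<eta>)) \<le> suminf a * ennreal p"
    using p by (simp add: ennreal_mult' mult.commute)
  have "suminf a * ennreal p = suminf (\<lambda>j. a j * ennreal p)" by (rule ennreal_suminf_multc[symmetric])
  also have "(\<lambda>j. a j * ennreal p) = (\<lambda>j. \<integral>\<^sup>+y. indicator (switched_on p (A j) j) y \<partial>driver p)"
    unfolding a_def by (rule ext) (simp only: emeasure_switched_on[OF A_sets p] nn_integral_indicator sw)
  also have "suminf \<dots> = (\<integral>\<^sup>+y. suminf (\<lambda>j. indicator (switched_on p (A j) j) y) \<partial>driver p)"
    by (rule nn_integral_suminf[symmetric]) (intro borel_measurable_indicator sw)
  finally have a_eq: "suminf a * ennreal p = (\<integral>\<^sup>+y. suminf (\<lambda>j. indicator (switched_on p (A j) j) y) \<partial>driver p)" .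
  have ind_le: "(\<integral>\<^sup>+y. suminf (\<lambda>j. indicator (switched_on p (A j) j) y) \<partial>driver p) \<le> (\<integral>\<^sup>+y. indicator (path_of -` stay_set s \<delta> \<inter> space (driver p)) y \<partial>driver p)"
  proof (rule nn_integral_mono_AE)
    show "AE y in driver p. suminf (\<lambda>j. indicator (switched_on p (A j) j) y) \<le>
        (indicator (path_of -` stay_set s \<delta> \<inter> space (driver p)) y :: ennreal)"
      using AE_driver_good AE_space
    proof eventually_elim
      case (elim y)
      then have mono: "strict_mono (\<lambda>j. S j (timing y))" by simp
      have in_A: "S j (timing y) \<le> t" "t < S (Suc j) (timing y)"
        if "y \<in> switched_on p (A j) j" "s \<le> t" "t < s + \<delta>" for j t
      proof -
        have "S j (timing y) \<le> s \<and> s + \<delta> < S (Suc j) (timing y)"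
          using that(1) unfolding switched_on_def A_def mem_Collect_eq by blast
        then show "S j (timing y) \<le> t" "t < S (Suc j) (timing y)" using that(2,3) by linarith+
      qed
      have s_in: "s \<le> s" "s < s + \<delta>" using s by auto
      have sum: "suminf (\<lambda>j. indicator (switched_on p (A j) j) y :: ennreal) = indicator (\<Union>j. switched_on p (A j) j) y"
      proof (rule suminf_indicator_unique)
        fix i j assume i: "y \<in> switched_on p (A i) i" and j: "y \<in> switched_on p (A j) j"
        show "i = j" by (rule renewal_interval_unique[OF mono in_A[OF i s_in] in_A[OF j s_in]])
      qed
      have "y \<in> path_of -` stay_set s \<delta> \<inter> space (driver p)" if j: "y \<in> switched_on p (A j) j" for j
      proof -
        have on: "snd (snd y) j" using j unfolding switched_on_def A_def mem_Collect_eq by blast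
        have "path_of y t = 1" if t: "s \<le> t" "t < s + \<delta>" for t
        proof -
          have "strict_mono (switch_time (fst y) (fst (snd y)))" using mono by simp
          then have "onoff (fst y) (fst (snd y)) (snd (snd y)) t = of_bool (snd (snd y) j)"
            by (rule onoff_eq) (use in_A[OF j t] in simp_all)
          then show ?thesis using on s(1) t by (simp add: case_prod_beta)
        qed
        then have "path_of y \<in> stay_set s \<delta>"
          unfolding stay_set_def mem_Collect_eq using measurable_space[OF path_of_measurable elim(2)]
          by (intro conjI ballI) auto
        then show ?thesis using elim(2) by blast
      qed
      then have "(\<Union>j. switched_on p (A j) j) \<inter> {y} \<subseteq> path_of -` stay_set s \<delta> \<inter> space (driver p)" by blast
      then show ?case unfolding sum by (intro indicator_leI) blast
    qed
  qed
  have "(\<integral>\<^sup>+y. indicator (path_of -` stay_set s \<delta> \<inter> space (driver p)) y \<partial>driver p) = emeasure (driver p) (path_of -` stay_set s \<delta> \<inter> space (driver p))"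
    by (rule nn_integral_indicator[OF pre])
  also have "\<dots> = emeasure (onoff_law \<nu> p) (stay_set s \<delta>)"
    unfolding onoff_law_driver by (rule emeasure_distr[OF path_of_measurable stay_set_measurable[OF s(1)], symmetric])
  finally have law_eq: "(\<integral>\<^sup>+y. indicator (path_of -` stay_set s \<delta> \<inter> space (driver p)) y \<partial>driver p) =
      emeasure (onoff_law \<nu> p) (stay_set s \<delta>)" .
  show ?thesis
    by (rule order_trans[OF le_a[unfolded a_eq] ind_le[unfolded law_eq]])
qed

lemma prob_space_onoff_law: "prob_space (onoff_law \<nu> p)"
  unfolding onoff_law_driver
  by (rule prob_space.prob_space_distr[OF prob_space_driver path_of_measurable])

text \<open>The threshold is fixed before p, so it serves all n although p depends on n.\<close>

lemma onoff_law_window: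
  assumes "0 < \<eta>"
  obtains \<delta>\<^sub>0 where "0 < \<delta>\<^sub>0" "\<And>\<delta> s p. 0 < \<delta> \<Longrightarrow> \<delta> \<le> \<delta>\<^sub>0 \<Longrightarrow> 0 \<le> s \<Longrightarrow> s \<le> T \<Longrightarrow> 0 \<le> p \<Longrightarrow> p \<le> 1 \<Longrightarrow>
    measure (onoff_law \<nu> p) (hit_set s \<delta>) \<le> p * (1 + \<eta>) \<and>
    p * (1 - \<eta>) \<le> measure (onoff_law \<nu> p) (stay_set s \<delta>)"
proof -
  obtain \<delta>\<^sub>0 where \<delta>\<^sub>0: "0 < \<delta>\<^sub>0" "\<And>\<delta> s. 0 < \<delta> \<Longrightarrow> \<delta> \<le> \<delta>\<^sub>0 \<Longrightarrow> s \<le> T \<Longrightarrow>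
    suminf (\<lambda>j. emeasure renewal {x \<in> space renewal. s < S (Suc j) x \<and> S (Suc j) x \<le> s + \<delta>}) \<le> ennreal \<eta>"
    by (rule switch_window_sum[OF assms, where T = T], rule that)
  show ?thesis
  proof (rule that[OF \<delta>\<^sub>0(1)])
    fix \<delta> s p :: real
    assume a: "0 < \<delta>" "\<delta> \<le> \<delta>\<^sub>0" "0 \<le> s" "s \<le> T" "0 \<le> p" "p \<le> 1"
    interpret L: prob_space "onoff_law \<nu> p" by (rule prob_space_onoff_law)
    have "ennreal (measure (onoff_law \<nu> p) (hit_set s \<delta>)) \<le> ennreal (p * (1 + \<eta>))"
      using hit_prob[OF a(5,6,3,1) less_imp_le[OF assms] \<delta>\<^sub>0(2)[OF a(1,2,4)]] by (simp add: L.emeasure_eq_measure)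
    moreover have "ennreal (p * (1 - \<eta>)) \<le> ennreal (measure (onoff_law \<nu> p) (stay_set s \<delta>))"
      using stay_prob[OF a(5,6,3,1) less_imp_le[OF assms] \<delta>\<^sub>0(2)[OF a(1,2,4)]] by (simp add: L.emeasure_eq_measure)
    ultimately show "measure (onoff_law \<nu> p) (hit_set s \<delta>) \<le> p * (1 + \<eta>) \<and>
      p * (1 - \<eta>) \<le> measure (onoff_law \<nu> p) (stay_set s \<delta>)"
      using a assms by (simp add: ennreal_le_iff)
  qed
qed

end

section \<open>Static face counts\<close>

definition tau_real :: "(nat \<Rightarrow> real) \<Rightarrow> nat \<Rightarrow> real" where
  "tau_real a j = real j + 1 - (\<Sum>i=1..j. real ((j + 1) choose (i + 1)) * a i)"

definition psi_real :: "(nat \<Rightarrow> real) \<Rightarrow> nat \<Rightarrow> real" where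
  "psi_real a j = (\<Sum>i=1..j. real (j choose i) * a i)"

text \<open>Pascal's rule splits the coefficients of tau_{j+1} into those of tau_j and those of
  psi_{j+1}. Thus tau grows while psi is below 1 and falls once psi is above 1, which is how the
  parameter region singles out k.\<close>

lemma tau_real_Suc: "tau_real a (Suc j) = tau_real a j + 1 - psi_real a (Suc j)"
proof -
  have "(\<Sum>i=1..Suc j. real ((Suc j + 1) choose (i + 1)) * a i) =
      psi_real a (Suc j) + (\<Sum>i=1..Suc j. real ((j + 1) choose (i + 1)) * a i)"
    by (simp add: psi_real_def sum.distrib[symmetric] algebra_simps del: sum.cl_ivl_Suc)
  also have "(\<Sum>i=1..Suc j. real ((j + 1) choose (i + 1)) * a i) = (\<Sum>i=1..j. real ((j + 1) choose (i + 1)) * a i)"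
    by (simp add: binomial_eq_0)
  finally show ?thesis by (simp add: tau_real_def)
qed

lemma psi_real_mono:
  assumes a: "\<And>i. 0 \<le> a i" and "i \<le> j"
  shows "psi_real a i \<le> psi_real a j"
  using assms(2)
proof (induction rule: dec_induct)
  case (step m)
  have "psi_real a m = (\<Sum>i=1..Suc m. real (m choose i) * a i)"
    by (simp add: psi_real_def)
  also have "\<dots> \<le> psi_real a (Suc m)"
    unfolding psi_real_def
  proof (intro sum_mono mult_right_mono a)
    show "real (m choose i) \<le> real (Suc m choose i)" for i by (cases i) simp_all
  qed
  finally show ?case using step by simp
qed simp

lemma tau_real_1: "tau_real a 1 = 2 - a 1"
  by (simp add: tau_real_def numeral_eq_Suc)

definition subcells :: "nat set \<Rightarrow> nat set set" where
  "subcells A = {B. B \<subseteq> A \<and> 2 \<le> card B}"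

lemma finite_subcells: "finite A \<Longrightarrow> finite (subcells A)"
  by (rule finite_subset[of _ "Pow A"]) (auto simp: subcells_def)

lemma card_subcells: "finite A \<Longrightarrow> card (subcells A) \<le> 2 ^ card A"
  using card_mono[of "Pow A" "subcells A"] by (auto simp: subcells_def card_Pow)

lemma subcells_Int: "subcells A \<inter> subcells B = subcells (A \<inter> B)"
  by (auto simp: subcells_def)

lemma sum_subcells:
  assumes "finite A"
  shows "(\<Sum>B\<in>subcells A. g (card B - 1)) = (\<Sum>i=1..card A - 1. real (card A choose (i + 1)) * g i)"
proof -
  have "(\<Sum>B\<in>subcells A. g (card B - 1)) =
      (\<Sum>i\<in>{1..card A - 1}. \<Sum>B\<in>{B \<in> subcells A. card B - 1 = i}. g (card B - 1))"
  proof (rule sum.group[symmetric])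
    show "(\<lambda>B. card B - 1) ` subcells A \<subseteq> {1..card A - 1}"
    proof clarify
      fix B assume "B \<in> subcells A"
      then show "card B - 1 \<in> {1..card A - 1}"
        using card_mono[OF assms, of B] by (auto simp: subcells_def)
    qed
  qed (use finite_subcells[OF assms] in auto)
  also have "\<dots> = (\<Sum>i=1..card A - 1. real (card A choose (i + 1)) * g i)"
  proof (rule sum.cong[OF refl])
    fix i assume i: "i \<in> {1..card A - 1}"
    then have "{B \<in> subcells A. card B - 1 = i} = {B. B \<subseteq> A \<and> card B = i + 1}"
      by (auto simp: subcells_def)
    then show "(\<Sum>B\<in>{B \<in> subcells A. card B - 1 = i}. g (card B - 1)) = real (card A choose (i + 1)) * g i"
      using n_subsets[OF assms, of "i + 1"] by simp
  qed
  finally show ?thesis .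
qed

text \<open>The total exponent of the cells of a j-face. With about n^(j+1) vertex sets available,
  the expected number of j-faces has order n^(tau_j).\<close>

lemma sum_subcells_tau:
  assumes "finite A" "card A = Suc j"
  shows "(\<Sum>B\<in>subcells A. a (card B - 1)) = real (Suc j) - tau_real a j"
  using sum_subcells[OF assms(1), of a] assms(2) by (simp add: tau_real_def)

section \<open>Vertex sets, overlapping pairs and face counts\<close>

definition vsets :: "nat \<Rightarrow> nat \<Rightarrow> nat set set" where
  "vsets n m = {A. A \<subseteq> {1..n} \<and> card A = m}"

lemma finite_vsets: "finite (vsets n m)"
  by (rule finite_subset[of _ "Pow {1..n}"]) (auto simp: vsets_def)

lemma card_vsets: "card (vsets n m) = n choose m"
  using n_subsets[of "{1..n}" m] by (simp add: vsets_def)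

lemma vsets_finite: "A \<in> vsets n m \<Longrightarrow> finite A"
  by (auto simp: vsets_def intro: finite_subset)

lemma subcells_in_cells: "A \<in> vsets n m \<Longrightarrow> subcells A \<subseteq> cells n"
  by (auto simp: vsets_def cells_def subcells_def)

lemma card_vsets_le: "card (vsets n m) \<le> n ^ m"
  unfolding card_vsets by (cases "m \<le> n") (auto intro: binomial_le_pow simp: binomial_eq_0)

text \<open>A pair is determined by its intersection and its two differences, of sizes l, m - l and
  m - l.\<close>

lemma card_overlapping_pairs:
  assumes "l \<le> m"
  shows "card {(A, A'). A \<in> vsets n m \<and> A' \<in> vsets n m \<and> card (A \<inter> A') = l} \<le> n ^ (2 * m - l)"
proof -
  let ?P = "{(A, A'). A \<in> vsets n m \<and> A' \<in> vsets n m \<and> card (A \<inter> A') = l}"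
  let ?f = "\<lambda>(A, A'). (A \<inter> A', A - A', A' - A)"
  have "inj_on ?f ?P"
    by (rule inj_on_inverseI[where g = "\<lambda>(x, y, z). (x \<union> y, x \<union> z)"]) auto
  moreover have "?f ` ?P \<subseteq> vsets n l \<times> vsets n (m - l) \<times> vsets n (m - l)"
  proof (rule image_subsetI)
    fix x assume "x \<in> ?P"
    then obtain A A' where x: "x = (A, A')" and A: "A \<in> vsets n m" "A' \<in> vsets n m" "l = card (A \<inter> A')"
      by auto
    note fin = vsets_finite[OF A(1)] vsets_finite[OF A(2)]
    have "card (A - A') = m - l" "card (A' - A) = m - l"
      using A fin card_Diff_subset_Int[of A A'] card_Diff_subset_Int[of A' A]
      by (auto simp: vsets_def Int_commute)
    then show "?f x \<in> vsets n l \<times> vsets n (m - l) \<times> vsets n (m - l)"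
      using A by (auto simp: x vsets_def)
  qed
  ultimately have "card ?P \<le> card (vsets n l \<times> vsets n (m - l) \<times> vsets n (m - l))"
    by (intro card_inj_on_le[of ?f]) (auto simp: finite_vsets)
  also have "\<dots> = card (vsets n l) * (card (vsets n (m - l)) * card (vsets n (m - l)))"
    by (simp add: card_cartesian_product)
  also have "\<dots> \<le> n ^ l * (n ^ (m - l) * n ^ (m - l))"
    by (intro mult_mono card_vsets_le) auto
  also have "\<dots> = n ^ (2 * m - l)"
    using assms by (simp add: mult_2 flip: power_add)
  finally show ?thesis .
qed

text \<open>Written as a polynomial with nonnegative coefficients in the cell variables: for 0/1
  values it counts faces, it is monotone in every nonnegative variable, and independence gives its
  moments.\<close>

definition face_count :: "nat \<Rightarrow> nat \<Rightarrow> (nat set \<Rightarrow> real) \<Rightarrow> real" where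
  "face_count n j y = (\<Sum>A\<in>vsets n (Suc j). \<Prod>B\<in>subcells A. y B)"

lemma face_count_nonneg: "(\<And>B. B \<in> cells n \<Longrightarrow> 0 \<le> y B) \<Longrightarrow> 0 \<le> face_count n j y"
  unfolding face_count_def using subcells_in_cells by (intro sum_nonneg prod_nonneg) blast

lemma face_count_mono:
  assumes "\<And>B. B \<in> cells n \<Longrightarrow> 0 \<le> y B \<and> y B \<le> z B"
  shows "face_count n j y \<le> face_count n j z"
  unfolding face_count_def using assms subcells_in_cells by (intro sum_mono prod_mono) blast

section \<open>Moments of face counts for independent cells\<close>

locale static_faces = prob_space M for M :: "'w measure" +
  fixes Y :: "nat set \<Rightarrow> 'w \<Rightarrow> real" and n :: nat
  assumes indep: "indep_vars (\<lambda>_. borel) Y (cells n)"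
    and binary: "\<And>B \<omega>. Y B \<omega> \<in> {0, 1}"
begin

lemma Y_bounds: "0 \<le> Y B \<omega>" "Y B \<omega> \<le> 1"
  using binary[of B \<omega>] by auto

lemma Y_measurable: "B \<in> cells n \<Longrightarrow> Y B \<in> borel_measurable M"
  using indep by (auto simp: indep_vars_def)

lemma Y_prod_measurable: "C \<subseteq> cells n \<Longrightarrow> (\<lambda>\<omega>. \<Prod>B\<in>C. Y B \<omega>) \<in> borel_measurable M"
  using Y_measurable by (intro borel_measurable_prod) auto

lemma Y_prod_integrable: "C \<subseteq> cells n \<Longrightarrow> integrable M (\<lambda>\<omega>. \<Prod>B\<in>C. Y B \<omega>)"
  by (rule integrable_const_bound[of _ 1, OF _ Y_prod_measurable])
     (auto simp: abs_prod Y_bounds intro!: AE_I2 prod_le_1)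

lemma Y_integrable: "B \<in> cells n \<Longrightarrow> integrable M (Y B)"
  using Y_prod_integrable[of "{B}"] by simp

lemma expectation_Y_prod:
  assumes "C \<subseteq> cells n" "finite C"
  shows "expectation (\<lambda>\<omega>. \<Prod>B\<in>C. Y B \<omega>) = (\<Prod>B\<in>C. expectation (Y B))"
proof (cases "C = {}")
  case False
  then show ?thesis
    using assms by (intro indep_vars_lebesgue_integral indep_vars_subset[OF indep] Y_integrable) auto
qed (simp add: prob_space)

lemma expectation_Y_nonneg: "0 \<le> expectation (Y B)"
  by (rule integral_nonneg_AE) (simp add: Y_bounds)

text \<open>Binary variables are idempotent, so a cell common to both sets counts once. This turns
  second moments into expectations over unions of cells.\<close>

lemma Y_prod_mult:
  assumes "finite C" "finite D"
  shows "(\<Prod>B\<in>C. Y B \<omega>) * (\<Prod>B\<in>D. Y B \<omega>) = (\<Prod>B\<in>C \<union> D. Y B \<omega>)"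
proof -
  have "(\<Prod>B\<in>E. Y B \<omega>) = of_bool (\<forall>B\<in>E. Y B \<omega> = 1)" if "finite E" for E
    using that
  proof (induction E)
    case (insert B E)
    then show ?case using binary[of B \<omega>] by auto
  qed simp
  with assms show ?thesis by (simp add: ball_Un of_bool_conj)
qed

abbreviation "cnt j \<equiv> \<lambda>\<omega>. face_count n j (\<lambda>B. Y B \<omega>)"

lemma count_measurable [measurable]: "cnt j \<in> borel_measurable M"
  unfolding face_count_def using subcells_in_cells by (intro borel_measurable_sum Y_prod_measurable) auto

lemma count_integrable: "integrable M (cnt j)"
  unfolding face_count_def using subcells_in_cells by (intro Bochner_Integration.integrable_sum Y_prod_integrable) auto

lemma expectation_count:
  "expectation (cnt j) = (\<Sum>A\<in>vsets n (Suc j). \<Prod>B\<in>subcells A. expectation (Y B))"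
proof -
  have "expectation (cnt j) = (\<Sum>A\<in>vsets n (Suc j). expectation (\<lambda>\<omega>. \<Prod>B\<in>subcells A. Y B \<omega>))"
    unfolding face_count_def using subcells_in_cells
    by (intro Bochner_Integration.integral_sum Y_prod_integrable) auto
  also have "\<dots> = (\<Sum>A\<in>vsets n (Suc j). \<Prod>B\<in>subcells A. expectation (Y B))"
    by (intro sum.cong refl expectation_Y_prod finite_subcells) (erule subcells_in_cells vsets_finite)+
  finally show ?thesis .
qed

lemma expectation_count_sq:
  "expectation (\<lambda>\<omega>. (cnt j \<omega>)\<^sup>2) =
    (\<Sum>A\<in>vsets n (Suc j). \<Sum>A'\<in>vsets n (Suc j). \<Prod>B\<in>subcells A \<union> subcells A'. expectation (Y B))"
  and count_sq_integrable: "integrable M (\<lambda>\<omega>. (cnt j \<omega>)\<^sup>2)"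
proof -
  let ?V = "vsets n (Suc j)"
  have sub: "subcells A \<union> subcells A' \<subseteq> cells n" "finite (subcells A \<union> subcells A')"
    if "A \<in> ?V" "A' \<in> ?V" for A A'
    using subcells_in_cells[OF that(1)] subcells_in_cells[OF that(2)]
      finite_subcells[OF vsets_finite[OF that(1)]] finite_subcells[OF vsets_finite[OF that(2)]] by auto
  have eq: "(cnt j \<omega>)\<^sup>2 = (\<Sum>A\<in>?V. \<Sum>A'\<in>?V. \<Prod>B\<in>subcells A \<union> subcells A'. Y B \<omega>)" for \<omega>
    unfolding power2_eq_square face_count_def sum_product
    by (intro sum.cong refl Y_prod_mult finite_subcells) (erule vsets_finite)+
  show "integrable M (\<lambda>\<omega>. (cnt j \<omega>)\<^sup>2)"
    unfolding eq by (intro Bochner_Integration.integrable_sum Y_prod_integrable sub(1))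
  have "expectation (\<lambda>\<omega>. (cnt j \<omega>)\<^sup>2) =
      (\<Sum>A\<in>?V. expectation (\<lambda>\<omega>. \<Sum>A'\<in>?V. \<Prod>B\<in>subcells A \<union> subcells A'. Y B \<omega>))"
    unfolding eq
    by (intro Bochner_Integration.integral_sum Bochner_Integration.integrable_sum Y_prod_integrable sub(1))
  also have "\<dots> = (\<Sum>A\<in>?V. \<Sum>A'\<in>?V. expectation (\<lambda>\<omega>. \<Prod>B\<in>subcells A \<union> subcells A'. Y B \<omega>))"
    by (intro sum.cong refl Bochner_Integration.integral_sum Y_prod_integrable sub(1))
  also have "\<dots> = (\<Sum>A\<in>?V. \<Sum>A'\<in>?V. \<Prod>B\<in>subcells A \<union> subcells A'. expectation (Y B))"
    by (intro sum.cong refl expectation_Y_prod sub)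
  finally show "expectation (\<lambda>\<omega>. (cnt j \<omega>)\<^sup>2) =
    (\<Sum>A\<in>?V. \<Sum>A'\<in>?V. \<Prod>B\<in>subcells A \<union> subcells A'. expectation (Y B))" .
qed

text \<open>Pairs of faces sharing at most one vertex share no cell, so they are uncorrelated.\<close>

lemma variance_count_le:
  "variance (cnt j) \<le> (\<Sum>(A, A')\<in>{(A, A'). A \<in> vsets n (Suc j) \<and> A' \<in> vsets n (Suc j) \<and> 2 \<le> card (A \<inter> A')}.
     \<Prod>B\<in>subcells A \<union> subcells A'. expectation (Y B))"
proof -
  let ?V = "vsets n (Suc j)"
  let ?e = "\<lambda>A. \<Prod>B\<in>A. expectation (Y B)"
  let ?Q = "{(A, A'). A \<in> ?V \<and> A' \<in> ?V \<and> 2 \<le> card (A \<inter> A')}"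
  have "variance (cnt j) = (\<Sum>A\<in>?V. \<Sum>A'\<in>?V. ?e (subcells A \<union> subcells A')) -
      (\<Sum>A\<in>?V. \<Sum>A'\<in>?V. ?e (subcells A) * ?e (subcells A'))"
    unfolding variance_eq[OF count_integrable count_sq_integrable] expectation_count_sq
    unfolding power2_eq_square expectation_count sum_product ..
  also have "\<dots> = (\<Sum>(A, A')\<in>?V \<times> ?V. ?e (subcells A \<union> subcells A') - ?e (subcells A) * ?e (subcells A'))"
    by (simp add: sum.cartesian_product sum_subtractf case_prod_beta)
  also have "\<dots> = (\<Sum>(A, A')\<in>?Q. ?e (subcells A \<union> subcells A') - ?e (subcells A) * ?e (subcells A'))"
  proof (rule sum.mono_neutral_right)
    show "\<forall>x\<in>?V \<times> ?V - ?Q. (case x of (A, A') \<Rightarrow> ?e (subcells A \<union> subcells A') - ?e (subcells A) * ?e (subcells A')) = 0"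
    proof (rule ballI)
      fix x assume "x \<in> ?V \<times> ?V - ?Q"
      then obtain A A' where x: "x = (A, A')" and A: "A \<in> ?V" "A' \<in> ?V" "\<not> 2 \<le> card (A \<inter> A')"
        by auto
      have "finite (A \<inter> A')" using vsets_finite[OF A(1)] by simp
      then have "\<not> 2 \<le> card B" if "B \<subseteq> A \<inter> A'" for B
        using card_mono[OF _ that] A(3) by linarith
      then have "subcells (A \<inter> A') = {}" unfolding subcells_def by blast
      then have "subcells A \<inter> subcells A' = {}" by (simp add: subcells_Int)
      then show "(case x of (A, A') \<Rightarrow> ?e (subcells A \<union> subcells A') - ?e (subcells A) * ?e (subcells A')) = 0"
        unfolding x using finite_subcells[OF vsets_finite[OF A(1)]] finite_subcells[OF vsets_finite[OF A(2)]]
        by (simp add: prod.union_disjoint)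
    qed
  qed (auto simp: finite_vsets)
  also have "\<dots> \<le> (\<Sum>(A, A')\<in>?Q. ?e (subcells A \<union> subcells A'))"
    by (rule sum_mono) (simp add: case_prod_beta mult_nonneg_nonneg prod_nonneg expectation_Y_nonneg)
  finally show ?thesis .
qed

end

text \<open>Faces of dimension j involve only cells with at most j + 1 vertices, so the bound is
  asked for those alone. The constant K stands for the window error 1 + \<eta>; K \<ge> 1 makes its
  powers increase with the number of cells.\<close>

locale static_bounded_faces = static_faces +
  fixes a :: "nat \<Rightarrow> real" and K :: real and j :: nat
  assumes n: "0 < n" and K: "1 \<le> K"
    and Y_le: "\<And>B. B \<in> cells n \<Longrightarrow> card B \<le> Suc j \<Longrightarrow> expectation (Y B) \<le> K * real n powr (- a (card B - 1))"
begin

lemma expectation_prod_le: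
  assumes "C \<subseteq> cells n" "finite C" "\<And>B. B \<in> C \<Longrightarrow> card B \<le> Suc j"
  shows "(\<Prod>B\<in>C. expectation (Y B)) \<le> K ^ card C * real n powr (- (\<Sum>B\<in>C. a (card B - 1)))"
proof -
  have "(\<Prod>B\<in>C. expectation (Y B)) \<le> (\<Prod>B\<in>C. K * real n powr (- a (card B - 1)))"
    using assms Y_le expectation_Y_nonneg by (intro prod_mono) auto
  also have "\<dots> = K ^ card C * real n powr (\<Sum>B\<in>C. - a (card B - 1))"
    using assms n by (simp add: prod.distrib powr_sum)
  finally show ?thesis by (simp add: sum_negf)
qed

lemma K_power_le: "m \<le> m' \<Longrightarrow> K ^ m \<le> K ^ m'"
  by (rule power_increasing[OF _ K])

text \<open>A face has at most 2^(j+1) cells, which bounds the power of K. The factor 1 / (j+1)! is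
  kept since the bound has to become sharp as K tends to 1.\<close>

lemma expectation_count_le:
  "expectation (cnt j) \<le> K ^ 2 ^ Suc j / fact (Suc j) * real n powr tau_real a j"
proof -
  let ?c = "K ^ 2 ^ Suc j * real n powr (tau_real a j - real (Suc j))"
  have "(\<Prod>B\<in>subcells A. expectation (Y B)) \<le> ?c" if A: "A \<in> vsets n (Suc j)" for A
  proof -
    have fin: "finite A" "card A = Suc j" using A vsets_finite[OF A] by (simp_all add: vsets_def)
    have "(\<Prod>B\<in>subcells A. expectation (Y B)) \<le> K ^ card (subcells A) * real n powr (- (\<Sum>B\<in>subcells A. a (card B - 1)))"
    proof (rule expectation_prod_le[OF subcells_in_cells[OF A] finite_subcells[OF fin(1)]])
      show "card B \<le> Suc j" if "B \<in> subcells A" for B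
        using card_mono[OF fin(1), of B] that fin(2) by (simp add: subcells_def)
    qed
    also have "\<dots> \<le> K ^ 2 ^ Suc j * real n powr (- (\<Sum>B\<in>subcells A. a (card B - 1)))"
      by (rule mult_right_mono[OF K_power_le[OF card_subcells[OF fin(1), unfolded fin(2)]]]) simp
    also have "- (\<Sum>B\<in>subcells A. a (card B - 1)) = tau_real a j - real (Suc j)"
      unfolding sum_subcells_tau[OF fin, of a] by simp
    finally show ?thesis .
  qed
  then have "expectation (cnt j) \<le> of_nat (card (vsets n (Suc j))) * ?c"
    unfolding expectation_count by (rule sum_bounded_above)
  also have "\<dots> \<le> real n ^ Suc j / fact (Suc j) * ?c"
  proof (rule mult_right_mono)
    have "real ((n choose Suc j) * fact (Suc j)) \<le> real (n ^ Suc j)"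
      by (rule of_nat_mono[OF binomial_fact_pow])
    then show "real (card (vsets n (Suc j))) \<le> real n ^ Suc j / fact (Suc j)"
      unfolding card_vsets by (simp add: pos_le_divide_eq del: fact_Suc power_Suc)
    show "0 \<le> ?c" using K by (intro mult_nonneg_nonneg zero_le_power) auto
  qed
  also have "\<dots> = K ^ 2 ^ Suc j / fact (Suc j) * (real n ^ Suc j * real n powr (tau_real a j - real (Suc j)))"
    by (simp only: mult_ac divide_inverse)
  also have "real n ^ Suc j * real n powr (tau_real a j - real (Suc j)) = real n powr real (Suc j) * real n powr (tau_real a j - real (Suc j))"
    using n powr_realpow[of "real n" "Suc j"] by simp
  also have "\<dots> = real n powr tau_real a j"
    by (simp only: powr_add[symmetric]) simp
  finally show ?thesis .
qed

text \<open>For two faces sharing m + 1 vertices, inclusion-exclusion on the cells gives the joint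
  exponent 2 (j + 1 - tau_j) - (m + 1 - tau_m). There are at most n^(2 (j + 1) - (m + 1)) such
  pairs, and the powers combine to 2 tau_j - tau_m. The union has at most 2 * 2^(j+1) cells.\<close>

lemma variance_count_bound:
  "variance (cnt j) \<le> K ^ 2 ^ (j + 2) * (\<Sum>m=1..j. real n powr (2 * tau_real a j - tau_real a m))"
proof -
  let ?V = "vsets n (Suc j)"
  let ?e = "\<lambda>A. \<Prod>B\<in>A. expectation (Y B)"
  let ?Q = "{(A, A'). A \<in> ?V \<and> A' \<in> ?V \<and> 2 \<le> card (A \<inter> A')}"
  let ?P = "\<lambda>l. {(A, A'). A \<in> ?V \<and> A' \<in> ?V \<and> card (A \<inter> A') = l}"
  let ?K = "K ^ 2 ^ (j + 2)"
  have bound: "?e (subcells A \<union> subcells A') \<le> ?K * real n powr (2 * tau_real a j - tau_real a m - real (2 * Suc j - Suc m))"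
    if A: "(A, A') \<in> ?P (Suc m)" and m: "1 \<le> m" "m \<le> j" for A A' m
  proof -
    have AV: "A \<in> ?V" "A' \<in> ?V" using A by auto
    have fin: "finite A" "card A = Suc j" "finite A'" "card A' = Suc j" "finite (A \<inter> A')" "card (A \<inter> A') = Suc m"
      using A vsets_finite[OF AV(1)] vsets_finite[OF AV(2)] by (auto simp: vsets_def)
    let ?C = "subcells A \<union> subcells A'"
    have finC: "finite ?C" using finite_subcells[OF fin(1)] finite_subcells[OF fin(3)] by simp
    have "card ?C \<le> 2 ^ Suc j + 2 ^ Suc j"
      by (rule order_trans[OF card_Un_le add_mono[OF card_subcells[OF fin(1), unfolded fin(2)]
            card_subcells[OF fin(3), unfolded fin(4)]]])
    then have cardC: "card ?C \<le> 2 ^ (j + 2)" by simp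
    have "?e ?C \<le> K ^ card ?C * real n powr (- (\<Sum>B\<in>?C. a (card B - 1)))"
    proof (rule expectation_prod_le[OF _ finC])
      show "?C \<subseteq> cells n" using subcells_in_cells[OF AV(1)] subcells_in_cells[OF AV(2)] by simp
      show "card B \<le> Suc j" if "B \<in> ?C" for B
        using card_mono[OF fin(1), of B] card_mono[OF fin(3), of B] that fin(2,4) by (auto simp: subcells_def)
    qed
    also have "\<dots> \<le> ?K * real n powr (- (\<Sum>B\<in>?C. a (card B - 1)))"
      by (rule mult_right_mono[OF K_power_le[OF cardC]]) simp
    also have "(\<Sum>B\<in>?C. a (card B - 1)) = (\<Sum>B\<in>subcells A. a (card B - 1)) + (\<Sum>B\<in>subcells A'. a (card B - 1))
        - (\<Sum>B\<in>subcells (A \<inter> A'). a (card B - 1))"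
      using fin by (subst sum_Un) (auto simp: finite_subcells subcells_Int)
    also have "- \<dots> = 2 * tau_real a j - tau_real a m - real (2 * Suc j - Suc m)"
      unfolding sum_subcells_tau[OF fin(1,2)] sum_subcells_tau[OF fin(3,4)] sum_subcells_tau[OF fin(5,6)]
      using m by (simp add: of_nat_diff)
    finally show ?thesis .
  qed
  have Q: "?Q = (\<Union>m\<in>{1..j}. ?P (Suc m))"
  proof (intro equalityI subsetI)
    fix x assume "x \<in> ?Q"
    then obtain A A' where x: "x = (A, A')" and A: "A \<in> ?V" "A' \<in> ?V" "2 \<le> card (A \<inter> A')" by auto
    have "card (A \<inter> A') \<le> card A" using vsets_finite[OF A(1)] by (intro card_mono) auto
    then have "card (A \<inter> A') - 1 \<in> {1..j}" "card (A \<inter> A') = Suc (card (A \<inter> A') - 1)"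
      using A by (auto simp: vsets_def)
    then show "x \<in> (\<Union>m\<in>{1..j}. ?P (Suc m))" unfolding x using A by blast
  qed auto
  have finP: "finite (?P l)" for l
    by (rule finite_subset[of _ "?V \<times> ?V"]) (auto simp: finite_vsets)
  have "variance (cnt j) \<le> (\<Sum>(A, A')\<in>?Q. ?e (subcells A \<union> subcells A'))"
    by (rule variance_count_le)
  also have "\<dots> = (\<Sum>m\<in>{1..j}. \<Sum>(A, A')\<in>?P (Suc m). ?e (subcells A \<union> subcells A'))"
    unfolding Q using finP by (intro sum.UNION_disjoint) auto
  also have "\<dots> \<le> (\<Sum>m\<in>{1..j}. ?K * real n powr (2 * tau_real a j - tau_real a m))"
  proof (rule sum_mono)
    fix m assume m: "m \<in> {1..j}"
    let ?c = "?K * real n powr (2 * tau_real a j - tau_real a m - real (2 * Suc j - Suc m))"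
    have "(\<Sum>(A, A')\<in>?P (Suc m). ?e (subcells A \<union> subcells A')) \<le> real (card (?P (Suc m))) * ?c"
    proof (rule sum_bounded_above)
      fix x assume "x \<in> ?P (Suc m)"
      then obtain A A' where "x = (A, A')" "(A, A') \<in> ?P (Suc m)" by blast
      then show "(case x of (A, A') \<Rightarrow> ?e (subcells A \<union> subcells A')) \<le> ?c"
        using bound[of A A' m] m by simp
    qed
    also have "\<dots> \<le> real (n ^ (2 * Suc j - Suc m)) * ?c"
    proof (rule mult_right_mono[OF of_nat_mono[OF card_overlapping_pairs]])
      show "Suc m \<le> Suc j" using m by simp
      show "0 \<le> ?c" using K by (intro mult_nonneg_nonneg zero_le_power) auto
    qed
    also have "real (n ^ (2 * Suc j - Suc m)) = real n powr real (2 * Suc j - Suc m)"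
      using n powr_realpow[of "real n" "2 * Suc j - Suc m"] by (simp only: of_nat_power)
    also have "real n powr real (2 * Suc j - Suc m) * ?c = ?K * real n powr (2 * tau_real a j - tau_real a m)"
      by (simp only: mult.left_commute[of _ ?K] powr_add[symmetric]) simp
    finally show "(\<Sum>(A, A')\<in>?P (Suc m). ?e (subcells A \<union> subcells A')) \<le> ?K * real n powr (2 * tau_real a j - tau_real a m)" .
  qed
  finally show ?thesis by (simp add: sum_distrib_left)
qed

end

text \<open>Here c \<le> 1, so replacing the number of cells by its bound 2^(j+1) lowers the power.
  The binomial coefficient stays exact, as n^(j+1) / (j+1)! exceeds it;
  \<open>binomial_ratio_tendsto\<close> compares them in the limit.\<close>

lemma (in static_faces) expectation_count_ge:
  assumes n: "0 < n" and c: "0 \<le> c" "c \<le> 1"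
    and Y_ge: "\<And>B. B \<in> cells n \<Longrightarrow> card B \<le> Suc j \<Longrightarrow> c * real n powr (- a (card B - 1)) \<le> expectation (Y B)"
  shows "real (n choose Suc j) * (c ^ 2 ^ Suc j * real n powr (tau_real a j - real (Suc j))) \<le> expectation (cnt j)"
proof -
  let ?c = "c ^ 2 ^ Suc j * real n powr (tau_real a j - real (Suc j))"
  have "?c \<le> (\<Prod>B\<in>subcells A. expectation (Y B))" if A: "A \<in> vsets n (Suc j)" for A
  proof -
    have fin: "finite A" "card A = Suc j" using A vsets_finite[OF A] by (simp_all add: vsets_def)
    have "?c \<le> c ^ card (subcells A) * real n powr (tau_real a j - real (Suc j))"
      by (rule mult_right_mono[OF power_decreasing[OF card_subcells[OF fin(1), unfolded fin(2)] c]]) simp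
    also have "\<dots> = (\<Prod>B\<in>subcells A. c * real n powr (- a (card B - 1)))"
      using sum_subcells_tau[OF fin, of a] n finite_subcells[OF fin(1)] by (simp add: prod.distrib sum_negf powr_sum[symmetric])
    also have "\<dots> \<le> (\<Prod>B\<in>subcells A. expectation (Y B))"
    proof (rule prod_mono, intro conjI)
      fix B assume B: "B \<in> subcells A"
      then have "card B \<le> Suc j" using card_mono[OF fin(1), of B] fin(2) by (simp add: subcells_def)
      then show "c * real n powr (- a (card B - 1)) \<le> expectation (Y B)"
        using B subcells_in_cells[OF A] by (intro Y_ge) auto
    qed (use c in simp)
    finally show ?thesis .
  qed
  then have "real (card (vsets n (Suc j))) * ?c \<le> expectation (cnt j)"
    unfolding expectation_count by (intro sum_bounded_below)
  then show ?thesis by (simp add: card_vsets)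
qed

section \<open>Strong law for static face counts\<close>

lemma binomial_ratio_tendsto: "(\<lambda>n. real (n choose m) / real n ^ m) \<longlonglongrightarrow> 1 / fact m"
proof -
  have "(\<lambda>n. (\<Prod>i=0..<m. 1 - real i / real n) / fact m) \<longlonglongrightarrow> (\<Prod>i=0..<m. 1 - 0) / fact m"
    by (intro tendsto_intros lim_const_over_n) auto
  moreover have "eventually (\<lambda>n. (\<Prod>i=0..<m. 1 - real i / real n) / fact m = real (n choose m) / real n ^ m) sequentially"
    using eventually_gt_at_top[of 0]
  proof eventually_elim
    case (elim n)
    have "(\<Prod>i=0..<m. 1 - real i / real n) = (\<Prod>i=0..<m. (real n - real i) / real n)"
      using elim by (intro prod.cong refl) (simp add: field_simps)
    also have "\<dots> = (\<Prod>i=0..<m. real n - real i) / real n ^ m"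
      by (simp add: prod_dividef)
    also have "(\<Prod>i=0..<m. real n - real i) = fact m * real (n choose m)"
      by (simp add: binomial_gbinomial gbinomial_prod_rev)
    finally show ?case by simp
  qed
  ultimately show ?thesis by (simp add: filterlim_cong)
qed

section \<open>The exponents tau have their strict maximum at k\<close>

locale dominant_dimension =
  fixes a :: "nat \<Rightarrow> real" and k :: nat
  assumes a_nonneg: "\<And>i. 0 \<le> a i" and k_pos: "1 \<le> k"
    and psi_k: "psi_real a k < 1" "1 < psi_real a (Suc k)"
begin

abbreviation "\<tau> \<equiv> tau_real a"

lemma tau_step_up: "j < k \<Longrightarrow> \<tau> j < \<tau> (Suc j)"
  using psi_real_mono[of a "Suc j" k, OF a_nonneg] psi_k(1) by (simp add: tau_real_Suc)

lemma tau_step_down: "k \<le> j \<Longrightarrow> \<tau> (Suc j) \<le> \<tau> j - (psi_real a (Suc k) - 1)"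
  using psi_real_mono[of a "Suc k" "Suc j", OF a_nonneg] by (simp add: tau_real_Suc)

lemma tau_up: "i \<le> j \<Longrightarrow> j \<le> k \<Longrightarrow> \<tau> i \<le> \<tau> j"
proof (induction rule: dec_induct)
  case (step m)
  then show ?case using tau_step_up[of m] by simp
qed simp

text \<open>Since psi increases, every step from k on loses at least psi_{k+1} - 1 > 0. The decay is
  at least linear, so tau becomes as negative as desired.\<close>

lemma tau_down: "i \<le> j \<Longrightarrow> k \<le> i \<Longrightarrow> \<tau> j \<le> \<tau> i - real (j - i) * (psi_real a (Suc k) - 1)"
proof (induction rule: dec_induct)
  case (step m)
  then show ?case using tau_step_down[of m] by (simp add: algebra_simps of_nat_diff)
qed simp

lemma tau_antimono: "i \<le> j \<Longrightarrow> k \<le> i \<Longrightarrow> \<tau> j \<le> \<tau> i"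
  using tau_down[of i j] psi_k(2) mult_nonneg_nonneg[of "real (j - i)" "psi_real a (Suc k) - 1"] by linarith

lemma tau_less: "j \<noteq> k \<Longrightarrow> \<tau> j < \<tau> k"
proof (cases "j < k")
  case True
  then show ?thesis using tau_step_up[of j] tau_up[of "Suc j" k] by simp
next
  case False
  assume "j \<noteq> k"
  with False have "k < j" by simp
  then show ?thesis using tau_step_down[of k] tau_antimono[of "Suc k" j] psi_k(2) by simp
qed

lemma tau_le: "\<tau> j \<le> \<tau> k"
  using tau_less[of j] by (cases "j = k") auto

lemma tau_1_gt: "1 < \<tau> 1"
  using psi_real_mono[of a 1 k, OF a_nonneg] k_pos psi_k(1)
  unfolding tau_real_1 by (simp add: psi_real_def)

text \<open>For m \<le> k use tau_m \<ge> tau_1 and tau_j \<le> tau_k. For m > k also j \<ge> m lies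
  on the falling side, so tau_j \<le> tau_m and the left side is at most tau_j - 2 tau_k \<le> -
  tau_k \<le> - tau_1.\<close>

lemma variance_exponent:
  assumes "1 \<le> m" "m \<le> j"
  shows "2 * \<tau> j - \<tau> m - 2 * \<tau> k \<le> - \<tau> 1"
proof (cases "m \<le> k")
  case True
  then show ?thesis using tau_up[of 1 m] tau_le[of j] assms by simp
next
  case False
  then show ?thesis using tau_antimono[of m j] tau_le[of j] tau_le[of 1] assms by simp
qed

text \<open>The value -2 makes n^(tau_J) summable, as \<open>AE_count_zero\<close> requires.\<close>

lemma ex_tau_small: "\<exists>J>k. \<tau> J \<le> - 2"
proof -
  obtain m :: nat where m: "(\<tau> k + 2) / (psi_real a (Suc k) - 1) < real m"
    using reals_Archimedean2 by blast
  then have "\<tau> k + 2 \<le> real (Suc m) * (psi_real a (Suc k) - 1)"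
    using psi_k(2) by (simp add: field_simps)
  then show ?thesis using tau_down[of k "k + Suc m"] by (intro exI[of _ "k + Suc m"]) simp
qed

end

section \<open>Almost sure asymptotics along a sequence of static complexes\<close>

locale static_sequence = dominant_dimension a k + prob_space M
  for a :: "nat \<Rightarrow> real" and k and M :: "'w measure" +
  fixes Y :: "nat \<Rightarrow> nat set \<Rightarrow> 'w \<Rightarrow> real" and K :: real and J :: nat
  assumes faces: "\<And>n. static_faces M (Y n) n" and K: "1 \<le> K"
    and Y_le: "\<And>n B. 0 < n \<Longrightarrow> B \<in> cells n \<Longrightarrow> card B \<le> Suc J \<Longrightarrow>
      expectation (Y n B) \<le> K * real n powr (- a (card B - 1))"
begin

abbreviation "num n j \<equiv> \<lambda>\<omega>. face_count n j (\<lambda>B. Y n B \<omega>)"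

lemma bounded_faces:
  assumes "0 < n" "j \<le> J" shows "static_bounded_faces M (Y n) n a K j"
  unfolding static_bounded_faces_def static_bounded_faces_axioms_def
  using assms faces K Y_le by auto

lemma powr_summable: "summable (\<lambda>n. C * real n powr (- s))" if "1 < s"
  using that by (intro summable_mult) (simp add: summable_real_powr_iff)

text \<open>Chebyshev at the scale n^(tau_k), for every dimension j up to J and not only for k. By
  \<open>variance_exponent\<close> the failure probabilities are O(n^(-tau_1)), which is summable as
  tau_1 > 1.\<close>

lemma AE_deviation_small:
  assumes j: "j \<le> J" and \<epsilon>: "0 < \<epsilon>"
  shows "AE \<omega> in M. eventually (\<lambda>n. \<bar>num n j \<omega> - expectation (num n j)\<bar> < \<epsilon> * real n powr \<tau> k) sequentially"
proof -
  let ?A = "\<lambda>n. {\<omega> \<in> space M. \<epsilon> * real n powr \<tau> k \<le> \<bar>num n j \<omega> - expectation (num n j)\<bar>}"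
  \<comment> \<open>The factor j is the number of overlap sizes, each contributing at most
    n^(-tau_1).\<close>
  let ?C = "K ^ 2 ^ (j + 2) * real j / \<epsilon>\<^sup>2"
  have bound: "prob (?A n) \<le> ?C * real n powr (- \<tau> 1)" if n: "0 < n" for n
  proof -
    interpret static_bounded_faces M "Y n" n a K j by (rule bounded_faces[OF n j])
    have pos: "0 < \<epsilon> * real n powr \<tau> k" using \<epsilon> n by simp
    have "prob (?A n) \<le> variance (num n j) / (\<epsilon> * real n powr \<tau> k)\<^sup>2"
      by (rule Chebyshev_inequality[OF count_measurable count_sq_integrable pos])
    also have "\<dots> \<le> K ^ 2 ^ (j + 2) * (\<Sum>m=1..j. real n powr (2 * \<tau> j - \<tau> m)) / (\<epsilon> * real n powr \<tau> k)\<^sup>2"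
      by (rule divide_right_mono[OF variance_count_bound]) simp
    also have "\<dots> = K ^ 2 ^ (j + 2) / \<epsilon>\<^sup>2 * (\<Sum>m=1..j. real n powr (2 * \<tau> j - \<tau> m)) / (real n powr \<tau> k)\<^sup>2"
      by (simp add: power_mult_distrib)
    also have "(real n powr \<tau> k)\<^sup>2 = real n powr (2 * \<tau> k)"
      by (simp add: power2_eq_square flip: powr_add)
    also have "K ^ 2 ^ (j + 2) / \<epsilon>\<^sup>2 * (\<Sum>m=1..j. real n powr (2 * \<tau> j - \<tau> m)) / real n powr (2 * \<tau> k) =
        K ^ 2 ^ (j + 2) / \<epsilon>\<^sup>2 * (\<Sum>m=1..j. real n powr (2 * \<tau> j - \<tau> m - 2 * \<tau> k))"
    proof -
      have eq: "real n powr (2 * \<tau> j - \<tau> m - 2 * \<tau> k) = real n powr (2 * \<tau> j - \<tau> m) / real n powr (2 * \<tau> k)" for m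
        by (rule powr_diff)
      show ?thesis unfolding eq sum_divide_distrib[symmetric] by simp
    qed
    also have "(\<Sum>m=1..j. real n powr (2 * \<tau> j - \<tau> m - 2 * \<tau> k)) \<le> (\<Sum>m=1..j. real n powr (- \<tau> 1))"
      using n variance_exponent by (intro sum_mono powr_mono) auto
    finally show ?thesis using K by (simp add: mult_left_mono divide_right_mono mult_ac)
  qed
  have "AE \<omega> in M. eventually (\<lambda>n. \<omega> \<in> space M - ?A n) sequentially"
  proof (rule borel_cantelli_AE1)
    show "?A n \<in> sets M" for n
    proof -
      interpret static_faces M "Y n" n by (rule faces)
      show ?thesis by measurable
    qed
    show "summable (\<lambda>n. prob (?A n))"
      by (rule summable_comparison_test'[OF powr_summable[OF tau_1_gt, of ?C], of 1]) (use bound in simp)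
  qed (simp add: emeasure_eq_measure)
  then show ?thesis by (rule AE_mp) (auto intro!: AE_I2 elim!: eventually_mono)
qed

lemma expectation_cnt_le:
  assumes "0 < n" "j \<le> J"
  shows "expectation (num n j) \<le> K ^ 2 ^ Suc j / fact (Suc j) * real n powr \<tau> j"
proof -
  interpret static_bounded_faces M "Y n" n a K j by (rule bounded_faces[OF assms])
  show ?thesis by (rule expectation_count_le)
qed

lemma AE_count_upper:
  assumes "k \<le> J" and \<epsilon>: "0 < \<epsilon>"
  shows "AE \<omega> in M. eventually (\<lambda>n. num n k \<omega> \<le> (K ^ 2 ^ Suc k / fact (Suc k) + \<epsilon>) * real n powr \<tau> k) sequentially"
  using AE_deviation_small[OF assms]
proof eventually_elim
  case (elim \<omega>)
  show ?case using elim eventually_gt_at_top[of 0]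
  proof eventually_elim
    case (elim n)
    then show ?case using expectation_cnt_le[of n k] assms(1) unfolding distrib_right by linarith
  qed
qed

lemma AE_count_negligible:
  assumes "j \<le> J" "j \<noteq> k" and \<epsilon>: "0 < \<epsilon>"
  shows "AE \<omega> in M. eventually (\<lambda>n. num n j \<omega> \<le> \<epsilon> * real n powr \<tau> k) sequentially"
proof -
  let ?C = "K ^ 2 ^ Suc j / fact (Suc j)"
  have "((\<lambda>n. ?C * real n powr (\<tau> j - \<tau> k)) \<longlongrightarrow> ?C * 0) sequentially"
    using tau_less[OF assms(2)] by (intro tendsto_intros tendsto_neg_powr filterlim_real_sequentially) auto
  then have ev: "eventually (\<lambda>n. ?C * real n powr (\<tau> j - \<tau> k) < \<epsilon> / 2) sequentially"
    by (rule order_tendstoD(2)) (use \<epsilon> in simp)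
  show ?thesis
    using AE_deviation_small[OF assms(1) half_gt_zero[OF \<epsilon>]]
  proof eventually_elim
    case (elim \<omega>)
    show ?case using elim ev eventually_gt_at_top[of 0]
    proof eventually_elim
      case (elim n)
      have "?C * real n powr \<tau> j = ?C * real n powr (\<tau> j - \<tau> k) * real n powr \<tau> k"
        using elim(3) by (simp add: powr_diff)
      also have "\<dots> \<le> \<epsilon> / 2 * real n powr \<tau> k"
        by (rule mult_right_mono[OF less_imp_le[OF elim(2)]]) simp
      finally have "expectation (num n j) \<le> \<epsilon> / 2 * real n powr \<tau> k"
        using expectation_cnt_le[OF elim(3) assms(1)] by linarith
      moreover have "\<epsilon> * real n powr \<tau> k = \<epsilon> / 2 * real n powr \<tau> k + \<epsilon> / 2 * real n powr \<tau> k" by simp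
      ultimately show ?case using elim(1) by linarith
    qed
  qed
qed

text \<open>Deviations measured at the scale n^(tau_k) cannot show that a count vanishes. Markov's
  inequality at level 1 does, since the mean is O(n^(-2)).\<close>

lemma AE_count_zero:
  assumes "j \<le> J" "\<tau> j \<le> - 2"
  shows "AE \<omega> in M. eventually (\<lambda>n. num n j \<omega> < 1) sequentially"
proof -
  let ?A = "\<lambda>n. {\<omega> \<in> space M. 1 \<le> num n j \<omega>}"
  let ?C = "K ^ 2 ^ Suc j / fact (Suc j)"
  have bound: "prob (?A n) \<le> ?C * real n powr (- 2)" if n: "0 < n" for n
  proof -
    interpret static_bounded_faces M "Y n" n a K j by (rule bounded_faces[OF n assms(1)])
    have "prob (?A n) \<le> expectation (num n j) / 1"
      by (rule integral_Markov_inequality_measure[OF count_integrable, where A = "{}"])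
         (auto intro!: AE_I2 face_count_nonneg Y_bounds)
    also have "\<dots> \<le> ?C * real n powr \<tau> j" using expectation_cnt_le[OF n assms(1)] by simp
    also have "\<dots> \<le> ?C * real n powr (- 2)"
      using n K assms(2) by (intro mult_left_mono powr_mono) auto
    finally show ?thesis .
  qed
  have "AE \<omega> in M. eventually (\<lambda>n. \<omega> \<in> space M - ?A n) sequentially"
  proof (rule borel_cantelli_AE1)
    show "?A n \<in> sets M" for n
    proof -
      interpret static_faces M "Y n" n by (rule faces)
      show ?thesis by measurable
    qed
    show "summable (\<lambda>n. prob (?A n))"
      by (rule summable_comparison_test'[OF powr_summable[of 2 ?C], of 1]) (use bound in simp_all)
  qed (simp add: emeasure_eq_measure)
  then show ?thesis by (rule AE_mp) (auto intro!: AE_I2 elim!: eventually_mono)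
qed

lemma AE_count_lower:
  assumes "k \<le> J" and \<epsilon>: "0 < \<epsilon>" and c: "0 \<le> c" "c \<le> 1"
    and Y_ge: "\<And>n B. 0 < n \<Longrightarrow> B \<in> cells n \<Longrightarrow> card B \<le> Suc k \<Longrightarrow>
      c * real n powr (- a (card B - 1)) \<le> expectation (Y n B)"
  shows "AE \<omega> in M. eventually (\<lambda>n. (c ^ 2 ^ Suc k / fact (Suc k) - \<epsilon>) * real n powr \<tau> k \<le> num n k \<omega>) sequentially"
proof -
  let ?C = "c ^ 2 ^ Suc k"
  have "(\<lambda>n. real (n choose Suc k) / real n ^ Suc k * ?C) \<longlonglongrightarrow> 1 / fact (Suc k) * ?C"
    by (intro tendsto_intros binomial_ratio_tendsto)
  then have ev: "eventually (\<lambda>n. 1 / fact (Suc k) * ?C - \<epsilon> / 2 < real (n choose Suc k) / real n ^ Suc k * ?C) sequentially"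
    by (rule order_tendstoD(1)) (use \<epsilon> in simp)
  show ?thesis
    using AE_deviation_small[OF assms(1) half_gt_zero[OF \<epsilon>]]
  proof eventually_elim
    case (elim \<omega>)
    show ?case using elim ev eventually_gt_at_top[of 0]
    proof eventually_elim
      case (elim n)
      interpret static_faces M "Y n" n by (rule faces)
      have "?C / fact (Suc k) - \<epsilon> / 2 \<le> real (n choose Suc k) / real n ^ Suc k * ?C"
        using elim(2) by simp
      then have "(?C / fact (Suc k) - \<epsilon> / 2) * real n powr \<tau> k \<le> real (n choose Suc k) / real n ^ Suc k * ?C * real n powr \<tau> k"
        by (rule mult_right_mono) simp
      also have "\<dots> = real (n choose Suc k) * (?C * real n powr (\<tau> k - real (Suc k)))"
        using elim(3) powr_realpow[of "real n" "Suc k"] by (simp only: powr_diff) (simp add: divide_inverse mult_ac)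
      also have "\<dots> \<le> expectation (num n k)"
        by (rule expectation_count_ge[OF elim(3) c Y_ge[OF elim(3)]])
      finally have "(?C / fact (Suc k) - \<epsilon> / 2) * real n powr \<tau> k \<le> expectation (num n k)" .
      moreover have "(?C / fact (Suc k) - \<epsilon>) * real n powr \<tau> k = (?C / fact (Suc k) - \<epsilon> / 2) * real n powr \<tau> k - \<epsilon> / 2 * real n powr \<tau> k"
        by (simp add: algebra_simps)
      ultimately show ?case using elim(1) by linarith
    qed
  qed
qed

end

section \<open>Comparison with static complexes\<close>

lemma down_closed_complex_at: "down_closed (complex_at n X)"
  by (auto simp: down_closed_def complex_at_def)

lemma faces_complex_at:
  "faces (complex_at n X) j = {A \<in> vsets n (Suc j). \<forall>B\<in>subcells A. X B = 1}"
  by (auto simp: faces_def complex_at_def vsets_def subcells_def)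

lemma finite_faces_complex_at: "finite (faces (complex_at n X) j)"
  unfolding faces_complex_at by (simp add: finite_vsets)

lemma prod_of_bool: "finite S \<Longrightarrow> (\<Prod>x\<in>S. of_bool (P x)) = (of_bool (\<forall>x\<in>S. P x) :: real)"
  by (induction S rule: finite_induct) auto

lemma card_faces_complex_at:
  "real (card (faces (complex_at n X) j)) = face_count n j (\<lambda>B. of_bool (X B = 1))"
proof -
  have "face_count n j (\<lambda>B. of_bool (X B = 1)) = (\<Sum>A\<in>vsets n (Suc j). of_bool (\<forall>B\<in>subcells A. X B = 1))"
    unfolding face_count_def by (intro sum.cong refl prod_of_bool finite_subcells) (erule vsets_finite)
  also have "\<dots> = real (card (faces (complex_at n X) j))"
    unfolding faces_complex_at by (simp add: finite_vsets Int_def flip: of_bool_def)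
  finally show ?thesis by simp
qed

text \<open>Every larger face contains a face of dimension i. One empty dimension thus settles all
  higher ones at once.\<close>

lemma faces_empty_above:
  assumes "faces (complex_at n X) i = {}" "i \<le> j"
  shows "faces (complex_at n X) j = {}"
proof (rule equals0I)
  fix A assume A: "A \<in> faces (complex_at n X) j"
  then have "i + 1 \<le> card A" using assms(2) by (simp add: faces_def)
  then obtain B where B: "B \<subseteq> A" "card B = i + 1" by (meson obtain_subset_with_card_n)
  then have "B \<noteq> {}" by auto
  then have "B \<in> faces (complex_at n X) i"
    using A B down_closed_complex_at[of n X] unfolding down_closed_def faces_def by blast
  then show False using assms(1) by simp
qed

text \<open>By right-continuity a violation at t would persist just to the right of t, since the
  complement of \<open>C\<close> is open, and rational times there would see it. It is used with {0,
  1}, {1} and (-\<infinity>, 1/2].\<close>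

lemma cadlag_closed_rational:
  assumes x: "x \<in> cadlag" and t: "0 \<le> t" "t < u" and "closed C"
    and r: "\<And>r. r \<in> \<rat> \<Longrightarrow> t < r \<Longrightarrow> r < u \<Longrightarrow> x r \<in> C"
  shows "x t \<in> C"
proof (rule ccontr)
  assume "x t \<notin> C"
  have "(x \<longlongrightarrow> x t) (at_right t)"
    using x t by (auto simp: cadlag_def continuous_within)
  then have "eventually (\<lambda>v. x v \<in> - C) (at_right t)"
    using \<open>closed C\<close> \<open>x t \<notin> C\<close> by (intro topological_tendstoD) auto
  then obtain b where b: "t < b" "\<And>v. t < v \<Longrightarrow> v < b \<Longrightarrow> x v \<notin> C"
    by (auto simp: eventually_at_right_field)
  obtain v where "v \<in> \<rat>" "t < v" "v < min b u"
    using Rats_dense_in_real[of t "min b u"] b(1) t(2) by auto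
  then show False using b(2) r by auto
qed

lemma cadlag_binary:
  assumes "x \<in> cadlag" "\<forall>r\<in>\<rat> \<inter> {0..}. x r \<in> {0, 1}" "0 \<le> t"
  shows "x t \<in> {0, 1}"
  by (rule cadlag_closed_rational[OF assms(1,3), of "t + 1"]) (use assms in auto)

lemma cadlag_stay:
  assumes "x \<in> cadlag" "x \<in> stay_set s \<delta>" "0 \<le> s" "s \<le> t" "t < s + \<delta>"
  shows "x t = 1"
proof -
  have "x t \<in> {1}"
    by (rule cadlag_closed_rational[of x t "s + \<delta>"]) (use assms in \<open>auto simp: stay_set_def\<close>)
  then show ?thesis by simp
qed

lemma cadlag_hit:
  assumes "x \<in> cadlag" "0 \<le> s" "s \<le> t" "t < s + \<delta>" "x t = 1"
  shows "x \<in> hit_set s \<delta>"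
proof (rule ccontr)
  assume no: "x \<notin> hit_set s \<delta>"
  have "x \<in> space path_measurable_space"
    using assms(1) by (auto simp: cadlag_def space_PiM PiE_def)
  then have "x t \<in> {..1 / 2}"
    using no assms by (intro cadlag_closed_rational[of x t "s + \<delta>"]) (auto simp: hit_set_def not_less)
  then show False using assms(5) by simp
qed

lemma stay_subset_hit:
  assumes "0 < \<delta>" shows "stay_set s \<delta> \<subseteq> hit_set s \<delta>"
proof
  fix x assume x: "x \<in> stay_set s \<delta>"
  obtain r where "r \<in> \<rat>" "s < r" "r < s + \<delta>" using Rats_dense_in_real[of s "s + \<delta>"] assms by auto
  then show "x \<in> hit_set s \<delta>" using x by (auto simp: stay_set_def hit_set_def intro!: bexI[of _ r])
qed

lemma face_prob_bounds: "0 < n \<Longrightarrow> 0 \<le> b \<Longrightarrow> 0 \<le> face_prob b n \<and> face_prob b n \<le> 1"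
proof -
  assume n: "0 < n" and b: "0 \<le> b"
  have "real n powr - real_of_ereal b \<le> real n powr 0"
    using n real_of_ereal_pos[OF b] by (intro powr_mono) auto
  then show ?thesis using n by (simp add: face_prob_def)
qed

text \<open>
  Above dimension \<open>k\<close> only an upper bound on \<open>p\<^sub>i\<close> is needed, so the possibly infinite exponents
  there can be lowered. Capping \<open>\<alpha>\<^sub>k\<^sub>+\<^sub>1\<close> at 2 keeps \<open>\<psi>\<^sub>k\<^sub>+\<^sub>1 > 1\<close>, and \<open>\<psi>\<^sub>j\<close> is increasing in \<open>j\<close>.
\<close>

definition finite_exponents :: "(nat \<Rightarrow> ereal) \<Rightarrow> nat \<Rightarrow> nat \<Rightarrow> real" where
  "finite_exponents \<alpha> k i = (if 1 \<le> i \<and> i \<le> Suc k then real_of_ereal (min (\<alpha> i) 2) else 0)"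

context
  fixes \<alpha> :: "nat \<Rightarrow> ereal" and k :: nat
  assumes nonneg: "\<And>i. 1 \<le> i \<Longrightarrow> 0 \<le> \<alpha> i" and region: "\<alpha> \<in> param_region k" and k: "1 \<le> k"
begin

abbreviation "fx \<equiv> finite_exponents \<alpha> k"

lemma psi_nonneg_term: "i \<in> {1..j} \<Longrightarrow> 0 \<le> ereal (real (j choose i)) * \<alpha> i"
  using nonneg[of i] by (intro ereal_0_le_mult) auto

lemma exponent_lt_1:
  assumes "1 \<le> i" "i \<le> k"
  shows "\<alpha> i < 1"
proof -
  have "1 * \<alpha> i \<le> ereal (real (k choose i)) * \<alpha> i"
    using assms nonneg[of i] zero_less_binomial[of i k] by (intro ereal_mult_right_mono) (auto simp: Suc_le_eq one_ereal_def)
  also have "\<dots> \<le> psi k \<alpha>" unfolding psi_def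
    using sum_mono2[of "{1..k}" "{i}" "\<lambda>i. ereal (real (k choose i)) * \<alpha> i"] assms psi_nonneg_term by auto
  also have "\<dots> < 1" using region by (simp add: param_region_def)
  finally show ?thesis by simp
qed

lemma exponent_eq:
  assumes "1 \<le> i" "i \<le> k"
  shows "\<alpha> i = ereal (fx i)"
proof -
  have "\<alpha> i < 1" "0 \<le> \<alpha> i" using assms exponent_lt_1 nonneg by auto
  then show ?thesis using assms
    by (cases "\<alpha> i") (auto simp: finite_exponents_def min_def one_ereal_def)
qed

lemma min_exponent_cases: "min x 2 = ereal (real_of_ereal (min x 2))" if "0 \<le> x" for x :: ereal
  using that by (cases x) (auto simp: min_def)

lemma finite_exponents_nonneg: "0 \<le> fx i"
  using nonneg[of i] by (auto simp: finite_exponents_def intro!: real_of_ereal_pos)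

lemma psi_eq: "psi k \<alpha> = ereal (psi_real fx k)"
proof -
  have "psi k \<alpha> = (\<Sum>i=1..k. ereal (real (k choose i) * fx i))"
    unfolding psi_def by (intro sum.cong refl) (simp add: exponent_eq)
  then show ?thesis by (simp add: psi_real_def)
qed

lemma tau_eq: "real_of_ereal (tau k \<alpha>) = tau_real fx k"
proof -
  have "(\<Sum>i=1..k. ereal (real ((k + 1) choose (i + 1))) * \<alpha> i) = (\<Sum>i=1..k. ereal (real ((k + 1) choose (i + 1)) * fx i))"
    by (intro sum.cong refl) (simp add: exponent_eq del: binomial_Suc_Suc)
  then show ?thesis by (simp add: tau_def tau_real_def del: binomial_Suc_Suc)
qed

text \<open>Either the cap is inactive and psi_{k+1} is unchanged, or the top term alone, with
  coefficient 1, is already 2.\<close>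

lemma psi_Suc_gt: "1 < psi_real fx (Suc k)"
proof (cases "\<alpha> (Suc k) \<le> 2")
  case True
  then have eq: "\<alpha> i = ereal (fx i)" if "i \<in> {1..Suc k}" for i
    using that exponent_eq[of i] min_exponent_cases[OF nonneg, of "Suc k"]
    by (cases "i = Suc k") (auto simp: finite_exponents_def)
  have "psi (k + 1) \<alpha> = (\<Sum>i=1..Suc k. ereal (real (Suc k choose i) * fx i))"
    unfolding psi_def Suc_eq_plus1[symmetric] by (intro sum.cong refl) (simp add: eq del: sum.cl_ivl_Suc)
  also have "\<dots> = ereal (psi_real fx (Suc k))" by (simp only: psi_real_def sum_ereal)
  finally show ?thesis using region by (simp add: param_region_def one_ereal_def)
next
  case False
  then have "fx (Suc k) = 2" by (simp add: finite_exponents_def min_def)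
  moreover have "real (Suc k choose Suc k) * fx (Suc k) \<le> psi_real fx (Suc k)"
    unfolding psi_real_def by (rule member_le_sum) (auto intro!: mult_nonneg_nonneg finite_exponents_nonneg)
  ultimately show ?thesis by simp
qed

lemma dominant_dimension_finite_exponents: "dominant_dimension fx k"
  using finite_exponents_nonneg k psi_eq region psi_Suc_gt
  by unfold_locales (auto simp: param_region_def one_ereal_def)

lemma face_prob_le:
  assumes "0 < n" "1 \<le> i"
  shows "face_prob (\<alpha> i) n \<le> real n powr (- fx i)"
proof (cases "\<alpha> i = \<infinity>")
  case False
  then obtain b where b: "\<alpha> i = ereal b" "0 \<le> b" using nonneg[OF assms(2)] by (cases "\<alpha> i") auto
  have "fx i \<le> b" using b assms by (auto simp: finite_exponents_def min_def)
  then show ?thesis using assms b by (auto simp: face_prob_def intro!: powr_mono)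
qed (simp add: face_prob_def)

lemma face_prob_eq:
  assumes "1 \<le> i" "i \<le> k"
  shows "face_prob (\<alpha> i) n = real n powr (- fx i)"
  by (simp add: exponent_eq[OF assms] face_prob_def)

end

lemma finite_family_uniform_threshold:
  assumes "finite I" "\<And>i. i \<in> I \<Longrightarrow> \<exists>d>0. \<forall>\<delta>. 0 < \<delta> \<and> \<delta> \<le> (d::real) \<longrightarrow> P i \<delta>"
  shows "\<exists>\<delta>>0. \<forall>i\<in>I. P i \<delta>"
proof -
  obtain d where d: "\<And>i. i \<in> I \<Longrightarrow> 0 < d i \<and> (\<forall>\<delta>. 0 < \<delta> \<and> \<delta> \<le> d i \<longrightarrow> P i \<delta>)"
    using assms(2) by metis
  have "0 < Min (insert 1 (d ` I))" using assms(1) d by (subst Min_gr_iff) auto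
  moreover have "Min (insert 1 (d ` I)) \<le> d i" if "i \<in> I" for i
    using assms(1) that by (intro Min_le) auto
  ultimately show ?thesis using d by blast
qed

text \<open>One e for the deviation of f_k from c and one for each neighbouring dimension in the
  Morse inequality.\<close>

lemma reduced_betti_close:
  fixes X n k j
  defines "f \<equiv> \<lambda>j. real (card (faces (complex_at n X) j))"
  assumes k: "k = Suc j" and fk: "\<bar>f k - c\<bar> \<le> e" and small: "f j \<le> e" "f (Suc k) \<le> e"
  shows "\<bar>real (reduced_betti (complex_at n X) k) - c\<bar> \<le> 3 * e"
proof -
  note b = reduced_betti_bounds[of "complex_at n X" j, OF finite_faces_complex_at down_closed_complex_at]
  have "real (reduced_betti (complex_at n X) k) \<le> f k"
    using b(1) by (simp add: f_def k)
  moreover have "f k \<le> real (reduced_betti (complex_at n X) k) + f j + f (Suc k)"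
    using b(2) by (simp add: f_def k flip: of_nat_add)
  moreover have "0 \<le> f j" by (simp add: f_def)
  ultimately show ?thesis using fk small by (auto simp: abs_le_iff)
qed

text \<open>One e for dimension k and at most J for the other dimensions below J; J \<le> n ensures
  that the alternating sum reaches all of these.\<close>

lemma euler_char_close:
  fixes X n k J
  defines "f \<equiv> \<lambda>j. real (card (faces (complex_at n X) j))"
  assumes J: "k < J" "J \<le> n" and fk: "\<bar>f k - c\<bar> \<le> e"
    and small: "\<And>j. j \<noteq> k \<Longrightarrow> f j \<le> e" and zero: "\<And>j. J \<le> j \<Longrightarrow> f j = 0"
  shows "\<bar>euler_char n (complex_at n X) - (-1) ^ k * c\<bar> \<le> (1 + real J) * e"
proof -
  have f_nonneg: "0 \<le> f j" for j by (simp add: f_def)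
  have e: "0 \<le> e" using fk by (rule order_trans[OF abs_ge_zero])
  have "euler_char n (complex_at n X) = (\<Sum>j<n. (-1) ^ j * f j)"
    by (simp add: euler_char_def f_def)
  also have "\<dots> = (\<Sum>j<J. (-1) ^ j * f j)"
    using J(2) zero by (intro sum.mono_neutral_right) auto
  also have "\<dots> = (-1) ^ k * f k + (\<Sum>j\<in>{..<J} - {k}. (-1) ^ j * f j)"
    using J(1) by (intro sum.remove) auto
  finally have eq: "euler_char n (complex_at n X) - (-1) ^ k * c =
      (-1) ^ k * (f k - c) + (\<Sum>j\<in>{..<J} - {k}. (-1) ^ j * f j)"
    by (simp add: algebra_simps)
  have "\<bar>\<Sum>j\<in>{..<J} - {k}. (-1) ^ j * f j\<bar> \<le> (\<Sum>j\<in>{..<J} - {k}. \<bar>(-1) ^ j * f j\<bar>)"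
    by (rule sum_abs)
  also have "\<dots> \<le> real (card ({..<J} - {k})) * e"
    using small f_nonneg by (intro sum_bounded_above) (auto simp: abs_mult)
  also have "\<dots> \<le> real J * e"
    using e card_mono[of "{..<J}" "{..<J} - {k}"] by (intro mult_right_mono) auto
  finally have "\<bar>\<Sum>j\<in>{..<J} - {k}. (-1) ^ j * f j\<bar> \<le> real J * e" .
  moreover have "\<bar>(-1) ^ k * (f k - c)\<bar> \<le> e" using fk by (simp add: abs_mult)
  ultimately show ?thesis unfolding eq distrib_right
    using abs_triangle_ineq[of "(-1) ^ k * (f k - c)" "\<Sum>j\<in>{..<J} - {k}. (-1) ^ j * f j"] by simp
qed

section \<open>The dynamic complex, window by window\<close>

locale dynamic_complex = prob_space M
  for M :: "'w measure" +
  fixes \<alpha> :: "nat \<Rightarrow> ereal" and \<nu> :: "nat \<Rightarrow> real measure"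
    and \<Delta> :: "nat \<Rightarrow> nat set \<Rightarrow> real \<Rightarrow> 'w \<Rightarrow> real" and k :: nat
  assumes nonneg: "\<And>i. 1 \<le> i \<Longrightarrow> 0 \<le> \<alpha> i"
    and laws: "\<And>i. 1 \<le> i \<Longrightarrow> positive_finite_mean_law (\<nu> i)"
    and dyn: "dynamic_processes M \<alpha> \<nu> \<Delta>"
    and region: "\<alpha> \<in> param_region k" and k: "1 \<le> k"
begin

abbreviation "ex \<equiv> finite_exponents \<alpha> k"

definition path :: "nat \<Rightarrow> nat set \<Rightarrow> 'w \<Rightarrow> real \<Rightarrow> real" where
  "path n A \<omega> = (\<lambda>t\<in>{0..}. \<Delta> n A t \<omega>)"

sublocale dominant_dimension ex k
  by (rule dominant_dimension_finite_exponents[OF nonneg region k])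

lemma tau_dominant: "real_of_ereal (tau k \<alpha>) = \<tau> k"
  by (rule tau_eq[OF nonneg region k])

lemma path_indep: "indep_vars (\<lambda>_. path_measurable_space) (path n) (cells n)"
  using dyn by (simp add: dynamic_processes_def path_def[abs_def])

lemma path_measurable: "A \<in> cells n \<Longrightarrow> path n A \<in> M \<rightarrow>\<^sub>M path_measurable_space"
  using path_indep[of n] by (auto simp: indep_vars_def)

lemma path_law:
  "A \<in> cells n \<Longrightarrow> distr M path_measurable_space (path n A) = onoff_law (\<nu> (card A - 1)) (face_prob (\<alpha> (card A - 1)) n)"
  using dyn by (simp add: dynamic_processes_def path_def[abs_def])

lemma AE_paths: "AE \<omega> in M. \<forall>n. \<forall>A\<in>cells n. path n A \<omega> \<in> cadlag \<and> (\<forall>t\<ge>0. \<Delta> n A t \<omega> \<in> {0, 1})"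
  unfolding AE_all_countable
proof
  fix n
  have "AE \<omega> in M. path n A \<omega> \<in> cadlag \<and> (\<forall>t\<ge>0. \<Delta> n A t \<omega> \<in> {0, 1})" if A: "A \<in> cells n" for A
  proof -
    have "2 \<le> card A" using A by (simp add: cells_def)
    then have "1 \<le> card A - 1" by linarith
    then have "positive_law (\<nu> (card A - 1))" using laws by (simp add: positive_law_def)
    then have "AE x in distr M path_measurable_space (path n A). \<forall>t\<in>\<rat> \<inter> {0..}. x t \<in> {0, 1}"
      unfolding path_law[OF A] by (rule positive_law.AE_onoff_law_binary)
    then have "AE \<omega> in M. \<forall>t\<in>\<rat> \<inter> {0..}. path n A \<omega> t \<in> {0, 1}"
      by (rule AE_distrD[OF path_measurable[OF A]])
    moreover have "AE \<omega> in M. path n A \<omega> \<in> cadlag"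
      using dyn A by (simp add: dynamic_processes_def path_def)
    ultimately show ?thesis
    proof eventually_elim
      case (elim \<omega>)
      have "\<Delta> n A t \<omega> \<in> {0, 1}" if "0 \<le> t" for t
        using cadlag_binary[OF elim(2,1) that] that by (simp add: path_def)
      with elim show ?case by simp
    qed
  qed
  then show "AE \<omega> in M. \<forall>A\<in>cells n. path n A \<omega> \<in> cadlag \<and> (\<forall>t\<ge>0. \<Delta> n A t \<omega> \<in> {0, 1})"
    by (intro AE_finite_allI finite_cells)
qed

text \<open>Each static cell is a function of a single path, so the cells inherit independence from
  the processes, and being an indicator it is binary at every \<omega>.\<close>

definition seen :: "(real \<Rightarrow> real) set \<Rightarrow> nat \<Rightarrow> nat set \<Rightarrow> 'w \<Rightarrow> real" where
  "seen E n B \<omega> = indicator E (path n B \<omega>)"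

lemma static_faces_seen:
  assumes E: "E \<in> sets path_measurable_space"
  shows "static_faces M (seen E n) n"
proof unfold_locales
  show "indep_vars (\<lambda>_. borel) (seen E n) (cells n)"
    unfolding seen_def[abs_def]
    by (rule indep_vars_compose2[OF path_indep]) (rule borel_measurable_indicator[OF E])
  show "seen E n B \<omega> \<in> {0, 1}" for B \<omega>
    by (simp add: seen_def indicator_def)
qed

lemma expectation_seen:
  assumes E: "E \<in> sets path_measurable_space" and B: "B \<in> cells n"
  shows "expectation (seen E n B) = measure (onoff_law (\<nu> (card B - 1)) (face_prob (\<alpha> (card B - 1)) n)) E"
proof -
  have "expectation (seen E n B) = (LINT x|distr M path_measurable_space (path n B). indicator E x)"
    unfolding seen_def[abs_def]
    by (rule integral_distr[symmetric, OF path_measurable[OF B] borel_measurable_indicator[OF E]])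
  then show ?thesis
    unfolding path_law[OF B] using E by (simp add: onoff_law_def space_pair_measure)
qed

lemma cell_dim: "B \<in> cells n \<Longrightarrow> card B \<le> Suc m \<Longrightarrow> card B - 1 \<in> {1..m}"
  by (auto simp: cells_def)

definition good_window :: "nat \<Rightarrow> real \<Rightarrow> real \<Rightarrow> real \<Rightarrow> bool" where
  "good_window J \<eta> s \<delta> \<longleftrightarrow> (\<forall>i\<in>{1..J}. \<forall>p. 0 \<le> p \<and> p \<le> 1 \<longrightarrow>
     measure (onoff_law (\<nu> i) p) (hit_set s \<delta>) \<le> p * (1 + \<eta>) \<and>
     p * (1 - \<eta>) \<le> measure (onoff_law (\<nu> i) p) (stay_set s \<delta>))"

lemma ex_good_window:
  assumes "0 < \<eta>"
  shows "\<exists>\<delta>>0. \<forall>s. 0 \<le> s \<and> s \<le> T \<longrightarrow> good_window J \<eta> s \<delta>"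
proof -
  let ?P = "\<lambda>i \<delta>. \<forall>s p. 0 \<le> s \<and> s \<le> T \<and> 0 \<le> p \<and> p \<le> 1 \<longrightarrow>
     measure (onoff_law (\<nu> i) p) (hit_set s \<delta>) \<le> p * (1 + \<eta>) \<and>
     p * (1 - \<eta>) \<le> measure (onoff_law (\<nu> i) p) (stay_set s \<delta>)"
  have "\<exists>\<delta>>0. \<forall>i\<in>{1..J}. ?P i \<delta>"
  proof (rule finite_family_uniform_threshold)
    fix i assume "i \<in> {1..J}"
    then have "positive_law (\<nu> i)" using laws by (simp add: positive_law_def)
    from positive_law.onoff_law_window[OF this assms, of T]
    obtain d where "0 < d" "\<And>\<delta> s p. 0 < \<delta> \<Longrightarrow> \<delta> \<le> d \<Longrightarrow> 0 \<le> s \<Longrightarrow> s \<le> T \<Longrightarrow> 0 \<le> p \<Longrightarrow> p \<le> 1 \<Longrightarrow>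
      measure (onoff_law (\<nu> i) p) (hit_set s \<delta>) \<le> p * (1 + \<eta>) \<and>
      p * (1 - \<eta>) \<le> measure (onoff_law (\<nu> i) p) (stay_set s \<delta>)" by metis
    then show "\<exists>d>0. \<forall>\<delta>. 0 < \<delta> \<and> \<delta> \<le> d \<longrightarrow> ?P i \<delta>" by (intro exI[of _ d]) blast
  qed simp
  then show ?thesis unfolding good_window_def by blast
qed

context
  fixes J :: nat and \<eta> s \<delta> :: real
  assumes win: "good_window J \<eta> s \<delta>" and s: "0 \<le> s" "0 < \<delta>" and \<eta>: "0 < \<eta>" "\<eta> < 1"
begin

lemma face_prob_unit: "0 < n \<Longrightarrow> i \<in> {1..m} \<Longrightarrow> 0 \<le> face_prob (\<alpha> i) n \<and> face_prob (\<alpha> i) n \<le> 1"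
  using nonneg[of i] by (intro face_prob_bounds) auto

lemma expectation_hit_le:
  assumes "0 < n" "B \<in> cells n" "card B \<le> Suc J"
  shows "expectation (seen (hit_set s \<delta>) n B) \<le> (1 + \<eta>) * real n powr (- ex (card B - 1))"
proof -
  note i = cell_dim[OF assms(2,3)]
  have "expectation (seen (hit_set s \<delta>) n B) \<le> face_prob (\<alpha> (card B - 1)) n * (1 + \<eta>)"
    using win i face_prob_unit[OF assms(1) i]
    unfolding expectation_seen[OF hit_set_measurable[OF s(1)] assms(2)] good_window_def by blast
  also have "\<dots> \<le> real n powr (- ex (card B - 1)) * (1 + \<eta>)"
    using face_prob_le[OF nonneg region k assms(1), of "card B - 1"] i \<eta> by (intro mult_right_mono) auto
  finally show ?thesis by (simp add: mult.commute)
qed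

lemma expectation_stay_le:
  assumes "0 < n" "B \<in> cells n" "card B \<le> Suc J"
  shows "expectation (seen (stay_set s \<delta>) n B) \<le> (1 + \<eta>) * real n powr (- ex (card B - 1))"
proof -
  interpret h: static_faces M "seen (hit_set s \<delta>) n" n by (rule static_faces_seen[OF hit_set_measurable[OF s(1)]])
  interpret t: static_faces M "seen (stay_set s \<delta>) n" n by (rule static_faces_seen[OF stay_set_measurable[OF s(1)]])
  have "expectation (seen (stay_set s \<delta>) n B) \<le> expectation (seen (hit_set s \<delta>) n B)"
    using stay_subset_hit[OF s(2), of s]
    by (intro integral_mono h.Y_integrable t.Y_integrable assms(2)) (auto simp: seen_def indicator_def)
  then show ?thesis using expectation_hit_le[OF assms] by simp
qed

text \<open>Confined to cells of dimension at most k, where \<open>face_prob\<close> equals the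
  power of n exactly; above k the modified exponents give only an upper bound.\<close>

lemma expectation_stay_ge:
  assumes "0 < n" "B \<in> cells n" "card B \<le> Suc k" "k \<le> J"
  shows "(1 - \<eta>) * real n powr (- ex (card B - 1)) \<le> expectation (seen (stay_set s \<delta>) n B)"
proof -
  note i = cell_dim[OF assms(2,3)]
  then have iJ: "card B - 1 \<in> {1..J}" using assms(4) by auto
  have "face_prob (\<alpha> (card B - 1)) n * (1 - \<eta>) \<le> expectation (seen (stay_set s \<delta>) n B)"
    using win iJ face_prob_unit[OF assms(1) i]
    unfolding expectation_seen[OF stay_set_measurable[OF s(1)] assms(2)] good_window_def by blast
  then show ?thesis
    using face_prob_eq[OF nonneg region k, of "card B - 1" n] i by (simp add: mult.commute)
qed

lemma static_sequence_hit: "static_sequence ex k M (seen (hit_set s \<delta>)) (1 + \<eta>) J"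
  unfolding static_sequence_def static_sequence_axioms_def
  using dominant_dimension_axioms prob_space_axioms static_faces_seen[OF hit_set_measurable[OF s(1)]]
    expectation_hit_le \<eta> by auto

lemma static_sequence_stay: "static_sequence ex k M (seen (stay_set s \<delta>)) (1 + \<eta>) J"
  unfolding static_sequence_def static_sequence_axioms_def
  using dominant_dimension_axioms prob_space_axioms static_faces_seen[OF stay_set_measurable[OF s(1)]]
    expectation_stay_le \<eta> by auto

lemma AE_window:
  assumes J: "k < J" "\<tau> J \<le> - 2" and \<epsilon>: "0 < \<epsilon>"
  shows "AE \<omega> in M. eventually (\<lambda>n.
      face_count n k (\<lambda>B. seen (hit_set s \<delta>) n B \<omega>) \<le> ((1 + \<eta>) ^ 2 ^ Suc k / fact (Suc k) + \<epsilon>) * real n powr \<tau> k \<and>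
      ((1 - \<eta>) ^ 2 ^ Suc k / fact (Suc k) - \<epsilon>) * real n powr \<tau> k \<le> face_count n k (\<lambda>B. seen (stay_set s \<delta>) n B \<omega>) \<and>
      (\<forall>j\<in>{..<J} - {k}. face_count n j (\<lambda>B. seen (hit_set s \<delta>) n B \<omega>) \<le> \<epsilon> * real n powr \<tau> k) \<and>
      face_count n J (\<lambda>B. seen (hit_set s \<delta>) n B \<omega>) < 1) sequentially"
proof -
  interpret h: static_sequence ex k M "seen (hit_set s \<delta>)" "1 + \<eta>" J by (rule static_sequence_hit)
  interpret t: static_sequence ex k M "seen (stay_set s \<delta>)" "1 + \<eta>" J by (rule static_sequence_stay)
  have kJ: "k \<le> J" using J by simp
  have "AE \<omega> in M. \<forall>j\<in>{..<J} - {k}. eventually (\<lambda>n. face_count n j (\<lambda>B. seen (hit_set s \<delta>) n B \<omega>) \<le> \<epsilon> * real n powr \<tau> k) sequentially"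
    using \<epsilon> by (intro AE_finite_allI h.AE_count_negligible) auto
  then have "AE \<omega> in M. eventually (\<lambda>n. \<forall>j\<in>{..<J} - {k}. face_count n j (\<lambda>B. seen (hit_set s \<delta>) n B \<omega>) \<le> \<epsilon> * real n powr \<tau> k) sequentially"
    by eventually_elim (intro eventually_ball_finite, auto)
  moreover have "AE \<omega> in M. eventually (\<lambda>n. ((1 - \<eta>) ^ 2 ^ Suc k / fact (Suc k) - \<epsilon>) * real n powr \<tau> k \<le> face_count n k (\<lambda>B. seen (stay_set s \<delta>) n B \<omega>)) sequentially"
    using \<eta> expectation_stay_ge kJ by (intro t.AE_count_lower[OF kJ \<epsilon>]) auto
  ultimately show ?thesis
    using h.AE_count_upper[OF kJ \<epsilon>] h.AE_count_zero[OF order_refl J(2)]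
    by eventually_elim (intro eventually_conj)
qed

end

abbreviation "fnum n j t \<omega> \<equiv> real (card (faces (complex_at n (\<lambda>B. \<Delta> n B t \<omega>)) j))"

text \<open>Cell by cell: on throughout the window implies on at t, which implies on at some time of
  the window; face counts are monotone in the cells.\<close>

lemma fnum_sandwich:
  assumes good: "\<forall>A\<in>cells n. path n A \<omega> \<in> cadlag \<and> (\<forall>t\<ge>0. \<Delta> n A t \<omega> \<in> {0, 1})"
    and t: "0 \<le> s" "s \<le> t" "t < s + \<delta>"
  shows "face_count n j (\<lambda>B. seen (stay_set s \<delta>) n B \<omega>) \<le> fnum n j t \<omega>"
    and "fnum n j t \<omega> \<le> face_count n j (\<lambda>B. seen (hit_set s \<delta>) n B \<omega>)"
proof -
  have eq: "path n B \<omega> t = \<Delta> n B t \<omega>" for B using t by (simp add: path_def)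
  show "face_count n j (\<lambda>B. seen (stay_set s \<delta>) n B \<omega>) \<le> fnum n j t \<omega>"
    unfolding card_faces_complex_at
  proof (rule face_count_mono)
    fix B assume "B \<in> cells n"
    then show "0 \<le> seen (stay_set s \<delta>) n B \<omega> \<and> seen (stay_set s \<delta>) n B \<omega> \<le> of_bool (\<Delta> n B t \<omega> = 1)"
      using good cadlag_stay[of "path n B \<omega>" s \<delta> t] t by (auto simp: seen_def indicator_def eq)
  qed
  show "fnum n j t \<omega> \<le> face_count n j (\<lambda>B. seen (hit_set s \<delta>) n B \<omega>)"
    unfolding card_faces_complex_at
  proof (rule face_count_mono)
    fix B assume "B \<in> cells n"
    then show "0 \<le> (of_bool (\<Delta> n B t \<omega> = 1) :: real) \<and> of_bool (\<Delta> n B t \<omega> = 1) \<le> seen (hit_set s \<delta>) n B \<omega>"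
      using good cadlag_hit[of "path n B \<omega>" s t \<delta>] t by (auto simp: seen_def indicator_def eq)
  qed
qed

lemma AE_uniform:
  assumes J: "k < J" "\<tau> J \<le> - 2" and \<epsilon>: "0 < \<epsilon>"
  shows "AE \<omega> in M. eventually (\<lambda>n. \<forall>t. 0 \<le> t \<and> t < real T \<longrightarrow>
      \<bar>fnum n k t \<omega> - real n powr \<tau> k / fact (Suc k)\<bar> \<le> \<epsilon> * real n powr \<tau> k \<and>
      (\<forall>j. j \<noteq> k \<longrightarrow> fnum n j t \<omega> \<le> \<epsilon> * real n powr \<tau> k) \<and> (\<forall>j\<ge>J. fnum n j t \<omega> = 0)) sequentially"
proof -
  let ?F = "fact (Suc k) :: real"
  let ?N = "2 ^ Suc k :: nat"
  have "((\<lambda>\<eta>::real. (1 + \<eta>) ^ ?N / ?F) \<longlongrightarrow> (1 + 0) ^ ?N / ?F) (at_right 0)"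
    "((\<lambda>\<eta>::real. (1 - \<eta>) ^ ?N / ?F) \<longlongrightarrow> (1 - 0) ^ ?N / ?F) (at_right 0)"
    by (intro tendsto_intros; simp)+
  then have "eventually (\<lambda>\<eta>. (1 + \<eta>) ^ ?N / ?F < 1 / ?F + \<epsilon> / 2) (at_right 0)"
      "eventually (\<lambda>\<eta>. 1 / ?F - \<epsilon> / 2 < (1 - \<eta>) ^ ?N / ?F) (at_right 0)"
    using \<epsilon> by (auto intro: order_tendstoD)
  moreover have "eventually (\<lambda>\<eta>::real. 0 < \<eta> \<and> \<eta> < 1) (at_right 0)"
    by (auto simp: eventually_at_right_field intro!: exI[of _ 1])
  ultimately have "eventually (\<lambda>\<eta>. (1 + \<eta>) ^ ?N / ?F < 1 / ?F + \<epsilon> / 2 \<and>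
      1 / ?F - \<epsilon> / 2 < (1 - \<eta>) ^ ?N / ?F \<and> 0 < \<eta> \<and> \<eta> < 1) (at_right 0)"
    by eventually_elim simp
  \<comment> \<open>Half of \<epsilon> pays for the factors (1 + \<eta>) and (1 - \<eta>) raised to
    2^(k+1), the other half for the random deviation.\<close>
  then obtain \<eta> where \<eta>: "(1 + \<eta>) ^ ?N / ?F < 1 / ?F + \<epsilon> / 2" "1 / ?F - \<epsilon> / 2 < (1 - \<eta>) ^ ?N / ?F" "0 < \<eta>" "\<eta> < 1"
    using eventually_happens'[OF trivial_limit_at_right_real] by blast
  obtain \<delta> where \<delta>: "0 < \<delta>" "\<And>s. 0 \<le> s \<Longrightarrow> s \<le> real T \<Longrightarrow> good_window J \<eta> s \<delta>"
    using ex_good_window[OF \<eta>(3), of "real T" J] by blast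
  \<comment> \<open>Windows [l \<delta>, (l + 1) \<delta>) starting no later than T; finitely many
    of them cover [0, T), so the exceptional sets and the thresholds in n can be merged.\<close>
  let ?L = "{l::nat. real l * \<delta> \<le> real T}"
  have "?L \<subseteq> {..nat \<lceil>real T / \<delta>\<rceil>}"
  proof
    fix l assume "l \<in> ?L"
    then have "real l \<le> real T / \<delta>" using \<delta>(1) by (simp add: field_simps)
    then show "l \<in> {..nat \<lceil>real T / \<delta>\<rceil>}" by (simp add: le_nat_iff) linarith
  qed
  then have finL: "finite ?L" by (rule finite_subset) simp
  let ?hit = "\<lambda>n j l \<omega>. face_count n j (\<lambda>B. seen (hit_set (real l * \<delta>) \<delta>) n B \<omega>)"
  let ?stay = "\<lambda>n j l \<omega>. face_count n j (\<lambda>B. seen (stay_set (real l * \<delta>) \<delta>) n B \<omega>)"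
  let ?ev = "\<lambda>\<omega> l n. ?hit n k l \<omega> \<le> ((1 + \<eta>) ^ ?N / ?F + \<epsilon> / 2) * real n powr \<tau> k \<and>
      ((1 - \<eta>) ^ ?N / ?F - \<epsilon> / 2) * real n powr \<tau> k \<le> ?stay n k l \<omega> \<and>
      (\<forall>j\<in>{..<J} - {k}. ?hit n j l \<omega> \<le> \<epsilon> / 2 * real n powr \<tau> k) \<and> ?hit n J l \<omega> < 1"
  have "AE \<omega> in M. \<forall>l\<in>?L. eventually (?ev \<omega> l) sequentially"
  proof (rule AE_finite_allI[OF finL])
    fix l assume l: "l \<in> ?L"
    show "AE \<omega> in M. eventually (?ev \<omega> l) sequentially"
      by (rule AE_window) (use l \<delta> \<eta> J \<epsilon> in auto)
  qed
  then show ?thesis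
    using AE_paths
  proof eventually_elim
    case (elim \<omega>)
    have "eventually (\<lambda>n. \<forall>l\<in>?L. ?ev \<omega> l n) sequentially"
      by (rule eventually_ball_finite[OF finL elim(1)])
    then show ?case
    proof eventually_elim
      case (elim n)
      show ?case
      proof (intro allI impI)
        fix t assume t: "0 \<le> t \<and> t < real T"
        define l where "l = nat \<lfloor>t / \<delta>\<rfloor>"
        have rl: "real l = of_int \<lfloor>t / \<delta>\<rfloor>" using t \<delta>(1) by (simp add: l_def)
        have "real l \<le> t / \<delta>" "t / \<delta> < real l + 1" unfolding rl by linarith+
        then have lt: "real l * \<delta> \<le> t" "t < real l * \<delta> + \<delta>"
          using \<delta>(1) by (simp_all add: field_simps)
        have lL: "l \<in> ?L" using lt(1) t by simp
        have ev: "?ev \<omega> l n" using elim lL by blast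
        have good: "\<forall>A\<in>cells n. path n A \<omega> \<in> cadlag \<and> (\<forall>t\<ge>0. \<Delta> n A t \<omega> \<in> {0, 1})"
          using \<open>\<forall>n. \<forall>A\<in>cells n. path n A \<omega> \<in> cadlag \<and> (\<forall>t\<ge>0. \<Delta> n A t \<omega> \<in> {0, 1})\<close> by blast
        have s0: "0 \<le> real l * \<delta>" using \<delta>(1) by simp
        note lower = fnum_sandwich(1)[OF good s0 lt]
        note upper = fnum_sandwich(2)[OF good s0 lt]
        let ?n = "real n powr \<tau> k"
        have n0: "0 \<le> ?n" by simp
        have "fnum n k t \<omega> \<le> ((1 + \<eta>) ^ ?N / ?F + \<epsilon> / 2) * ?n"
          using ev upper[of k] by linarith
        also have "\<dots> \<le> (1 / ?F + \<epsilon>) * ?n" using \<eta>(1) by (intro mult_right_mono n0) linarith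
        finally have up: "fnum n k t \<omega> \<le> (1 / ?F + \<epsilon>) * ?n" .
        have "(1 / ?F - \<epsilon>) * ?n \<le> ((1 - \<eta>) ^ ?N / ?F - \<epsilon> / 2) * ?n"
          using \<eta>(2) by (intro mult_right_mono n0) linarith
        also have "\<dots> \<le> fnum n k t \<omega>" using ev lower[of k] by linarith
        finally have low: "(1 / ?F - \<epsilon>) * ?n \<le> fnum n k t \<omega>" .
        have main: "\<bar>fnum n k t \<omega> - ?n / ?F\<bar> \<le> \<epsilon> * ?n"
          using up low by (simp add: abs_le_iff distrib_right left_diff_distrib del: fact_Suc)
        have "fnum n J t \<omega> < 1" using ev upper[of J] by linarith
        \<comment> \<open>A cardinality below 1 is 0.\<close>
        then have "faces (complex_at n (\<lambda>B. \<Delta> n B t \<omega>)) J = {}"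
          by (simp add: finite_faces_complex_at)
        then have zero: "fnum n j t \<omega> = 0" if "J \<le> j" for j
          using faces_empty_above[OF _ that] by simp
        have small: "fnum n j t \<omega> \<le> \<epsilon> * ?n" if "j \<noteq> k" for j
        proof (cases "j < J")
          case True
          then have "?hit n j l \<omega> \<le> \<epsilon> / 2 * ?n" using ev that by blast
          then have "fnum n j t \<omega> \<le> \<epsilon> / 2 * ?n" by (rule order_trans[OF upper])
          also have "\<dots> \<le> \<epsilon> * ?n" using \<epsilon> by (intro mult_right_mono n0) linarith
          finally show ?thesis .
        next
          case False
          then show ?thesis using zero[of j] \<epsilon> by simp
        qed
        show "\<bar>fnum n k t \<omega> - ?n / ?F\<bar> \<le> \<epsilon> * ?n \<and>
          (\<forall>j. j \<noteq> k \<longrightarrow> fnum n j t \<omega> \<le> \<epsilon> * ?n) \<and> (\<forall>j\<ge>J. fnum n j t \<omega> = 0)"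
          using main small zero by blast
      qed
    qed
  qed
qed

lemma AE_statistics_close:
  assumes "0 < \<epsilon>"
  shows "AE \<omega> in M. eventually (\<lambda>n. \<forall>t. 0 \<le> t \<and> t < real T \<longrightarrow>
      \<bar>euler_char n (complex_at n (\<lambda>B. \<Delta> n B t \<omega>)) / real n powr \<tau> k - (-1) ^ k / fact (k + 1)\<bar> \<le> \<epsilon> \<and>
      \<bar>real (reduced_betti (complex_at n (\<lambda>B. \<Delta> n B t \<omega>)) k) / real n powr \<tau> k - 1 / fact (k + 1)\<bar> \<le> \<epsilon>) sequentially"
proof -
  obtain J where J: "k < J" "\<tau> J \<le> - 2" using ex_tau_small by blast
  \<comment> \<open>The divisor 3 + J dominates both 3, for the Betti number, and 1 + J, for the
    Euler characteristic.\<close>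
  define e where "e = \<epsilon> / (3 + real J)"
  have e: "0 < e" using assms by (simp add: e_def)
  have e_le: "(1 + real J) * e \<le> \<epsilon>" "3 * e \<le> \<epsilon>"
    using assms by (simp_all add: e_def field_simps)
  obtain k' where k': "k = Suc k'" using k by (cases k) auto
  show ?thesis using AE_uniform[OF J e, of T]
  proof eventually_elim
    case (elim \<omega>)
    then show ?case using eventually_ge_at_top[of J]
    proof eventually_elim
      case (elim n)
      show ?case
      proof (intro allI impI)
        fix t assume "0 \<le> t \<and> t < real T"
        then have h: "\<bar>fnum n k t \<omega> - real n powr \<tau> k / fact (Suc k)\<bar> \<le> e * real n powr \<tau> k"
            "\<And>j. j \<noteq> k \<Longrightarrow> fnum n j t \<omega> \<le> e * real n powr \<tau> k" "\<And>j. J \<le> j \<Longrightarrow> fnum n j t \<omega> = 0"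
          using elim(1) by blast+
        have n: "0 < real n powr \<tau> k" using elim(2) J(1) by simp
        have scale: "\<bar>x / real n powr \<tau> k - c\<bar> \<le> \<epsilon>"
          if "\<bar>x - c * real n powr \<tau> k\<bar> \<le> m * (e * real n powr \<tau> k)" "m * e \<le> \<epsilon>" for x c m
        proof -
          have "\<bar>x / real n powr \<tau> k - c\<bar> = \<bar>x - c * real n powr \<tau> k\<bar> / real n powr \<tau> k"
            using n by (simp add: field_simps flip: abs_div_pos)
          also have "\<dots> \<le> m * (e * real n powr \<tau> k) / real n powr \<tau> k"
            using n by (intro divide_right_mono that(1)) simp
          also have "\<dots> \<le> \<epsilon>" using n that(2) by simp
          finally show ?thesis .
        qed
        have "\<bar>euler_char n (complex_at n (\<lambda>B. \<Delta> n B t \<omega>)) - (-1) ^ k * (real n powr \<tau> k / fact (Suc k))\<bar>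
            \<le> (1 + real J) * (e * real n powr \<tau> k)"
          by (rule euler_char_close[OF J(1) elim(2) h])
        moreover have "\<bar>real (reduced_betti (complex_at n (\<lambda>B. \<Delta> n B t \<omega>)) k) - real n powr \<tau> k / fact (Suc k)\<bar>
            \<le> 3 * (e * real n powr \<tau> k)"
          by (rule reduced_betti_close[OF k' h(1) h(2) h(2)]) (use k' in simp_all)
        ultimately show "\<bar>euler_char n (complex_at n (\<lambda>B. \<Delta> n B t \<omega>)) / real n powr \<tau> k - (-1) ^ k / fact (k + 1)\<bar> \<le> \<epsilon> \<and>
            \<bar>real (reduced_betti (complex_at n (\<lambda>B. \<Delta> n B t \<omega>)) k) / real n powr \<tau> k - 1 / fact (k + 1)\<bar> \<le> \<epsilon>"
          by (intro conjI scale[OF _ e_le(1)] scale[OF _ e_le(2)]) (simp_all del: fact_Suc)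
      qed
    qed
  qed
qed

lemma AE_limitin:
  assumes close: "\<And>T \<epsilon>. 0 < \<epsilon> \<Longrightarrow> AE \<omega> in M. eventually (\<lambda>n. \<forall>t. 0 \<le> t \<and> t < real T \<longrightarrow>
      \<bar>g n (complex_at n (\<lambda>B. \<Delta> n B t \<omega>)) - c\<bar> \<le> \<epsilon>) sequentially"
  shows "AE \<omega> in M. limitin skorohod_J1 (\<lambda>n. \<lambda>t\<in>{0..}. g n (complex_at n (\<lambda>B. \<Delta> n B t \<omega>))) (\<lambda>t\<in>{0..}. c) sequentially"
proof -
  \<comment> \<open>Countably many horizons and tolerances 1 / (m + 1) allow one null set for all T
    and \<epsilon>.\<close>
  have "AE \<omega> in M. \<forall>T m::nat. eventually (\<lambda>n. \<forall>t. 0 \<le> t \<and> t < real T \<longrightarrow>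
      \<bar>g n (complex_at n (\<lambda>B. \<Delta> n B t \<omega>)) - c\<bar> \<le> 1 / real (Suc m)) sequentially"
    unfolding AE_all_countable by (intro allI close) simp
  then show ?thesis
    using AE_paths
  proof eventually_elim
    case (elim \<omega>)
    show ?case
    proof (rule limitin_skorohod_const)
      show "eventually (\<lambda>n. (\<lambda>t\<in>{0..}. g n (complex_at n (\<lambda>B. \<Delta> n B t \<omega>))) \<in> cadlag) sequentially"
      proof (rule always_eventually, rule allI)
        fix n
        show "(\<lambda>t\<in>{0..}. g n (complex_at n (\<lambda>B. \<Delta> n B t \<omega>))) \<in> cadlag"
        proof (rule cadlag_finite_state[OF finite_cells[of n], where X = "\<lambda>B t. \<Delta> n B t \<omega>" and F = "\<lambda>X. g n (complex_at n X)"])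
          show "(\<lambda>t\<in>{0..}. \<Delta> n B t \<omega>) \<in> cadlag" if "B \<in> cells n" for B
            using elim(2) that unfolding path_def by blast
          show "\<Delta> n B t \<omega> \<in> {0, 1}" if "B \<in> cells n" "0 \<le> t" for B t
            using elim(2) that by blast
          show "g n (complex_at n Y) = g n (complex_at n Z)" if "\<And>B. B \<in> cells n \<Longrightarrow> Y B = Z B" for Y Z
            using complex_at_cong[OF that] by simp
        qed
      qed
      fix T :: nat and \<epsilon> :: real assume "0 < \<epsilon>"
      then obtain m where m: "1 / real (Suc m) < \<epsilon>" by (meson nat_approx_posE)
      show "eventually (\<lambda>n. \<forall>t. 0 \<le> t \<and> t < real T \<longrightarrow>
          \<bar>(\<lambda>t\<in>{0..}. g n (complex_at n (\<lambda>B. \<Delta> n B t \<omega>))) t - c\<bar> \<le> \<epsilon>) sequentially"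
        using elim(1)[rule_format, of T m]
      proof eventually_elim
        case (elim n)
        show ?case
        proof (intro allI impI)
          fix t assume t: "0 \<le> t \<and> t < real T"
          then have "\<bar>g n (complex_at n (\<lambda>B. \<Delta> n B t \<omega>)) - c\<bar> \<le> 1 / real (Suc m)" using elim by blast
          then show "\<bar>(\<lambda>t\<in>{0..}. g n (complex_at n (\<lambda>B. \<Delta> n B t \<omega>))) t - c\<bar> \<le> \<epsilon>"
            using m t by simp
        qed
      qed
    qed
  qed
qed

end

theorem theorem4p1:
  fixes M :: "'w measure"
    and \<alpha> :: "nat \<Rightarrow> ereal"
    and \<nu> :: "nat \<Rightarrow> real measure"
    and \<Delta> :: "nat \<Rightarrow> nat set \<Rightarrow> real \<Rightarrow> 'w \<Rightarrow> real"
    and k :: nat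
  assumes "prob_space M"
    and "\<And>i. i \<ge> 1 \<Longrightarrow> 0 \<le> \<alpha> i"
    and "\<exists>i\<ge>1. \<alpha> i \<noteq> 0"
    and "\<And>i. i \<ge> 1 \<Longrightarrow> positive_finite_mean_law (\<nu> i)"
    and "\<exists>a>0. \<forall>i\<ge>q_index \<alpha>. cdf (\<nu> i) a \<le> 1 / 2"
    and "dynamic_processes M \<alpha> \<nu> \<Delta>"
    and "k \<ge> q_index \<alpha>"
    and "\<alpha> \<in> param_region k"
  shows "(AE \<omega> in M. limitin skorohod_J1
            (\<lambda>n. \<lambda>t\<in>{0..}. euler_char n (complex_at n (\<lambda>A. \<Delta> n A t \<omega>))
                              / real n powr real_of_ereal (tau k \<alpha>))
            (\<lambda>t\<in>{0..}. (-1) ^ k / fact (k + 1)) sequentially) \<and>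
         (AE \<omega> in M. limitin skorohod_J1
            (\<lambda>n. \<lambda>t\<in>{0..}. real (reduced_betti (complex_at n (\<lambda>A. \<Delta> n A t \<omega>)) k)
                              / real n powr real_of_ereal (tau k \<alpha>))
            (\<lambda>t\<in>{0..}. 1 / fact (k + 1)) sequentially)"
proof -
  obtain i where i: "1 \<le> i" "\<alpha> i \<noteq> 0" using assms(3) by blast
  have "1 \<le> i \<and> 0 < \<alpha> i" using i assms(2)[OF i(1)] by (simp add: less_le)
  then have "1 \<le> q_index \<alpha> \<and> 0 < \<alpha> (q_index \<alpha>)" unfolding q_index_def by (rule LeastI)
  \<comment> \<open>The index q is itself at least 1, hence k - 1 is a dimension and the Morse
    inequality around k makes sense.\<close>
  then have k: "1 \<le> k" using assms(7) by simp
  interpret prob_space M by (rule assms(1))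
  interpret dynamic_complex M \<alpha> \<nu> \<Delta> k
    using assms k by unfold_locales auto
  show ?thesis
    unfolding tau_dominant
  proof
    show "AE \<omega> in M. limitin skorohod_J1
        (\<lambda>n. \<lambda>t\<in>{0..}. euler_char n (complex_at n (\<lambda>A. \<Delta> n A t \<omega>)) / real n powr \<tau> k)
        (\<lambda>t\<in>{0..}. (-1) ^ k / fact (k + 1)) sequentially"
    proof (rule AE_limitin[where g = "\<lambda>n K. euler_char n K / real n powr \<tau> k"])
      fix T :: nat and \<epsilon> :: real assume \<epsilon>: "0 < \<epsilon>"
      show "AE \<omega> in M. eventually (\<lambda>n. \<forall>t. 0 \<le> t \<and> t < real T \<longrightarrow>
          \<bar>euler_char n (complex_at n (\<lambda>B. \<Delta> n B t \<omega>)) / real n powr \<tau> k - (-1) ^ k / fact (k + 1)\<bar> \<le> \<epsilon>) sequentially"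
        using AE_statistics_close[OF \<epsilon>, of T] by eventually_elim (erule eventually_mono, blast)
    qed
    show "AE \<omega> in M. limitin skorohod_J1
        (\<lambda>n. \<lambda>t\<in>{0..}. real (reduced_betti (complex_at n (\<lambda>A. \<Delta> n A t \<omega>)) k) / real n powr \<tau> k)
        (\<lambda>t\<in>{0..}. 1 / fact (k + 1)) sequentially"
    proof (rule AE_limitin[where g = "\<lambda>n K. real (reduced_betti K k) / real n powr \<tau> k"])
      fix T :: nat and \<epsilon> :: real assume \<epsilon>: "0 < \<epsilon>"
      show "AE \<omega> in M. eventually (\<lambda>n. \<forall>t. 0 \<le> t \<and> t < real T \<longrightarrow>
          \<bar>real (reduced_betti (complex_at n (\<lambda>B. \<Delta> n B t \<omega>)) k) / real n powr \<tau> k - 1 / fact (k + 1)\<bar> \<le> \<epsilon>) sequentially"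
        using AE_statistics_close[OF \<epsilon>, of T] by eventually_elim (erule eventually_mono, blast)
    qed
  qed
qed

end
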